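(* There are at least $71$ pairwise inequivalent $s$-extremal singly even self-dual $[56,28,10]$ codes.
   Context: All codes are binary: an $[n,m]$ code is an $m$-dimensional subspace $C$ of $\mathbb{F}_2^n$, and it is an $[n,m,d]$ code if its minimum non-zero weight $d(C)$ is $d$. Two codes are equivalent if one can be obtained from the other by permuting the coordinates. The dual is $C^\perp=\{x\in\mathbb{F}_2^n \mid x\cdot y=0 \text{ for all } y\in C\}$ for the standard inner product, and $C$ is self-dual if $C=C^\perp$. A self-dual code is singly even if some codeword has weight $\equiv 2\pmod 4$. For a singly even self-dual code $C$, let $C_0$ be the subcode (of codimension 1) of codewords of weight $\equiv 0\pmod 4$; the shadow of $C$ is $S=C_0^\perp\setminus C$, and $d(S)$ is the minimum non-zero weight of the vectors in $S$. A singly even self-dual code $C$ of length $n$ satisfies $d(S)\le \frac n2+4-2d(C)$ unless $n\equiv 22\pmod{24}$ and $d(C)=4\lfloor n/24\rfloor+6$; outside this exceptional case, $C$ is called $s$-extremal if $d(S)=\frac n2+4-2d(C)$. *)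

theory Defs
  imports "HOL-Analysis.Analysis" "HOL-Library.Z2"
begin

text \<open>The space \<open>bit ^ 'n\<close> with \<open>CARD('n) = n\<close> plays the role of the
  space of binary vectors of length \<open>n\<close>.\<close>

definition weight :: "bit ^ 'n \<Rightarrow> nat" where
  "weight x = card {i. x $ i \<noteq> 0}"

text \<open>Minimum non-zero weight; meaningful only if \<open>X\<close> contains a non-zero vector.\<close>

definition min_weight :: "(bit ^ 'n) set \<Rightarrow> nat" where
  "min_weight X = Min (weight ` (X - {0}))"

definition is_code :: "nat \<Rightarrow> nat \<Rightarrow> nat \<Rightarrow> (bit ^ 'n) set \<Rightarrow> bool" where
  "is_code n m d C \<longleftrightarrow>
     CARD('n) = n \<and> vec.subspace C \<and> vec.dim C = m \<and> min_weight C = d"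

definition code_equiv :: "(bit ^ 'n) set \<Rightarrow> (bit ^ 'n) set \<Rightarrow> bool" where
  "code_equiv C D \<longleftrightarrow> (\<exists>p :: 'n \<Rightarrow> 'n. bij p \<and> D = (\<lambda>x. \<chi> i. x $ p i) ` C)"

definition dual :: "(bit ^ 'n) set \<Rightarrow> (bit ^ 'n) set" where
  "dual C = {x. \<forall>y\<in>C. (\<Sum>i\<in>UNIV. x $ i * y $ i) = 0}"

definition self_dual :: "(bit ^ 'n) set \<Rightarrow> bool" where
  "self_dual C \<longleftrightarrow> C = dual C"

definition singly_even :: "(bit ^ 'n) set \<Rightarrow> bool" where
  "singly_even C \<longleftrightarrow> (\<exists>x\<in>C. weight x mod 4 = 2)"

definition doubly_even_part :: "(bit ^ 'n) set \<Rightarrow> (bit ^ 'n) set" where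
  "doubly_even_part C = {x\<in>C. weight x mod 4 = 0}"

definition shadow :: "(bit ^ 'n) set \<Rightarrow> (bit ^ 'n) set" where
  "shadow C = dual (doubly_even_part C) - C"

text \<open>In the excluded case the bound \<open>d(S) \<le> n/2 + 4 - 2 d(C)\<close> on the minimum
  weight of the shadow can fail, and being s-extremal is not defined.\<close>

definition s_extremal :: "(bit ^ 'n) set \<Rightarrow> bool" where
  "s_extremal C \<longleftrightarrow>
     self_dual C \<and> singly_even C \<and>
     \<not> (CARD('n) mod 24 = 22 \<and> min_weight C = 4 * (CARD('n) div 24) + 6) \<and>
     real (min_weight (shadow C)) = real CARD('n) / 2 + 4 - 2 * real (min_weight C)"

end

theory Submission
  imports Defs
begin

text \<open>A \<open>28 \<times> 28\<close> binary matrix \<open>M\<close> that is symmetric and satisfies \<open>M\<^sup>2 = 1\<close> gives the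
self-dual code \<open>C = {(u, u M)}\<close> of length 56.  If every row of \<open>M\<close> has weight 1 modulo 4, the weight
of \<open>(u, u M)\<close> is congruent to \<open>2 |u|\<close> modulo 4.  So the doubly even part of \<open>C\<close> is cut out by the
inner product with \<open>h = (1, \<dots>, 1, 0, \<dots>, 0)\<close>, and the shadow of \<open>C\<close> is the coset \<open>h + C\<close>
(\<open>shadow_eq\<close>).

Both minimum weights follow from one finite check: for \<open>0 < |u| \<le> 4\<close> the weight of \<open>u M\<close> lies
between \<open>10 - |u|\<close> and \<open>19 + |u|\<close>.  A word of \<open>C\<close> of weight below 10 has at most four ones in one of
its halves, and by \<open>M\<^sup>2 = 1\<close> each half determines the other one through \<open>M\<close>.  Complementing the left
half turns the upper bound into a lower bound of 9 for the weights in the shadow, which are multiples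
of 4 and hence at least 12.  As \<open>12 = 56/2 + 4 - 2 * 10\<close>, the code is \<open>s\<close>-extremal
(\<open>code_properties\<close>).  The matrices \<open>M\<close> consist of \<open>7 \<times> 7\<close> blocks whose entry at \<open>(i, j)\<close> depends only
on \<open>i + j\<close> modulo 7.  Shifting all blocks of \<open>u\<close> cyclically then shifts those of \<open>u M\<close> backwards, so
that only one \<open>u\<close> of each orbit has to be looked at (\<open>small_supports\<close>).

Inequivalent codes are told apart by the \<^emph>\<open>pair energy\<close>: for every pair of coordinates count the words of
weight 10 that contain both, and add up the squares of these numbers.  It is computable from a list of
all words of weight 10, and the length of that list is known in advance: an \<open>s\<close>-extremal
\<open>[56, 28, 10]\<close> code has exactly 308 words of weight 10 (\<open>card_weight_10\<close>).  Indeed the doubly even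
part \<open>D\<close> has dual distance 10, and the numbers \<open>56 - 2 |x|\<close> for \<open>x\<close> in \<open>D\<close> take the values
\<open>0, \<plusminus>8, \<plusminus>16, \<plusminus>24, \<plusminus>32\<close> apart from \<open>\<plusminus>56\<close>; summing the polynomial of degree 10 that
vanishes at the former values over \<open>D\<close> leaves the number of words of weight 10 as the only unknown.
So 44 words of weight 10 in distinct orbits of the cyclic shift account for all of them
(\<open>pair_energy_code\<close>).

Each of the 71 codes comes with a certificate: the blocks of \<open>M\<close>, the 44 words, a word of weight 12 of
the shadow, and the pair energy divided by 7.  A certificate is checked by rewriting
(\<open>certified_eval\<close>), and the energies of the 71 codes are pairwise distinct.\<close>

declare add_bit_eq_xor [simp del] mult_bit_eq_and [simp del]

section \<open>Binary vectors, characters and walks on the hypercube\<close>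

lemma bit_add_self [simp]: "(b::bit) + b = 0"
  by (cases b) (simp_all add: one_add_one)

lemma UNIV_bit: "(UNIV :: bit set) = {0, 1}"
  by auto

instance bit :: finite
  by standard (simp add: UNIV_bit)

lemma vec_add_self [simp]: "(x :: bit ^ 'n) + x = 0"
  by (simp add: vec_eq_iff)

lemma vec_add_self_left [simp]: "(x :: bit ^ 'n) + (x + y) = y"
  by (simp flip: add.assoc)

definition ip :: "bit ^ 'n \<Rightarrow> bit ^ 'n \<Rightarrow> bit" where
  "ip x y = (\<Sum>i\<in>UNIV. x $ i * y $ i)"

lemma ip_comm: "ip x y = ip y x"
  by (simp add: ip_def mult.commute)

lemma ip_add_left: "ip (x + y) z = ip x z + ip y z"
  by (simp add: ip_def distrib_right sum.distrib)

lemma ip_add_right: "ip x (y + z) = ip x y + ip x z"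
  by (simp add: ip_def distrib_left sum.distrib)

lemma ip_0 [simp]: "ip 0 x = 0" "ip x 0 = 0"
  by (simp_all add: ip_def)

lemma ip_axis [simp]: "ip x (axis i 1) = x $ i" "ip (axis i 1) x = x $ i"
  by (simp_all add: ip_def axis_def if_distrib if_distribR cong: if_cong)

lemma dual_ip: "dual C = {x. \<forall>y\<in>C. ip x y = 0}"
  by (simp add: dual_def ip_def)

definition bit_sign :: "bit \<Rightarrow> int" where
  "bit_sign b = (if b = 0 then 1 else -1)"

lemma bit_sign_simps [simp]: "bit_sign 0 = 1" "bit_sign 1 = -1"
  by (simp_all add: bit_sign_def)

lemma bit_sign_add: "bit_sign (a + b) = bit_sign a * bit_sign b"
  by (cases a; cases b) simp_all

lemma weight_0 [simp]: "weight (0 :: bit ^ 'n) = 0"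
  by (simp add: weight_def)

lemma weight_eq_0 [simp]: "weight x = 0 \<longleftrightarrow> x = 0"
  by (auto simp: weight_def vec_eq_iff)

lemma sum_bit_sign: "(\<Sum>i\<in>UNIV. bit_sign (x $ i)) = int CARD('n) - 2 * int (weight x)" for x :: "bit ^ 'n"
proof -
  have "(\<Sum>i\<in>UNIV. bit_sign (x $ i)) = (\<Sum>i\<in>UNIV. 1 - 2 * of_bool (x $ i \<noteq> 0))"
    by (intro sum.cong refl) (auto simp: bit_sign_def)
  also have "\<dots> = int CARD('n) - 2 * (\<Sum>i\<in>UNIV. of_bool (x $ i \<noteq> 0))"
    by (simp add: sum_subtractf sum_distrib_left)
  also have "(\<Sum>i\<in>UNIV. of_bool (x $ i \<noteq> 0)) = int (weight x)"
    by (simp add: weight_def of_bool_def flip: sum.inter_filter)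
  finally show ?thesis .
qed

text \<open>The number of walks of length \<open>k\<close> from \<open>0\<close> to \<open>y\<close> in the hypercube, whose edges flip one
  coordinate.  These numbers are the coefficients in the expansion of the \<open>k\<close>-th power of
  \<open>n - 2 |x|\<close> into characters of \<open>x\<close>, which turns a power moment of the weights of a code
  into a statement about its dual.\<close>

primrec walks :: "nat \<Rightarrow> bit ^ 'n \<Rightarrow> nat" where
  "walks 0 y = of_bool (y = 0)"
| "walks (Suc k) y = (\<Sum>i\<in>UNIV. walks k (y + axis i 1))"

text \<open>Multiplying by \<open>\<Sum>i. (-1)\<^bsup>x i\<^esup>\<close> prolongs every walk by one edge: the character at \<open>y\<close>
  times the \<open>i\<close>-th sign is the character at the neighbour of \<open>y\<close> in direction \<open>i\<close>.\<close>

lemma power_sum_bit_sign: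
  "(\<Sum>i\<in>UNIV. bit_sign (x $ i)) ^ k = (\<Sum>y\<in>UNIV. int (walks k y) * bit_sign (ip x y))" for x :: "bit ^ 'n"
proof (induction k)
  case 0
  have "(\<Sum>y\<in>UNIV. int (walks 0 y) * bit_sign (ip x y)) = (\<Sum>y\<in>UNIV. if y = (0 :: bit ^ 'n) then 1 else 0)"
    by (intro sum.cong refl) simp
  then show ?case by simp
next
  case (Suc k)
  have "(\<Sum>y\<in>UNIV. int (walks (Suc k) y) * bit_sign (ip x y))
      = (\<Sum>y\<in>UNIV. \<Sum>i\<in>UNIV. int (walks k (y + axis i 1)) * bit_sign (ip x y))"
    by (simp add: sum_distrib_right)
  also have "\<dots> = (\<Sum>i\<in>UNIV. \<Sum>y\<in>UNIV. int (walks k (y + axis i 1)) * bit_sign (ip x y))"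
    by (rule sum.swap)
  also have "\<dots> = (\<Sum>i\<in>UNIV. \<Sum>y\<in>UNIV. int (walks k y) * (bit_sign (ip x y) * bit_sign (x $ i)))"
  proof (rule sum.cong[OF refl])
    fix i
    show "(\<Sum>y\<in>UNIV. int (walks k (y + axis i 1)) * bit_sign (ip x y))
        = (\<Sum>y\<in>UNIV. int (walks k y) * (bit_sign (ip x y) * bit_sign (x $ i)))"
      by (rule sum.reindex_bij_witness[of _ "\<lambda>y. y + axis i 1" "\<lambda>y. y + axis i 1"])
        (simp_all add: add.assoc ip_add_right bit_sign_add flip: mult.assoc, simp add: mult.assoc bit_sign_def)
  qed
  also have "\<dots> = (\<Sum>i\<in>UNIV. bit_sign (x $ i)) * (\<Sum>y\<in>UNIV. int (walks k y) * bit_sign (ip x y))"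
    by (simp add: sum_product mult_ac)
  finally show ?case using Suc by simp
qed

lemma weight_add_axis:
  "weight (y + axis i 1) = (if y $ i = 0 then Suc (weight y) else weight y - 1)" for y :: "bit ^ 'n"
proof (cases "y $ i = 0")
  case True
  have "{j. (y + axis i 1) $ j \<noteq> 0} = insert i {j. y $ j \<noteq> 0}"
    using True by (auto simp: axis_def)
  then show ?thesis using True by (simp add: weight_def)
next
  case False
  have "{j. (y + axis i 1) $ j \<noteq> 0} = {j. y $ j \<noteq> 0} - {i}"
    using False by (auto simp: axis_def)
  then show ?thesis using False by (simp add: weight_def)
qed

text \<open>By symmetry a walk count depends on the end point only through its weight \<open>w\<close>; the last step
  came from one of \<open>w\<close> points of weight \<open>w - 1\<close> or from one of \<open>n - w\<close> points of weight \<open>w + 1\<close>.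
  This recursion is what evaluates the counts for \<open>n = 56\<close>.\<close>

primrec walk_count :: "nat \<Rightarrow> nat \<Rightarrow> nat \<Rightarrow> nat" where
  "walk_count n 0 w = of_bool (w = 0)"
| "walk_count n (Suc k) w = w * walk_count n k (w - 1) + (n - w) * walk_count n k (Suc w)"

lemma walks_eq: "walks k y = walk_count CARD('n) k (weight y)" for y :: "bit ^ 'n"
proof (induction k arbitrary: y)
  case (Suc k)
  have "card {i. y $ i = 0} = CARD('n) - weight y"
    using card_Diff_subset[of "{i. y $ i \<noteq> 0}" UNIV] by (simp add: weight_def Compl_eq_Diff_UNIV[symmetric] Collect_neg_eq[symmetric] del: bit_not_zero_iff)
  moreover have "card (- {i. y $ i = 0}) = weight y"
    by (simp add: weight_def Collect_neg_eq[symmetric])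
  moreover have "walks (Suc k) y = (\<Sum>i\<in>UNIV. if y $ i = 0
      then walk_count CARD('n) k (Suc (weight y)) else walk_count CARD('n) k (weight y - 1))"
    by (simp add: Suc.IH weight_add_axis if_distrib cong: if_cong)
  ultimately show ?case
    by (simp add: sum.If_cases)
qed simp

lemma walk_count_short: "k < w \<Longrightarrow> walk_count n k w = 0"
  by (induction k arbitrary: w) auto

lemma walk_count_geodesic: "walk_count n k k = fact k"
  by (induction k) (simp_all add: walk_count_short)

lemma walks_short: "k < weight y \<Longrightarrow> walks k y = 0"
  by (simp add: walks_eq walk_count_short)

text \<open>A walk of length \<open>|y|\<close> to \<open>y\<close> flips each coordinate of the support once, in any order.\<close>

lemma walks_geodesic: "weight y = k \<Longrightarrow> walks k y = fact k"
  by (auto simp add: walks_eq walk_count_geodesic)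

text \<open>If some \<open>c\<close> in \<open>C\<close> is not orthogonal to \<open>y\<close>, translation by \<open>c\<close> changes the sign of the sum.\<close>

lemma sum_bit_sign_ip:
  fixes C :: "(bit ^ 'n) set"
  assumes "\<And>x y. x \<in> C \<Longrightarrow> y \<in> C \<Longrightarrow> x + y \<in> C"
  shows "(\<Sum>x\<in>C. bit_sign (ip x y)) = (if y \<in> dual C then int (card C) else 0)"
proof (cases "y \<in> dual C")
  case True
  then have "(\<Sum>x\<in>C. bit_sign (ip x y)) = (\<Sum>x\<in>C. 1)"
    by (intro sum.cong) (auto simp: dual_ip ip_comm[of _ y])
  then show ?thesis using True by simp
next
  case False
  then obtain c where c: "c \<in> C" "ip c y = 1"
    by (auto simp: dual_ip ip_comm[of y])
  have "(\<Sum>x\<in>C. bit_sign (ip x y)) = (\<Sum>x\<in>C. - bit_sign (ip x y))"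
    by (rule sum.reindex_bij_witness[of _ "\<lambda>x. c + x" "\<lambda>x. c + x"])
      (use c assms in \<open>auto simp: ip_add_left bit_sign_add\<close>)
  also have "\<dots> = - (\<Sum>x\<in>C. bit_sign (ip x y))"
    by (simp add: sum_negf)
  finally show ?thesis using False by simp
qed

text \<open>The power moment form of the MacWilliams identities.\<close>

lemma code_moment:
  fixes C :: "(bit ^ 'n) set"
  assumes "\<And>x y. x \<in> C \<Longrightarrow> y \<in> C \<Longrightarrow> x + y \<in> C"
  shows "(\<Sum>x\<in>C. (int CARD('n) - 2 * int (weight x)) ^ k)
       = int (card C) * int (\<Sum>y\<in>dual C. walks k y)"
proof -
  have "(\<Sum>x\<in>C. (int CARD('n) - 2 * int (weight x)) ^ k)
      = (\<Sum>x\<in>C. \<Sum>y\<in>UNIV. int (walks k y) * bit_sign (ip x y))"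
    by (simp add: sum_bit_sign[symmetric] power_sum_bit_sign)
  also have "\<dots> = (\<Sum>y\<in>UNIV. int (walks k y) * (\<Sum>x\<in>C. bit_sign (ip x y)))"
    by (subst sum.swap) (simp add: sum_distrib_left)
  also have "\<dots> = (\<Sum>y\<in>UNIV. if y \<in> dual C then int (walks k y) * int (card C) else 0)"
    by (intro sum.cong refl) (simp add: sum_bit_sign_ip[OF assms])
  also have "\<dots> = (\<Sum>y\<in>dual C. int (walks k y) * int (card C))"
    by (subst sum.inter_filter[symmetric]) auto
  finally show ?thesis by (simp add: sum_distrib_left mult.commute)
qed

text \<open>Both sides arise by summing all characters \<open>(-1)\<^bsup>x y\<^esup>\<close> over \<open>x\<close> in \<open>C\<close> and all \<open>y\<close>, in the two
  possible orders.\<close>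

lemma card_code_dual:
  fixes C :: "(bit ^ 'n) set"
  assumes "\<And>x y. x \<in> C \<Longrightarrow> y \<in> C \<Longrightarrow> x + y \<in> C" "0 \<in> C"
  shows "card C * card (dual C) = 2 ^ CARD('n)"
proof -
  have u: "dual (UNIV :: (bit ^ 'n) set) = {0}"
  proof -
    have "x = 0" if "\<forall>y. ip x y = 0" for x :: "bit ^ 'n"
      using that[THEN spec, of "axis _ 1"] by (simp add: vec_eq_iff)
    then show ?thesis by (auto simp: dual_ip)
  qed
  have card: "card (UNIV :: (bit ^ 'n) set) = 2 ^ CARD('n)"
    by (simp add: UNIV_bit numeral_2_eq_2)
  have "int (card C * card (dual C)) = (\<Sum>y\<in>UNIV. if y \<in> dual C then int (card C) else 0)"
    by (subst sum.inter_filter[symmetric]) (auto simp: mult.commute)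
  also have "\<dots> = (\<Sum>y\<in>UNIV. \<Sum>x\<in>C. bit_sign (ip x y))"
    by (simp add: sum_bit_sign_ip[OF assms(1)])
  also have "\<dots> = (\<Sum>x\<in>C. \<Sum>y\<in>UNIV. bit_sign (ip y x))"
    by (subst sum.swap) (simp add: ip_comm)
  also have "\<dots> = (\<Sum>x\<in>C. if x = 0 then 2 ^ CARD('n) else 0)"
    by (intro sum.cong refl, subst sum_bit_sign_ip) (simp_all add: u card del: card_UNIV CARD_vec)
  also have "\<dots> = 2 ^ CARD('n)"
    using assms(2) by simp
  finally have "int (card C * card (dual C)) = int (2 ^ CARD('n))" by simp
  then show ?thesis by (simp only: of_nat_eq_iff)
qed

text \<open>Up to the minimum distance \<open>d\<close> of the dual, short walks end at \<open>0\<close> or, for \<open>k = d\<close>, at a dual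
  word of weight \<open>d\<close>; so the moments reveal nothing but the number of these words.\<close>

lemma moment_dual_distance:
  fixes C :: "(bit ^ 'n) set"
  assumes C: "\<And>x y. x \<in> C \<Longrightarrow> y \<in> C \<Longrightarrow> x + y \<in> C"
    and d: "\<And>y. y \<in> dual C \<Longrightarrow> y \<noteq> 0 \<Longrightarrow> d \<le> weight y" and k: "k \<le> d"
  shows "(\<Sum>x\<in>C. (int CARD('n) - 2 * int (weight x)) ^ k) = int (card C) *
     (int (walks k (0 :: bit ^ 'n)) + (if k = d then fact d * int (card {y\<in>dual C - {0}. weight y = d}) else 0))"
proof -
  have 0: "0 \<in> dual C" by (simp add: dual_ip)
  have eq: "walks k y = (if k = d \<and> weight y = d then fact d else 0)" if "y \<in> dual C - {0}" for y
    using d[of y] that k walks_short[of k y] walks_geodesic[of y k]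
    by (cases "weight y = k") auto
  have "(\<Sum>y\<in>dual C. walks k y) = walks k (0 :: bit ^ 'n) + (\<Sum>y\<in>dual C - {0}. walks k y)"
    using 0 by (intro sum.remove) auto
  also have "(\<Sum>y\<in>dual C - {0}. walks k y) = (\<Sum>y\<in>dual C - {0}. if k = d \<and> weight y = d then fact d else 0)"
    by (intro sum.cong refl eq)
  also have "\<dots> = (if k = d then fact d * card {y\<in>dual C - {0}. weight y = d} else 0)"
    by (simp flip: sum.inter_filter)
  finally show ?thesis
    by (simp add: code_moment[OF C])
qed

text \<open>The coordinates with respect to a basis are arbitrary functions from the basis to a field with
  two elements.\<close>

lemma card_subspace:
  fixes C :: "(bit ^ 'n) set"
  assumes "vec.subspace C"
  shows "card C = 2 ^ vec.dim C"
proof -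
  obtain B where B: "B \<subseteq> C" "vec.independent B" "C \<subseteq> vec.span B" "card B = vec.dim C"
    by (rule vec.basis_exists)
  have fin: "finite B" by simp
  have span: "vec.span B = C"
    using B assms by (meson subset_antisym vec.span_minimal)
  let ?f = "\<lambda>u. \<Sum>v\<in>B. u v *s v"
  have "bij_betw ?f (B \<rightarrow>\<^sub>E UNIV) C"
  proof (rule bij_betw_imageI)
    show "inj_on ?f (B \<rightarrow>\<^sub>E UNIV)"
    proof (rule inj_onI)
      fix u w assume uw: "u \<in> B \<rightarrow>\<^sub>E UNIV" "w \<in> B \<rightarrow>\<^sub>E UNIV" "?f u = ?f w"
      have "(\<Sum>v\<in>B. (u v - w v) *s v) = 0"
        using uw(3) by (simp only: vec.scale_left_diff_distrib sum_subtractf right_minus_eq)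
      then have "u v - w v = 0" if "v \<in> B" for v
        using vec.independentD[OF B(2) fin subset_refl, of "\<lambda>v. u v - w v" v] that by blast
      then have "u v = w v" if "v \<in> B" for v
        using that by (metis right_minus_eq)
      then show "u = w"
        using uw(1,2) by (metis PiE_ext)
    qed
    show "?f ` (B \<rightarrow>\<^sub>E UNIV) = C"
    proof -
      have "?f u \<in> ?f ` (B \<rightarrow>\<^sub>E UNIV)" for u
        by (rule image_eqI[of _ _ "restrict u B"]) (auto cong: sum.cong)
      then show ?thesis
        unfolding span[symmetric] vec.span_finite[OF fin] by auto
    qed
  qed
  then have "card C = card (B \<rightarrow>\<^sub>E (UNIV :: bit set))"
    by (simp add: bij_betw_same_card)
  also have "\<dots> = 2 ^ card B"
    by (simp add: card_PiE UNIV_bit numeral_2_eq_2)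
  finally show ?thesis using B(4) by simp
qed

section \<open>Self-dual codes and the number of words of weight 10\<close>

lemma subspace_dual: "vec.subspace (dual C)"
  by (rule vec.subspaceI)
    (auto simp: dual_ip ip_add_left, simp add: ip_def mult.assoc flip: sum_distrib_left)

lemma ip_ones: "ip x (\<chi> i. 1) = of_nat (weight x)"
proof -
  have "ip x (\<chi> i. 1) = (\<Sum>i\<in>UNIV. of_bool (x $ i \<noteq> 0))"
    unfolding ip_def by (intro sum.cong refl) auto
  also have "\<dots> = of_nat (weight x)"
    by (simp add: weight_def of_bool_def flip: sum.inter_filter)
  finally show ?thesis .
qed

lemma weight_complement: "weight ((\<chi> i. 1) + x) = CARD('n) - weight x" for x :: "bit ^ 'n"
proof -
  have "{i. ((\<chi> i. 1) + x) $ i \<noteq> 0} = UNIV - {i. x $ i \<noteq> 0}"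
    by auto
  then show ?thesis by (simp add: weight_def card_Diff_subset)
qed

lemma weight_le: "weight x \<le> CARD('n)" for x :: "bit ^ 'n"
  by (simp add: weight_def card_mono)

context
  fixes C :: "(bit ^ 'n) set" and s :: "bit ^ 'n"
  assumes sd: "self_dual C"
    and wt: "\<And>x. x \<in> C \<Longrightarrow> weight x mod 4 = (if ip x s = 0 then 0 else 2)"
    and sC: "s \<notin> C"
begin

lemma self_dual_iff: "x \<in> C \<longleftrightarrow> (\<forall>y\<in>C. ip x y = 0)"
proof -
  have "x \<in> C \<longleftrightarrow> x \<in> dual C"
    using sd unfolding self_dual_def by (rule arg_cong)
  then show ?thesis by (simp add: dual_ip)
qed

lemma self_dual_add: "x \<in> C \<Longrightarrow> y \<in> C \<Longrightarrow> x + y \<in> C"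
  using self_dual_iff[of x] self_dual_iff[of y] self_dual_iff[of "x + y"] by (simp add: ip_add_left)

lemma self_dual_add_iff: "x \<in> C \<Longrightarrow> x + y \<in> C \<longleftrightarrow> y \<in> C"
  using self_dual_add[of x y] self_dual_add[of x "x + y"] by auto

lemma self_dual_0: "0 \<in> C"
  by (subst self_dual_iff) simp

lemma self_dual_ip: "x \<in> C \<Longrightarrow> y \<in> C \<Longrightarrow> ip x y = 0"
  using self_dual_iff by blast

lemma doubly_even_part_eq: "doubly_even_part C = {x\<in>C. ip x s = 0}"
proof -
  have "weight x mod 4 = 0 \<longleftrightarrow> ip x s = 0" if "x \<in> C" for x
    using wt[OF that] by (cases "ip x s") simp_all
  then show ?thesis unfolding doubly_even_part_def by (intro Collect_cong conj_cong refl)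
qed

lemma obtain_not_orthogonal: obtains c where "c \<in> C" "ip c s = 1"
proof -
  obtain c where "c \<in> C" "ip s c \<noteq> 0" using sC self_dual_iff[of s] by blast
  then show ?thesis using that[of c] by (simp add: ip_comm)
qed

text \<open>A vector \<open>y\<close> of the dual of the doubly even part induces on \<open>C\<close> a functional that vanishes
  where \<open>s\<close> does.  Such a functional is either zero or equal to the one of \<open>s\<close>, so \<open>y\<close> or \<open>s + y\<close> is
  orthogonal to \<open>C\<close>.\<close>

lemma dual_doubly_even_part: "dual (doubly_even_part C) = C \<union> (+) s ` C"
proof -
  obtain c where c: "c \<in> C" "ip c s = 1" by (rule obtain_not_orthogonal)
  have "y \<in> C \<or> s + y \<in> C" if y: "y \<in> dual (doubly_even_part C)" for y
  proof -
    have y0: "ip y x = 0" if "x \<in> C" "ip x s = 0" for x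
      using y that by (auto simp: dual_ip doubly_even_part_eq)
    have yc: "ip y x = (if ip x s = 0 then 0 else ip y c)" if "x \<in> C" for x
      using y0[of x] y0[of "x + c"] that c self_dual_add
      by (cases "ip y x"; cases "ip y c"; cases "ip x s") (simp_all add: ip_add_left ip_add_right)
    show ?thesis
    proof (cases "ip y c = 0")
      case True
      then show ?thesis using yc self_dual_iff[of y] by simp
    next
      case False
      then have "ip (s + y) x = 0" if "x \<in> C" for x
        using yc[OF that] ip_comm[of s x] by (cases "ip x s") (simp_all add: ip_add_left)
      then show ?thesis using self_dual_iff[of "s + y"] by blast
    qed
  qed
  then have "y \<in> C \<union> (+) s ` C" if "y \<in> dual (doubly_even_part C)" for y
    using that by (metis UnI1 UnI2 imageI vec_add_self_left)
  moreover have "y \<in> dual (doubly_even_part C)" if "y \<in> C \<union> (+) s ` C" for y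
    using that ip_comm[of s] by (auto simp: dual_ip doubly_even_part_eq self_dual_ip ip_add_left)
  ultimately show ?thesis by blast
qed

lemma shadow_eq: "shadow C = (+) s ` C"
proof -
  have "s + x \<notin> C" if "x \<in> C" for x
    using self_dual_add_iff[OF that, of s] sC by (metis add.commute)
  then show ?thesis unfolding shadow_def dual_doubly_even_part by blast
qed

lemma singly_even_self_dual: "singly_even C"
proof -
  obtain c where "c \<in> C" "ip c s = 1" by (rule obtain_not_orthogonal)
  then have "weight c mod 4 = 2" using wt[of c] by simp
  with \<open>c \<in> C\<close> show ?thesis unfolding singly_even_def by blast
qed

lemma card_self_dual: "card C ^ 2 = 2 ^ CARD('n)"
proof -
  have "dual C = C" using sd unfolding self_dual_def by (rule sym)
  moreover have "card C * card (dual C) = 2 ^ CARD('n)"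
    by (rule card_code_dual[OF self_dual_add self_dual_0])
  ultimately show ?thesis by (simp only: power2_eq_square)
qed

lemma card_doubly_even_part: "2 * card (doubly_even_part C) = card C"
proof -
  have D: "x + y \<in> doubly_even_part C" if "x \<in> doubly_even_part C" "y \<in> doubly_even_part C" for x y
    using that by (auto simp: doubly_even_part_eq self_dual_add ip_add_left)
  have 0: "0 \<in> doubly_even_part C" by (simp add: doubly_even_part_eq self_dual_0)
  have "C \<inter> (+) s ` C = {}"
    using shadow_eq by (auto simp: shadow_def)
  then have "card (dual (doubly_even_part C)) = 2 * card C"
    by (simp add: dual_doubly_even_part card_Un_disjoint card_image)
  then have "card (doubly_even_part C) * (2 * card C) = card C * card C"
    using card_code_dual[OF D 0] card_self_dual by (simp only: power2_eq_square)
  moreover have "card C \<noteq> 0" using self_dual_0 by auto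
  ultimately show ?thesis by simp
qed

lemma ones_doubly_even: "CARD('n) mod 4 = 0 \<Longrightarrow> (\<chi> i. 1) \<in> doubly_even_part C"
proof -
  assume n: "CARD('n) mod 4 = 0"
  have "ip (\<chi> i. 1) x = 0" if "x \<in> C" for x
  proof -
    have "weight x mod 4 = 0 \<or> weight x mod 4 = 2"
      using wt[OF that] by (cases "ip x s") simp_all
    then have "even (weight x)" by presburger
    then obtain k where "weight x = 2 * k" by (rule evenE)
    then have "ip x (\<chi> i. 1) = 0" by (simp add: ip_ones)
    then show ?thesis by (simp only: ip_comm[of x])
  qed
  then have "(\<chi> i. 1) \<in> C"
    by (subst self_dual_iff) (rule ballI)
  moreover have "weight ((\<chi> i. 1) :: bit ^ 'n) = CARD('n)"
    by (simp add: weight_def)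
  ultimately show ?thesis using n by (simp add: doubly_even_part_def)
qed

end

text \<open>The recursion in a form that the simplifier can apply to numerals.\<close>

lemma walk_count_numeral: "walk_count n (numeral k) w =
    w * walk_count n (pred_numeral k) (w - 1) + (n - w) * walk_count n (pred_numeral k) (Suc w)"
  by (simp add: numeral_eq_Suc)

lemma closed_walks_56:
  "walks 2 (0 :: bit ^ 56) = 56" "walks 4 (0 :: bit ^ 56) = 9296"
  "walks 6 (0 :: bit ^ 56) = 2541056" "walks 8 (0 :: bit ^ 56) = 960692096"
  "walks 10 (0 :: bit ^ 56) = 461301779456"
  by (simp_all add: walks_eq walk_count_numeral)

text \<open>It vanishes at \<open>56 - 2 w\<close> for \<open>w = 12, 16, \<dots>, 44\<close>.  The root \<open>0\<close> is double to make the degree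
  even: then \<open>0\<close> and the all-one word contribute equally instead of cancelling, and the degree
  reaches the dual distance 10.\<close>

definition annihilator :: "int \<Rightarrow> int" where
  "annihilator z = z^2 * (z^2 - 64) * (z^2 - 256) * (z^2 - 576) * (z^2 - 1024)"

text \<open>The two words \<open>0\<close> and \<open>1\<close> of the doubly even part give the whole sum of the annihilator, and
  expanding it into moments gives \<open>2\<^bsup>27\<^esup> (1117670400 + 10! A)\<close> with the number \<open>A\<close> of words of weight
  10.\<close>

lemma card_weight_10:
  fixes C :: "(bit ^ 56) set"
  assumes sd: "self_dual C"
    and wt: "\<And>x. x \<in> C \<Longrightarrow> weight x mod 4 = (if ip x s = 0 then 0 else 2)"
    and sC: "s \<notin> C"
    and d: "\<And>x. x \<in> C \<Longrightarrow> x \<noteq> 0 \<Longrightarrow> 10 \<le> weight x"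
    and ds: "\<And>x. x \<in> C \<Longrightarrow> 12 \<le> weight (s + x)"
  shows "card {x\<in>C. weight x = 10} = 308"
proof -
  have C56: "CARD(56) = 56" by simp
  define D where "D = doubly_even_part C"
  note D_eq = doubly_even_part_eq[OF sd wt sC, folded D_def]
  define A where "A = card {x\<in>C. weight x = 10}"
  have D_add: "x + y \<in> D" if "x \<in> D" "y \<in> D" for x y
    using that self_dual_add[OF sd wt sC] by (auto simp: D_eq ip_add_left)
  have dualD: "dual D = C \<union> (+) s ` C"
    unfolding D_def by (rule dual_doubly_even_part[OF sd wt sC])
  have dD: "10 \<le> weight y" if "y \<in> dual D" "y \<noteq> 0" for y
    using that d ds unfolding dualD by force
  have "card C ^ 2 = (2 ^ 28) ^ 2"
    using card_self_dual[OF sd wt sC] by simp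
  then have "card C = 2 ^ 28"
    using power2_eq_imp_eq by blast
  then have cardD: "card D = 2 ^ 27"
    using card_doubly_even_part[OF sd wt sC] by (simp add: D_def)
  have "{y\<in>dual D - {0}. weight y = 10} = {x\<in>C. weight x = 10}"
    using ds unfolding dualD by (force)
  then have A: "card {y\<in>dual D - {0}. weight y = 10} = A"
    by (simp add: A_def)
  let ?z = "\<lambda>x :: bit ^ 56. 56 - 2 * int (weight x)"
  have moment: "(\<Sum>x\<in>D. ?z x ^ k) = 2 ^ 27 *
      (int (walks k (0 :: bit ^ 56)) + (if k = 10 then fact 10 * int A else 0))" if "k \<le> 10" for k
    using moment_dual_distance[OF D_add dD that, unfolded A cardD] by simp
  have ones: "(\<chi> i. 1) \<in> D"
    unfolding D_def by (rule ones_doubly_even[OF sd wt sC]) (simp_all only: C56, simp)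
  have w1: "weight ((\<chi> i. 1) :: bit ^ 56) = 56" by (simp add: weight_def)
  have zero: "annihilator (?z x) = 0" if x: "x \<in> D" "x \<noteq> 0" "x \<noteq> (\<chi> i. 1)" for x
  proof -
    have "(\<chi> i. 1) + x \<noteq> 0"
      using x(3) by (metis vec_add_self_left add.right_neutral)
    then have "10 \<le> weight ((\<chi> i. 1) + x)"
      using d[of "(\<chi> i. 1) + x"] D_add[OF ones x(1)] by (simp add: D_eq)
    moreover have "10 \<le> weight x" using x d by (auto simp: D_eq)
    moreover have "weight x mod 4 = 0" using x by (simp add: D_def doubly_even_part_def)
    \<comment> \<open>A word other than \<open>0\<close> and \<open>1\<close> has weight at least 10, and so has its complement.\<close>
    ultimately have "weight x \<in> {12, 16, 20, 24, 28, 32, 36, 40, 44}"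
      using weight_le[of x] unfolding weight_complement by simp presburger
    then show ?thesis by (auto simp: annihilator_def)
  qed
  have "(\<Sum>x\<in>D. annihilator (?z x)) = (\<Sum>x\<in>{0, \<chi> i. 1}. annihilator (?z x))"
  proof (rule sum.mono_neutral_right)
    show "{0, \<chi> i. 1} \<subseteq> D" using ones by (simp add: D_eq self_dual_0[OF sd wt sC])
  qed (use zero in auto)
  also have "\<dots> = 300022363481702400"
  proof -
    have "(0 :: bit ^ 56) \<noteq> (\<chi> i. 1)" by (simp add: vec_eq_iff)
    then show ?thesis by (simp add: w1 annihilator_def)
  qed
  finally have lhs: "(\<Sum>x\<in>D. annihilator (?z x)) = 300022363481702400" .
  \<comment> \<open>The coefficients of the annihilator; the moments are known up to the term with the unknown.\<close>
  have "(\<Sum>x\<in>D. annihilator (?z x)) = (\<Sum>x\<in>D. ?z x ^ 10 - 1920 * ?z x ^ 8 + 1118208 * ?z x ^ 6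
      - 214958080 * ?z x ^ 4 + 9663676416 * ?z x ^ 2)"
    by (intro sum.cong refl) (simp add: annihilator_def, algebra)
  also have "\<dots> = (\<Sum>x\<in>D. ?z x ^ 10) - 1920 * (\<Sum>x\<in>D. ?z x ^ 8) + 1118208 * (\<Sum>x\<in>D. ?z x ^ 6)
      - 214958080 * (\<Sum>x\<in>D. ?z x ^ 4) + 9663676416 * (\<Sum>x\<in>D. ?z x ^ 2)"
    by (simp only: sum.distrib sum_subtractf sum_distrib_left)
  also have "\<dots> = 2 ^ 27 * (1117670400 + 3628800 * int A)"
    by (simp add: moment closed_walks_56 fact_numeral)
  finally show ?thesis using lhs by (simp add: A_def)
qed

section \<open>Codes from symmetric orthogonal matrices\<close>

text \<open>An arbitrary numbering of the 56 coordinates.  The numbers below 28 are the left half, on which the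
  words of a code take arbitrary values; the right half depends on it.\<close>

definition pos :: "nat \<Rightarrow> 56" where
  "pos = (SOME e. bij_betw e {..<56} UNIV)"

lemma bij_pos: "bij_betw pos {..<56} UNIV"
proof -
  obtain h :: "nat \<Rightarrow> 56" where "bij_betw h {0..<card (UNIV :: 56 set)} UNIV"
    using ex_bij_betw_nat_finite[of "UNIV :: 56 set"] by auto
  then have "bij_betw h {..<56} UNIV" by (simp add: lessThan_atLeast0)
  then show ?thesis unfolding pos_def by (rule someI[of "\<lambda>e. bij_betw e {..<56} UNIV"])
qed

lemma pos_eq_iff: "p < 56 \<Longrightarrow> q < 56 \<Longrightarrow> pos p = pos q \<longleftrightarrow> p = q"
  using bij_pos by (auto simp: bij_betw_def inj_on_def)

lemma sum_pos: "(\<Sum>q\<in>UNIV. f q) = (\<Sum>p<56. f (pos p))"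
  by (rule sum.reindex_bij_betw[OF bij_pos, symmetric])

lemma sum_halves: "(\<Sum>p<56. f p) = (\<Sum>i<28. f i) + (\<Sum>j<28. f (28 + j))" for f :: "nat \<Rightarrow> 'a :: comm_monoid_add"
proof -
  have "{..<56::nat} = {..<28} \<union> {28..<56}" by auto
  then have "(\<Sum>p<56. f p) = (\<Sum>i<28. f i) + (\<Sum>j\<in>{28..<56}. f j)"
    by (simp add: sum.union_disjoint ivl_disj_int)
  also have "(\<Sum>j\<in>{28..<56}. f j) = (\<Sum>j<28. f (28 + j))"
    by (rule sum.reindex_bij_witness[of _ "\<lambda>j. 28 + j" "\<lambda>j. j - 28"]) auto
  finally show ?thesis .
qed

lemma pos_cases: obtains i where "i < 28" "q = pos i" | j where "j < 28" "q = pos (28 + j)"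
proof -
  obtain p where p: "p < 56" "q = pos p"
    using bij_betw_imp_surj_on[OF bij_pos] by blast
  show ?thesis
  proof (cases "p < 28")
    case True
    then show ?thesis using p that(1) by blast
  next
    case False
    then show ?thesis using p that(2)[of "p - 28"] by auto
  qed
qed

definition left :: "bit ^ 56 \<Rightarrow> nat set" where
  "left x = {i. i < 28 \<and> x $ pos i = 1}"

definition right :: "bit ^ 56 \<Rightarrow> nat set" where
  "right x = {j. j < 28 \<and> x $ pos (28 + j) = 1}"

definition vec_of :: "nat set \<Rightarrow> nat set \<Rightarrow> bit ^ 56" where
  "vec_of U V = (\<chi> q. of_bool ((\<exists>i\<in>U. i < 28 \<and> q = pos i) \<or> (\<exists>j\<in>V. j < 28 \<and> q = pos (28 + j))))"

lemma left_sub: "left x \<subseteq> {..<28}" and right_sub: "right x \<subseteq> {..<28}"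
  by (auto simp: left_def right_def)

lemma finite_left [simp]: "finite (left x)" and finite_right [simp]: "finite (right x)"
  by (rule finite_subset[OF left_sub], simp) (rule finite_subset[OF right_sub], simp)

lemma vec_of_left: "i < 28 \<Longrightarrow> vec_of U V $ pos i = of_bool (i \<in> U)"
proof -
  assume i: "i < 28"
  have "(\<exists>k\<in>U. k < 28 \<and> pos i = pos k) \<longleftrightarrow> i \<in> U"
  proof
    assume "\<exists>k\<in>U. k < 28 \<and> pos i = pos k"
    then obtain k where k: "k \<in> U" "k < 28" "pos i = pos k" by blast
    then have "i = k" using i pos_eq_iff[of i k] by linarith
    then show "i \<in> U" using k by simp
  qed (use i in blast)
  moreover have "\<not> (\<exists>j\<in>V. j < 28 \<and> pos i = pos (28 + j))"
  proof
    assume "\<exists>j\<in>V. j < 28 \<and> pos i = pos (28 + j)"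
    then obtain j where "j < 28" "pos i = pos (28 + j)" by blast
    then show False using i pos_eq_iff[of i "28 + j"] by simp
  qed
  ultimately show ?thesis unfolding vec_of_def vec_lambda_beta by (simp only: simp_thms)
qed

lemma vec_of_right: "j < 28 \<Longrightarrow> vec_of U V $ pos (28 + j) = of_bool (j \<in> V)"
proof -
  assume j: "j < 28"
  have "(\<exists>k\<in>V. k < 28 \<and> pos (28 + j) = pos (28 + k)) \<longleftrightarrow> j \<in> V"
  proof
    assume "\<exists>k\<in>V. k < 28 \<and> pos (28 + j) = pos (28 + k)"
    then obtain k where k: "k \<in> V" "k < 28" "pos (28 + j) = pos (28 + k)" by blast
    then have "28 + j = 28 + k" using j pos_eq_iff[of "28 + j" "28 + k"] by linarith
    then show "j \<in> V" using k by simp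
  qed (use j in blast)
  moreover have "\<not> (\<exists>i\<in>U. i < 28 \<and> pos (28 + j) = pos i)"
  proof
    assume "\<exists>i\<in>U. i < 28 \<and> pos (28 + j) = pos i"
    then obtain i where "i < 28" "pos (28 + j) = pos i" by blast
    then show False using j pos_eq_iff[of "28 + j" i] by simp
  qed
  ultimately show ?thesis unfolding vec_of_def vec_lambda_beta by (simp only: simp_thms)
qed

lemma left_vec_of [simp]: "left (vec_of U V) = U \<inter> {..<28}"
  unfolding left_def by (auto simp: vec_of_left)

lemma right_vec_of [simp]: "right (vec_of U V) = V \<inter> {..<28}"
  unfolding right_def by (auto simp: vec_of_right)

lemma vec_eqI: "left x = left y \<Longrightarrow> right x = right y \<Longrightarrow> x = y"
proof -
  assume l: "left x = left y" and r: "right x = right y"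
  have "x $ q = y $ q" for q
  proof (rule pos_cases[of q])
    fix i assume "i < 28" "q = pos i"
    moreover have "i \<in> left x \<longleftrightarrow> i \<in> left y" using l by (simp only:)
    ultimately show ?thesis by (cases "x $ q"; cases "y $ q") (simp_all add: left_def)
  next
    fix j assume "j < 28" "q = pos (28 + j)"
    moreover have "j \<in> right x \<longleftrightarrow> j \<in> right y" using r by (simp only:)
    ultimately show ?thesis by (cases "x $ q"; cases "y $ q") (simp_all add: right_def)
  qed
  then show ?thesis by (simp add: vec_eq_iff)
qed

lemma left_0 [simp]: "left 0 = {}" and right_0 [simp]: "right 0 = {}"
  by (auto simp: left_def right_def)

lemma bit_sum_1: "(a :: bit) + b = 1 \<longleftrightarrow> (a = 1) \<noteq> (b = 1)"
  by (cases a; cases b) simp_all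

lemma left_add: "left (x + y) = (left x - left y) \<union> (left y - left x)"
  and right_add: "right (x + y) = (right x - right y) \<union> (right y - right x)"
  by (auto simp: left_def right_def bit_sum_1)

lemma weight_left_right: "weight x = card (left x) + card (right x)"
proof -
  have "weight x = (\<Sum>q\<in>UNIV. of_bool (x $ q = 1))"
    by (simp add: weight_def of_bool_def flip: sum.inter_filter)
  also have "\<dots> = (\<Sum>i<28. of_bool (x $ pos i = 1)) + (\<Sum>j<28. of_bool (x $ pos (28 + j) = 1))"
    by (simp only: sum_pos sum_halves)
  also have "(\<Sum>i<28. of_bool (x $ pos i = 1)) = card (left x)"
    by (simp add: left_def of_bool_def lessThan_def flip: sum.inter_filter)
  also have "(\<Sum>j<28. of_bool (x $ pos (28 + j) = 1)) = card (right x)"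
    by (simp add: right_def of_bool_def lessThan_def flip: sum.inter_filter)
  finally show ?thesis .
qed

lemma of_nat_bit: "(of_nat n :: bit) = of_bool (odd n)"
  by (induction n) auto

lemma bit_eq_iff_1: "a = b \<longleftrightarrow> (a = 1 \<longleftrightarrow> b = 1)" for a b :: bit
  by (cases a; cases b) simp_all

lemma bit_add_eq_0: "a + b = 0 \<Longrightarrow> a = b" for a b :: bit
  by (cases a; cases b) simp_all

lemma sum_bit_eq_card: "finite A \<Longrightarrow> (\<Sum>i\<in>A. f i) = (of_nat (card {i\<in>A. f i = 1}) :: bit)"
proof -
  assume "finite A"
  have "f i = (if f i = 1 then 1 else 0)" for i
    by (cases "f i") simp_all
  then have "(\<Sum>i\<in>A. f i) = (\<Sum>i\<in>A. if f i = 1 then 1 else 0)"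
    by (rule sum.cong[OF refl])
  also have "\<dots> = (\<Sum>i\<in>{i\<in>A. f i = 1}. 1)"
    by (rule sum.inter_filter[OF \<open>finite A\<close>, symmetric])
  finally show ?thesis by (simp only: sum_constant mult_1_right)
qed

text \<open>This is \<open>|A \<union> B - A \<inter> B| = |A| + |B| - 2 |A \<inter> B|\<close> modulo 4 for an even intersection.\<close>

lemma symdiff_mod_4:
  fixes a b c e A B :: nat
  assumes "c = a + b" "a + e = A" "b + e = B" "even e" "B mod 4 = 1"
  shows "c mod 4 = (A + 1) mod 4"
proof -
  obtain k where "e = 2 * k" using assms(4) by (rule evenE)
  then have "A + B = c + 4 * k" using assms(1-3) by simp
  then have "c mod 4 = (A + B) mod 4" by simp
  also have "\<dots> = (A + B mod 4) mod 4" by (simp add: mod_add_right_eq)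
  finally show ?thesis using assms(5) by simp
qed

lemma add_mod_4:
  fixes a b :: nat
  assumes "b mod 4 = a mod 4"
  shows "(a + b) mod 4 = (if even a then 0 else 2)"
proof -
  have "(a + b) mod 4 = (a + b mod 4) mod 4" by (simp only: mod_add_right_eq)
  also have "\<dots> = (a + a) mod 4" by (simp only: assms mod_add_right_eq)
  also have "\<dots> = 2 * (a mod 2)" using mult_mod_right[of 2 a 2] by (simp add: mult_2)
  finally show ?thesis by (simp add: odd_iff_mod_2_eq_one)
qed

locale symmetric_orthogonal =
  fixes M :: "nat \<Rightarrow> nat \<Rightarrow> bit"
  assumes sym: "\<And>i j. i < 28 \<Longrightarrow> j < 28 \<Longrightarrow> M i j = M j i"
    and orth: "\<And>i k. i < 28 \<Longrightarrow> k < 28 \<Longrightarrow> (\<Sum>j<28. M i j * M j k) = of_bool (i = k)"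
    and row_weight: "\<And>i. i < 28 \<Longrightarrow> card {j. j < 28 \<and> M i j = 1} mod 4 = 1"
begin

text \<open>The support of \<open>u M\<close> for the vector \<open>u\<close> with support \<open>U\<close>.\<close>

definition img :: "nat set \<Rightarrow> nat set" where
  "img U = {j. j < 28 \<and> (\<Sum>i\<in>U. M i j) = 1}"

definition code :: "(bit ^ 56) set" where
  "code = {x. right x = img (left x)}"

lemma img_sub: "img U \<subseteq> {..<28}" by (auto simp: img_def)

lemma finite_img [simp]: "finite (img U)"
  using img_sub by (rule finite_subset) simp

lemma img_empty [simp]: "img {} = {}" by (simp add: img_def)

lemma sum_left: "(\<Sum>i\<in>left x. f i) = (\<Sum>i<28. x $ pos i * f i)"
proof -
  have "(\<Sum>i<28. x $ pos i * f i) = (\<Sum>i<28. if x $ pos i = 1 then f i else 0)"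
    by (rule sum.cong[OF refl]) auto
  also have "\<dots> = (\<Sum>i\<in>left x. f i)"
    by (simp add: left_def lessThan_def flip: sum.inter_filter)
  finally show ?thesis by simp
qed

lemma code_iff: "x \<in> code \<longleftrightarrow> (\<forall>j<28. x $ pos (28 + j) = (\<Sum>i<28. x $ pos i * M i j))"
proof -
  have "x \<in> code \<longleftrightarrow> (\<forall>j<28. x $ pos (28 + j) = 1 \<longleftrightarrow> (\<Sum>i\<in>left x. M i j) = 1)"
    by (auto simp: code_def right_def img_def)
  also have "\<dots> \<longleftrightarrow> (\<forall>j<28. x $ pos (28 + j) = (\<Sum>i\<in>left x. M i j))"
    by (subst bit_eq_iff_1) (rule refl)
  finally show ?thesis by (simp only: sum_left)
qed

lemma img_mult:
  assumes "U \<subseteq> {..<28}" "k < 28"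
  shows "(\<Sum>j\<in>img U. M j k) = of_bool (k \<in> U)"
proof -
  have fin: "finite U" using assms(1) by (rule finite_subset) simp
  have "(\<Sum>j\<in>img U. M j k) = (\<Sum>j<28. if (\<Sum>i\<in>U. M i j) = 1 then M j k else 0)"
    by (simp add: img_def lessThan_def flip: sum.inter_filter)
  also have "\<dots> = (\<Sum>j<28. (\<Sum>i\<in>U. M i j) * M j k)"
    by (rule sum.cong[OF refl]) auto
  also have "\<dots> = (\<Sum>i\<in>U. \<Sum>j<28. M i j * M j k)"
    by (subst sum.swap) (simp add: sum_distrib_right)
  also have "\<dots> = (\<Sum>i\<in>U. of_bool (i = k))"
    by (rule sum.cong[OF refl], subst orth) (use assms in auto)
  also have "\<dots> = of_bool (k \<in> U)"
    using fin by (simp add: of_bool_def)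
  finally show ?thesis .
qed

lemma img_img: "U \<subseteq> {..<28} \<Longrightarrow> img (img U) = U"
proof -
  assume U: "U \<subseteq> {..<28}"
  have "img (img U) = {k. k < 28 \<and> (\<Sum>j\<in>img U. M j k) = 1}"
    by (subst img_def) (rule refl)
  also have "\<dots> = {k. k < 28 \<and> k \<in> U}"
    using img_mult[OF U] by auto
  finally show ?thesis using U by auto
qed

lemma img_symdiff:
  assumes "finite U" "finite W"
  shows "img ((U - W) \<union> (W - U)) = (img U - img W) \<union> (img W - img U)"
proof -
  have "(\<Sum>i\<in>(U - W) \<union> (W - U). M i j) = (\<Sum>i\<in>U. M i j) + (\<Sum>i\<in>W. M i j)" for j
  proof -
    have "(\<Sum>i\<in>(U - W) \<union> (W - U). M i j) = (\<Sum>i\<in>U - W. M i j) + (\<Sum>i\<in>W - U. M i j)"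
      using assms by (intro sum.union_disjoint) auto
    moreover have "(\<Sum>i\<in>U. M i j) = (\<Sum>i\<in>U - W. M i j) + (\<Sum>i\<in>U \<inter> W. M i j)"
      using sum.Int_Diff[OF assms(1), of "\<lambda>i. M i j" W] by (simp only: add.commute)
    moreover have "(\<Sum>i\<in>W. M i j) = (\<Sum>i\<in>W - U. M i j) + (\<Sum>i\<in>U \<inter> W. M i j)"
      using sum.Int_Diff[OF assms(2), of "\<lambda>i. M i j" U] by (simp only: add.commute Int_commute)
    ultimately show ?thesis
      by (simp add: algebra_simps)
  qed
  then show ?thesis by (auto simp: img_def bit_sum_1)
qed

text \<open>Distinct rows of an orthogonal matrix overlap evenly, so weights of sums of rows add modulo 4, and
  each row contributes 1.\<close>

lemma card_img_mod_4: "U \<subseteq> {..<28} \<Longrightarrow> card (img U) mod 4 = card U mod 4"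
proof -
  assume U: "U \<subseteq> {..<28}"
  then have "finite U" by (rule finite_subset) simp
  then show ?thesis using U
  proof induction
    case (insert a U)
    let ?A = "img U" and ?B = "img {a}"
    have a: "a < 28" and sub: "U \<subseteq> {..<28}" using insert.prems by auto
    have "img (insert a U) = (?A - ?B) \<union> (?B - ?A)"
      using img_symdiff[of U "{a}"] insert.hyps by (simp add: Un_commute)
    then have "card (img (insert a U)) = card (?A - ?B) + card (?B - ?A)"
      by (simp add: card_Un_disjoint Diff_Int_distrib2)
    moreover have "card (?A - ?B) + card (?A \<inter> ?B) = card ?A"
      using card_Int_Diff[of ?A ?B] by simp
    moreover have "card (?B - ?A) + card (?A \<inter> ?B) = card ?B"
      using card_Int_Diff[of ?B ?A] by (simp add: Int_commute)
    moreover have "even (card (?A \<inter> ?B))"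
    proof -
      have "(\<Sum>j\<in>?A. M j a) = (\<Sum>j\<in>?A. M a j)"
        by (rule sum.cong[OF refl]) (use a img_sub sym in blast)
      also have "\<dots> = of_nat (card {j\<in>?A. M a j = 1})"
        by (rule sum_bit_eq_card) simp
      also have "{j\<in>?A. M a j = 1} = ?A \<inter> ?B"
        using img_sub[of U] by (auto simp: img_def)
      finally have "(of_nat (card (?A \<inter> ?B)) :: bit) = 0"
        using img_mult[OF sub a] insert.hyps by simp
      then show ?thesis by (simp add: of_nat_bit)
    qed
    moreover have "card ?B mod 4 = 1"
      using row_weight[OF a] by (simp add: img_def)
    ultimately have "card (img (insert a U)) mod 4 = (card ?A + 1) mod 4"
      by (rule symdiff_mod_4)
    then show ?case
      using insert.IH[OF sub] insert.hyps by (simp add: mod_Suc)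
  qed simp
qed

text \<open>The rows of \<open>M\<close> have odd weight and \<open>M\<close> is symmetric, so the sum of all rows is the all-one
  vector.\<close>

lemma img_complement: "U \<subseteq> {..<28} \<Longrightarrow> img ({..<28} - U) = {..<28} - img U"
proof -
  assume U: "U \<subseteq> {..<28}"
  have "(\<Sum>i<28. M i j) = 1" if "j < 28" for j
  proof -
    have "(\<Sum>i<28. M i j) = (\<Sum>i<28. M j i)"
      by (rule sum.cong[OF refl]) (use that sym in auto)
    also have "\<dots> = of_nat (card {i\<in>{..<28}. M j i = 1})"
      by (rule sum_bit_eq_card) simp
    also have "{i\<in>{..<28}. M j i = 1} = {i. i < 28 \<and> M j i = 1}" by auto
    moreover have "odd (card {i. i < 28 \<and> M j i = 1})"
      using row_weight[OF that] by presburger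
    ultimately show ?thesis by (simp add: of_nat_bit)
  qed
  then have full: "img {..<28} = {..<28}" by (auto simp: img_def)
  have "img ({..<28} - U \<union> (U - {..<28})) = (img {..<28} - img U) \<union> (img U - img {..<28})"
    by (rule img_symdiff) (use U in \<open>auto intro: finite_subset\<close>)
  moreover have "U - {..<28} = {}" using U by auto
  moreover have "img U - {..<28} = {}" using img_sub by auto
  ultimately show ?thesis by (simp only: full Un_empty_right)
qed

lemma ip_split: "ip x y = (\<Sum>i<28. x $ pos i * y $ pos i) + (\<Sum>j<28. x $ pos (28 + j) * y $ pos (28 + j))"
  unfolding ip_def by (simp only: sum_pos sum_halves)

text \<open>Orthogonality of the rows makes the code self-orthogonal.  Conversely a vector \<open>(v, w)\<close> that is
  orthogonal to the generators \<open>(e\<^sub>i, M\<^sub>i)\<close> satisfies \<open>v = M w\<close>, hence \<open>v M = w\<close>.\<close>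

lemma self_dual_code: "self_dual code"
proof -
  have code_orth: "ip x y = 0" if x: "x \<in> code" and y: "y \<in> code" for x y
  proof -
    have "(\<Sum>j<28. x $ pos (28 + j) * y $ pos (28 + j))
        = (\<Sum>j<28. (\<Sum>i<28. x $ pos i * M i j) * (\<Sum>k<28. y $ pos k * M k j))"
      using x y unfolding code_iff by (intro sum.cong[OF refl]) (simp only: lessThan_iff)
    also have "\<dots> = (\<Sum>j<28. \<Sum>i<28. \<Sum>k<28. x $ pos i * y $ pos k * (M i j * M k j))"
      by (simp only: sum_product mult_ac)
    also have "\<dots> = (\<Sum>i<28. \<Sum>k<28. \<Sum>j<28. x $ pos i * y $ pos k * (M i j * M k j))"
      by (subst sum.swap, rule sum.cong[OF refl], rule sum.swap)
    also have "\<dots> = (\<Sum>i<28. \<Sum>k<28. x $ pos i * y $ pos k * (\<Sum>j<28. M i j * M k j))"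
      by (simp only: sum_distrib_left)
    also have "\<dots> = (\<Sum>i<28. \<Sum>k<28. x $ pos i * y $ pos k * of_bool (i = k))"
    proof (rule sum.cong[OF refl], rule sum.cong[OF refl])
      fix i k :: nat assume ik: "i \<in> {..<28}" "k \<in> {..<28}"
      have "(\<Sum>j<28. M i j * M k j) = (\<Sum>j<28. M i j * M j k)"
        by (rule sum.cong[OF refl]) (use ik sym[of k] in simp)
      then show "x $ pos i * y $ pos k * (\<Sum>j<28. M i j * M k j) = x $ pos i * y $ pos k * of_bool (i = k)"
        using ik orth by simp
    qed
    also have "\<dots> = (\<Sum>i<28. x $ pos i * y $ pos i)"
      by (rule sum.cong[OF refl]) (simp add: of_bool_def if_distrib cong: if_cong)
    finally show ?thesis by (simp add: ip_split)
  qed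
  have dual_code: "y \<in> code" if y: "\<And>x. x \<in> code \<Longrightarrow> ip x y = 0" for y
  proof -
    have yi: "y $ pos i = (\<Sum>j<28. M i j * y $ pos (28 + j))" if i: "i < 28" for i
    proof -
      \<comment> \<open>The generator with left half \<open>e\<^sub>i\<close>.\<close>
      let ?g = "vec_of {i} (img {i})"
      have "?g \<in> code" using i img_sub by (auto simp: code_def)
      then have "ip ?g y = 0" by (rule y)
      moreover have "(\<Sum>k<28. ?g $ pos k * y $ pos k) = y $ pos i"
      proof -
        have "(\<Sum>k\<in>left ?g. y $ pos k) = y $ pos i" using i by simp
        then show ?thesis by (simp only: sum_left)
      qed
      moreover have "(\<Sum>j<28. ?g $ pos (28 + j) * y $ pos (28 + j)) = (\<Sum>j<28. M i j * y $ pos (28 + j))"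
      proof (rule sum.cong[OF refl])
        fix j :: nat assume j: "j \<in> {..<28}"
        have "?g $ pos (28 + j) = M i j"
          using i j by (cases "M i j") (simp_all add: vec_of_right img_def)
        then show "?g $ pos (28 + j) * y $ pos (28 + j) = M i j * y $ pos (28 + j)" by simp
      qed
      ultimately have "y $ pos i + (\<Sum>j<28. M i j * y $ pos (28 + j)) = 0"
        by (simp only: ip_split)
      then show ?thesis by (rule bit_add_eq_0)
    qed
    have "y $ pos (28 + k) = (\<Sum>i<28. y $ pos i * M i k)" if k: "k < 28" for k
    proof -
      have "(\<Sum>i<28. y $ pos i * M i k) = (\<Sum>i<28. (\<Sum>j<28. M i j * y $ pos (28 + j)) * M i k)"
        by (rule sum.cong[OF refl]) (use yi in simp)
      also have "\<dots> = (\<Sum>i<28. \<Sum>j<28. y $ pos (28 + j) * (M j i * M i k))"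
      proof (rule sum.cong[OF refl], subst sum_distrib_right, rule sum.cong[OF refl])
        fix i j :: nat assume "i \<in> {..<28}" "j \<in> {..<28}"
        then have "M i j = M j i" using sym by simp
        then show "M i j * y $ pos (28 + j) * M i k = y $ pos (28 + j) * (M j i * M i k)"
          by (simp add: mult_ac)
      qed
      also have "\<dots> = (\<Sum>j<28. y $ pos (28 + j) * (\<Sum>i<28. M j i * M i k))"
        by (subst sum.swap) (simp add: sum_distrib_left)
      also have "\<dots> = (\<Sum>j<28. y $ pos (28 + j) * of_bool (j = k))"
        by (rule sum.cong[OF refl]) (use orth k in simp)
      also have "\<dots> = y $ pos (28 + k)"
        using k by (simp add: of_bool_def if_distrib cong: if_cong)
      finally show ?thesis by simp
    qed
    then show ?thesis by (simp add: code_iff)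
  qed
  have "y \<in> code \<longleftrightarrow> y \<in> dual code" for y
  proof
    assume "y \<in> code"
    then show "y \<in> dual code" using code_orth by (simp add: dual_ip)
  next
    assume "y \<in> dual code"
    then have "ip y x = 0" if "x \<in> code" for x using that by (simp add: dual_ip)
    then show "y \<in> code" by (intro dual_code) (simp only: ip_comm[of _ y])
  qed
  then show ?thesis unfolding self_dual_def by (rule set_eqI)
qed

text \<open>The vector that separates the doubly even words of a code from the others.\<close>

abbreviation half :: "bit ^ 56" where "half \<equiv> vec_of {..<28} {}"

lemma ip_half: "ip x half = of_nat (card (left x))"
proof -
  have "ip x half = ip half x" by (rule ip_comm)
  also have "\<dots> = (\<Sum>i\<in>left half. x $ pos i) + (\<Sum>j<28. half $ pos (28 + j) * x $ pos (28 + j))"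
    by (simp only: ip_split sum_left)
  also have "(\<Sum>j<28. half $ pos (28 + j) * x $ pos (28 + j)) = 0"
    by (rule sum.neutral) (simp add: vec_of_right)
  also have "left half = {..<28}" by simp
  also have "(\<Sum>i<28. x $ pos i) = of_nat (card {i\<in>{..<28}. x $ pos i = 1})"
    by (rule sum_bit_eq_card) simp
  finally show ?thesis by (simp add: left_def)
qed

lemma weight_code_mod_4: "x \<in> code \<Longrightarrow> weight x mod 4 = (if ip x half = 0 then 0 else 2)"
proof -
  assume "x \<in> code"
  then have "weight x = card (left x) + card (img (left x))"
    by (simp add: weight_left_right code_def)
  moreover have "card (img (left x)) mod 4 = card (left x) mod 4"
    by (rule card_img_mod_4) (rule left_sub)
  moreover have "ip x half = 0 \<longleftrightarrow> even (card (left x))"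
    by (simp add: ip_half of_nat_bit)
  ultimately show ?thesis using add_mod_4 by (simp only:)
qed

lemma half_notin_code: "half \<notin> code"
proof -
  have "img {..<28} = {..<28}" using img_complement[of "{}"] by simp
  moreover have "{..<28 :: nat} \<noteq> {}" by (simp add: lessThan_empty_iff)
  ultimately show ?thesis by (simp add: code_def)
qed

context
  assumes small_supports: "\<And>U. U \<subseteq> {..<28} \<Longrightarrow> U \<noteq> {} \<Longrightarrow> card U \<le> 4 \<Longrightarrow>
      10 \<le> card U + card (img U) \<and> card (img U) \<le> 19 + card U"
begin

lemma weight_code_ge: "x \<in> code \<Longrightarrow> x \<noteq> 0 \<Longrightarrow> 10 \<le> weight x"
proof -
  assume x: "x \<in> code" "x \<noteq> 0"
  have r: "img (left x) = right x" using x(1) by (simp add: code_def)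
  then have l: "img (right x) = left x" using img_img[OF left_sub[of x]] by (simp only:)
  have "left x = {} \<longleftrightarrow> right x = {}" using l r img_empty by metis
  then have ne: "left x \<noteq> {}" "right x \<noteq> {}"
    using x(2) vec_eqI[of x 0] by auto
  note * = small_supports[OF left_sub[of x] ne(1), unfolded r] small_supports[OF right_sub[of x] ne(2), unfolded l]
  show ?thesis
    using * by (cases "card (left x) \<le> 4"; cases "card (right x) \<le> 4")
      (simp_all add: weight_left_right)
qed

text \<open>A word of the shadow is the pair of \<open>W\<close> and the complement \<open>V\<close> of \<open>img W\<close>, and \<open>W\<close> arises
  from \<open>V\<close> in the same way.  If \<open>W\<close> or \<open>V\<close> has at most four elements, the upper bound in the
  hypothesis gives weight at least 9.  The weight is a multiple of 4.\<close>

lemma weight_shadow_ge: "x \<in> code \<Longrightarrow> 12 \<le> weight (half + x)"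
proof -
  assume x: "x \<in> code"
  define W where "W = {..<28} - left x"
  define V where "V = {..<28} - img W"
  have W: "W \<subseteq> {..<28}" and V: "V \<subseteq> {..<28}" by (auto simp: W_def V_def)
  have finW: "finite W" and finV: "finite V" by (simp_all add: W_def V_def)
  have lx: "left x = {..<28} - W" using left_sub[of x] by (auto simp: W_def)
  have "right x = img ({..<28} - W)" using x by (simp add: code_def lx)
  then have rx: "right x = V" by (simp add: img_complement[OF W] V_def)
  have "left (half + x) = W" "right (half + x) = V"
    using left_sub[of x] by (auto simp: left_add right_add W_def rx)
  then have wt: "weight (half + x) = card W + card V" by (simp add: weight_left_right)
  have cV: "card V = 28 - card (img W)" "card (img W) \<le> 28"
    using img_sub[of W] card_mono[OF _ img_sub[of W]] by (simp_all add: V_def card_Diff_subset)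
  have cW: "card W \<le> 28" using card_mono[OF _ W] by simp
  have imgV: "img V = {..<28} - W"
    using img_complement[OF img_sub[of W]] img_img[OF W] by (simp add: V_def)
  then have cimgV: "card (img V) = 28 - card W"
    using W finW by (simp add: card_Diff_subset)
  have "(a + (28 - b)) mod 4 = 0" if "b mod 4 = a mod 4" "b \<le> 28" for a b :: nat
    using mod_eq_dvd_iff_nat[of b "a + 28" 4] mod_mult_self2[of a 4 7] that
    by (simp add: mod_eq_0_iff_dvd)
  then have mod4: "(card W + card V) mod 4 = 0"
    using card_img_mod_4[OF W] cV by (simp only:)
  have nine: "9 \<le> card W + card V"
  proof (cases "W = {} \<or> V = {}")
    case True
    then show ?thesis
    proof
      assume "W = {}"
      then show ?thesis using cV by simp
    next
      assume "V = {}"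
      then have "card W = 28" using cimgV cW by simp
      then show ?thesis by simp
    qed
  next
    case False
    then show ?thesis
      using small_supports[OF W] small_supports[OF V, unfolded cimgV] cV cW
      by (cases "card W \<le> 4"; cases "card V \<le> 4") auto
  qed
  have "12 \<le> a" if "a mod 4 = 0" "9 \<le> a" for a :: nat
    using that by (auto simp: mod_eq_0_iff_dvd dvd_def)
  from this[OF mod4 nine] show ?thesis unfolding wt .
qed

lemma card_code_weight_10: "card {x\<in>code. weight x = 10} = 308"
  by (rule card_weight_10[OF self_dual_code weight_code_mod_4 half_notin_code weight_code_ge weight_shadow_ge])

lemma min_weight_code: "min_weight code = 10"
proof -
  have "{x\<in>code. weight x = 10} \<noteq> {}" using card_code_weight_10 by force
  then obtain x where "x \<in> code" "weight x = 10" by auto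
  then have "10 \<in> weight ` (code - {0})" by force
  moreover have "10 \<le> w" if "w \<in> weight ` (code - {0})" for w
    using that weight_code_ge by auto
  ultimately show ?thesis unfolding min_weight_def by (intro Min_eqI) simp_all
qed

lemma min_weight_shadow:
  assumes "U \<subseteq> {..<28}" "card (img U) = card U + 16"
  shows "min_weight (shadow code) = 12"
proof -
  have sh: "shadow code = (+) half ` code"
    by (rule shadow_eq[OF self_dual_code weight_code_mod_4 half_notin_code])
  have fin: "finite U" using assms(1) by (rule finite_subset) simp
  \<comment> \<open>The shadow contains the sum of \<open>half\<close> and this word, the pair of \<open>U\<close> and the complement of \<open>img U\<close>.\<close>
  let ?x = "vec_of ({..<28} - U) ({..<28} - img U)"
  have x: "?x \<in> code"
    using img_complement[OF assms(1)] by (simp add: code_def Int_absorb2)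
  have "left (half + ?x) = U" "right (half + ?x) = {..<28} - img U"
    using assms(1) by (auto simp: left_add right_add)
  then have "weight (half + ?x) = card U + (28 - card (img U))"
    by (simp add: weight_left_right card_Diff_subset img_sub)
  moreover have "card (img U) \<le> 28"
    using card_mono[OF _ img_sub[of U]] by simp
  ultimately have w: "weight (half + ?x) = 12" using assms(2) by simp
  then have "half + ?x \<noteq> 0" by auto
  then have "12 \<in> weight ` (shadow code - {0})"
    unfolding sh using x w by (intro image_eqI[of _ weight "half + ?x"]) simp_all
  moreover have "12 \<le> w" if "w \<in> weight ` (shadow code - {0})" for w
    using that weight_shadow_ge unfolding sh by auto
  ultimately show ?thesis unfolding min_weight_def by (intro Min_eqI) simp_all
qed

lemma code_properties:
  assumes "U \<subseteq> {..<28}" "card (img U) = card U + 16"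
  shows "is_code 56 28 10 code \<and> self_dual code \<and> singly_even code \<and> s_extremal code"
proof -
  have C56: "CARD(56) = 56" by simp
  have se: "singly_even code"
    by (rule singly_even_self_dual[OF self_dual_code weight_code_mod_4 half_notin_code])
  have sub: "vec.subspace code"
    using subspace_dual[of code] self_dual_code[unfolded self_dual_def] by (rule ssubst[rotated])
  have "(2 ^ vec.dim code) ^ 2 = (2 ^ 56 :: nat)"
    using card_self_dual[OF self_dual_code weight_code_mod_4 half_notin_code] card_subspace[OF sub]
    by (simp only: C56)
  then have "(2 :: nat) ^ (vec.dim code * 2) = 2 ^ 56"
    by (simp only: power_mult)
  then have "vec.dim code * 2 = 56"
    by (subst (asm) power_inject_exp) simp_all
  then have "vec.dim code = 28" by simp
  then show ?thesis
    using self_dual_code se sub min_weight_code min_weight_shadow[OF assms]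
    by (simp add: is_code_def s_extremal_def)
qed

end

end

section \<open>An invariant of codes\<close>

text \<open>Viewed as blocks of a design, the words of weight 10 through two given points.\<close>

definition pair_count :: "(bit ^ 'n) set \<Rightarrow> 'n \<Rightarrow> 'n \<Rightarrow> nat" where
  "pair_count C p q = card {x\<in>C. weight x = 10 \<and> x $ p = 1 \<and> x $ q = 1}"

text \<open>Permuting the coordinates permutes the summands, so this is an invariant.\<close>

definition pair_energy :: "(bit ^ 'n) set \<Rightarrow> nat" where
  "pair_energy C = (\<Sum>p\<in>UNIV. \<Sum>q\<in>UNIV. (pair_count C p q)\<^sup>2)"

lemma pair_energy_equiv:
  fixes C D :: "(bit ^ 'n) set"
  assumes "code_equiv C D"
  shows "pair_energy C = pair_energy D"
proof -
  obtain f :: "'n \<Rightarrow> 'n" where f: "bij f" and D: "D = (\<lambda>x. \<chi> i. x $ f i) ` C"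
    using assms by (auto simp: code_equiv_def)
  let ?g = "\<lambda>x :: bit ^ 'n. (\<chi> i. x $ f i) :: bit ^ 'n"
  have inj: "inj ?g"
  proof (rule injI)
    fix x y assume eq: "?g x = ?g y"
    have "x $ f i = y $ f i" for i
      using arg_cong[OF eq, of "\<lambda>z. z $ i"] by simp
    then have "x $ i = y $ i" for i
      using bij_is_surj[OF f] by (metis surjD)
    then show "x = y" by (simp add: vec_eq_iff)
  qed
  have wt: "weight (?g x) = weight x" for x
  proof -
    have "f ` {i. x $ f i \<noteq> 0} = {i. x $ i \<noteq> 0}"
      using bij_is_surj[OF f] by (simp add: set_eq_iff image_iff) (metis surjD)
    then have "card {i. x $ i \<noteq> 0} = card {i. x $ f i \<noteq> 0}"
      using card_image[OF inj_on_subset[OF bij_is_inj[OF f] subset_UNIV]] by metis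
    then show ?thesis by (simp add: weight_def)
  qed
  have pair_count: "pair_count D p q = pair_count C (f p) (f q)" for p q
  proof -
    have "{y\<in>D. weight y = 10 \<and> y $ p = 1 \<and> y $ q = 1}
        = ?g ` {x\<in>C. weight x = 10 \<and> x $ f p = 1 \<and> x $ f q = 1}"
      unfolding D by (auto simp: wt)
    then show ?thesis
      unfolding pair_count_def by (simp add: card_image inj_on_subset[OF inj])
  qed
  have "pair_energy D = (\<Sum>p\<in>UNIV. \<Sum>q\<in>UNIV. (pair_count C (f p) (f q))\<^sup>2)"
    by (simp add: pair_energy_def pair_count)
  also have "\<dots> = (\<Sum>p\<in>UNIV. \<Sum>q\<in>UNIV. (pair_count C (f p) q)\<^sup>2)"
    by (rule sum.cong[OF refl]) (rule sum.reindex_bij_betw[OF f])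
  also have "\<dots> = pair_energy C"
    unfolding pair_energy_def by (rule sum.reindex_bij_betw[OF f])
  finally show ?thesis by simp
qed

section \<open>Searching for words of small weight\<close>

definition ones :: "bool list \<Rightarrow> nat" where "ones xs = length (filter id xs)"

lemma ones_simps [simp]: "ones [] = 0" "ones (x # xs) = of_bool x + ones xs"
  by (simp_all add: ones_def)

lemma ones_append [simp]: "ones (xs @ ys) = ones xs + ones ys"
  by (simp add: ones_def)

lemma ones_card: "ones xs = card {i. i < length xs \<and> xs ! i}"
  by (simp add: ones_def length_filter_conv_card)

lemma ones_le: "ones xs \<le> length xs"
  by (simp add: ones_def)

lemma ones_0: "ones xs = 0 \<longleftrightarrow> (\<forall>x\<in>set xs. \<not> x)"
  by (simp add: ones_def filter_empty_conv)

definition xor_list :: "bool list \<Rightarrow> bool list \<Rightarrow> bool list" where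
  "xor_list = map2 (\<lambda>x y. x \<noteq> y)"

lemma xor_list_eval:
  "xor_list [] [] = []"
  "xor_list (True # xs) (True # ys) = False # xor_list xs ys"
  "xor_list (False # xs) (False # ys) = False # xor_list xs ys"
  "xor_list (True # xs) (False # ys) = True # xor_list xs ys"
  "xor_list (False # xs) (True # ys) = True # xor_list xs ys"
  by (simp_all add: xor_list_def)

text \<open>The lists differ in at least \<open>a\<close> places and agree in at least \<open>b\<close>.  Both counters are decreased
  along the lists in \<open>far_eval\<close>, and the comparison stops as soon as both are used up, on average
  long before the ends of the lists.\<close>

definition far :: "nat \<Rightarrow> nat \<Rightarrow> bool list \<Rightarrow> bool list \<Rightarrow> bool" where
  "far a b xs ys \<longleftrightarrow> a \<le> ones (xor_list xs ys) \<and> b + ones (xor_list xs ys) \<le> length (xor_list xs ys)"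

lemma far_eval:
  "far 0 0 xs ys = True"
  "far a (Suc b) (True # xs) (True # ys) = far a b xs ys"
  "far a (Suc b) (False # xs) (False # ys) = far a b xs ys"
  "far (Suc a) b (True # xs) (False # ys) = far a b xs ys"
  "far (Suc a) b (False # xs) (True # ys) = far a b xs ys"
  "far (Suc a) 0 (True # xs) (True # ys) = far (Suc a) 0 xs ys"
  "far (Suc a) 0 (False # xs) (False # ys) = far (Suc a) 0 xs ys"
  "far 0 (Suc b) (True # xs) (False # ys) = far 0 (Suc b) xs ys"
  "far 0 (Suc b) (False # xs) (True # ys) = far 0 (Suc b) xs ys"
  using ones_le[of "xor_list xs ys"] by (auto simp: far_def xor_list_eval)

text \<open>The sum of \<open>t\<close> and the rows selected by \<open>us\<close>.\<close>

fun xor_select :: "bool list \<Rightarrow> bool list list \<Rightarrow> bool list \<Rightarrow> bool list" where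
  "xor_select (True # us) (r # rs) t = xor_select us rs (xor_list t r)"
| "xor_select (False # us) (r # rs) t = xor_select us rs t"
| "xor_select us rs t = t"

lemma xor_select_none: "ones us = 0 \<Longrightarrow> xor_select us rs t = t"
  by (induction us rs t rule: xor_select.induct) auto

lemma xor_select_append_False: "k \<le> length rs \<Longrightarrow> xor_select (replicate k False @ us) rs t = xor_select us (drop k rs) t"
proof (induction k arbitrary: rs)
  case (Suc k)
  then show ?case by (cases rs) auto
qed simp

lemma of_bool_neq: "(of_bool (a \<noteq> b) :: bit) = of_bool a + of_bool b"
  by (cases a; cases b) auto

lemma xor_select_nth:
  assumes "length us = length rs" "\<And>r. r \<in> set rs \<Longrightarrow> length r = length t"
  shows "length (xor_select us rs t) = length t \<and> (\<forall>j<length t. (of_bool (xor_select us rs t ! j) :: bit) =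
    of_bool (t ! j) + (\<Sum>i<length rs. if us ! i then of_bool (rs ! i ! j) else 0))"
  using assms
proof (induction us rs t rule: xor_select.induct)
  case (1 us r rs t)
  have l: "length (xor_list t r) = length t" using 1(3)[of r] by (simp add: xor_list_def)
  have "length (xor_select us rs (xor_list t r)) = length (xor_list t r) \<and> (\<forall>j<length (xor_list t r). (of_bool (xor_select us rs (xor_list t r) ! j) :: bit) =
    of_bool (xor_list t r ! j) + (\<Sum>i<length rs. if us ! i then of_bool (rs ! i ! j) else 0))"
    by (rule 1(1)) (use 1(2,3) l in auto)
  moreover have "(of_bool (xor_list t r ! j) :: bit) = of_bool (t ! j) + of_bool (r ! j)" if "j < length t" for j
    using that 1(3)[of r] by (simp add: xor_list_def of_bool_neq)
  ultimately show ?case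
    by (simp add: l sum.lessThan_Suc_shift add.assoc del: sum.lessThan_Suc cong: if_cong)
next
  case (2 us r rs t)
  then show ?case by (simp add: sum.lessThan_Suc_shift del: sum.lessThan_Suc cong: if_cong)
qed auto

text \<open>All sums of \<open>t\<close> and between one and \<open>length ths\<close> of the rows are compared with the bounds in
  \<open>ths\<close>, whose \<open>k\<close>-th entry is for \<open>k\<close> rows.  The bounds are tested on \<open>t\<close> and the last row before
  their sum is formed.\<close>

fun search :: "(nat \<times> nat) list \<Rightarrow> bool list \<Rightarrow> bool list list \<Rightarrow> bool" where
  "search ((a, b) # ths) t (r # rs) \<longleftrightarrow>
     far a b t r \<and> search ths (xor_list t r) rs \<and> search ((a, b) # ths) t rs"
| "search ths t rs \<longleftrightarrow> True"

lemma search_sound: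
  "search ths t rs \<Longrightarrow> length us = length rs \<Longrightarrow> ones us = Suc k \<Longrightarrow> k < length ths \<Longrightarrow> ths ! k = (a, b) \<Longrightarrow>
     a \<le> ones (xor_select us rs t) \<and> b + ones (xor_select us rs t) \<le> length (xor_select us rs t)"
proof (induction ths t rs arbitrary: us k rule: search.induct)
  case (1 a' b' ths t r rs)
  obtain x us' where us: "us = x # us'" using 1(4) by (cases us) auto
  show ?case
  proof (cases x)
    case True
    show ?thesis
    proof (cases k)
      case 0
      then have "xor_select us (r # rs) t = xor_list t r"
        using 1(5) us True by (simp add: xor_select_none)
      then show ?thesis using 1(3,7) 0 by (auto simp: far_def)
    next
      case (Suc k')
      have "a \<le> ones (xor_select us' rs (xor_list t r)) \<and> b + ones (xor_select us' rs (xor_list t r)) \<le> length (xor_select us' rs (xor_list t r))"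
        by (rule 1(1)[of us' k']) (use 1(3-7) us True Suc in auto)
      then show ?thesis using us True by simp
    qed
  next
    case False
    have "a \<le> ones (xor_select us' rs t) \<and> b + ones (xor_select us' rs t) \<le> length (xor_select us' rs t)"
      by (rule 1(2)[of us' k]) (use 1(3-7) us False in auto)
    then show ?thesis using us False by simp
  qed
qed auto

text \<open>For \<open>k = 2, 3, 4\<close> rows altogether, at least \<open>10 - k\<close> ones and \<open>9 - k\<close> zeros, that is, at most
  \<open>19 + k\<close> ones; \<open>search_from\<close> deals with \<open>k = 1\<close>.\<close>

definition thresholds :: "(nat \<times> nat) list" where
  "thresholds = [(8, 7), (7, 6), (6, 5)]"

definition zero28 :: "bool list" where "zero28 = replicate 28 False"

fun search_from :: "bool list list \<Rightarrow> bool" where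
  "search_from (r # rs) \<longleftrightarrow> far 9 8 zero28 r \<and> search thresholds r rs"
| "search_from [] \<longleftrightarrow> False"

text \<open>For each group of seven rows, its first row is combined with rows that follow it.  This covers the
  selections that begin with the first row of a group, and every selection can be shifted to such a
  one.\<close>

primrec min_dist_check :: "bool list list list \<Rightarrow> bool" where
  "min_dist_check [] \<longleftrightarrow> True"
| "min_dist_check (B # Bs) \<longleftrightarrow> search_from (concat (B # Bs)) \<and> min_dist_check Bs"

lemma min_dist_check_drop: "min_dist_check Bs \<Longrightarrow> b < length Bs \<Longrightarrow> search_from (concat (drop b Bs))"
proof (induction Bs arbitrary: b)
  case (Cons B Bs)
  then show ?case by (cases b) auto
qed simp

lemma search_from_sound:
  assumes "search_from rs" "length us = length rs" "us \<noteq> []" "hd us" "ones us \<le> 4"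
    "\<And>r. r \<in> set rs \<Longrightarrow> length r = 28"
  shows "10 \<le> ones us + ones (xor_select us rs zero28) \<and> ones (xor_select us rs zero28) \<le> 19 + ones us"
proof -
  obtain us' where us: "us = True # us'" using assms(3,4) by (cases us) auto
  obtain r rs' where rs: "rs = r # rs'" using assms(2) us by (cases rs) auto
  have r: "length r = 28" using assms(6) rs by simp
  have x: "xor_list zero28 r = r"
    by (rule nth_equalityI) (simp_all add: xor_list_def zero28_def r)
  have c: "xor_select us rs zero28 = xor_select us' rs' r" by (simp add: us rs x)
  have l: "length (xor_select us' rs' r) = 28"
    using xor_select_nth[of us' rs' r] assms(2,6) us rs r by auto
  have f: "9 \<le> ones r" "8 + ones r \<le> 28"
    using assms(1) by (simp_all add: rs far_def x r)
  have s: "search thresholds r rs'" using assms(1) rs by simp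
  have "ones us' \<le> 3" using assms(5) us by simp
  then consider "ones us' = 0" | "ones us' = Suc 0" | "ones us' = Suc 1" | "ones us' = Suc 2" by linarith
  then show ?thesis
  proof cases
    case 1
    then have "xor_select us' rs' r = r" by (rule xor_select_none)
    then show ?thesis unfolding c using 1 f by (simp add: us)
  next
    case 2
    from search_sound[OF s _ 2, of 8 7] show ?thesis
      unfolding c using assms(2) 2 by (simp add: us rs l thresholds_def)
  next
    case 3
    from search_sound[OF s _ 3, of 7 6] show ?thesis
      unfolding c using assms(2) 3 by (simp add: us rs l thresholds_def)
  next
    case 4
    from search_sound[OF s _ 4, of 6 5] show ?thesis
      unfolding c using assms(2) 4 by (simp add: us rs l thresholds_def)
  qed
qed

definition even_overlap :: "bool list \<Rightarrow> bool list \<Rightarrow> bool" where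
  "even_overlap xs ys \<longleftrightarrow> even (ones (map2 (\<and>) xs ys))"

definition odd_overlap :: "bool list \<Rightarrow> bool list \<Rightarrow> bool" where
  "odd_overlap xs ys \<longleftrightarrow> odd (ones (map2 (\<and>) xs ys))"

lemma even_overlap_eval:
  "even_overlap [] [] = True"
  "even_overlap (True # xs) (True # ys) = odd_overlap xs ys"
  "even_overlap (False # xs) (y # ys) = even_overlap xs ys"
  "even_overlap (x # xs) (False # ys) = even_overlap xs ys"
  "odd_overlap (True # xs) (True # ys) = even_overlap xs ys"
  "odd_overlap (False # xs) (y # ys) = odd_overlap xs ys"
  "odd_overlap (x # xs) (False # ys) = odd_overlap xs ys"
  by (simp_all add: even_overlap_def odd_overlap_def)

text \<open>The argument \<open>a\<close> accumulates the number of ones in unary and is reduced modulo 4 at the end.\<close>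

definition weight_check :: "nat \<Rightarrow> bool list \<Rightarrow> bool" where
  "weight_check a xs \<longleftrightarrow> (a + ones xs) mod 4 = 1"

lemma weight_check_eval:
  "weight_check a (True # xs) = weight_check (Suc a) xs"
  "weight_check a (False # xs) = weight_check a xs"
  "weight_check (Suc (Suc (Suc (Suc a)))) [] = weight_check a []"
  "weight_check (Suc 0) [] = True"
  by (simp_all add: weight_check_def)

fun even_overlaps :: "bool list \<Rightarrow> bool list list \<Rightarrow> bool" where
  "even_overlaps r [] \<longleftrightarrow> True"
| "even_overlaps r (r' # rs) \<longleftrightarrow> even_overlap r r' \<and> even_overlaps r rs"

fun orth_rows :: "bool list list \<Rightarrow> bool" where
  "orth_rows [] \<longleftrightarrow> True"
| "orth_rows (r # rs) \<longleftrightarrow> weight_check 0 r \<and> even_overlaps r rs \<and> orth_rows rs"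

lemma even_overlaps_iff: "even_overlaps r rs \<longleftrightarrow> (\<forall>r'\<in>set rs. even_overlap r r')"
  by (induction rs) auto

lemma orth_rows_iff: "orth_rows rs \<longleftrightarrow> (\<forall>r\<in>set rs. weight_check 0 r) \<and> (\<forall>i j. i < j \<and> j < length rs \<longrightarrow> even_overlap (rs ! i) (rs ! j))"
proof (induction rs)
  case (Cons r rs)
  have "(\<forall>i j. i < j \<and> j < length (r # rs) \<longrightarrow> even_overlap ((r # rs) ! i) ((r # rs) ! j))
     \<longleftrightarrow> (\<forall>j<length rs. even_overlap r (rs ! j)) \<and> (\<forall>i j. i < j \<and> j < length rs \<longrightarrow> even_overlap (rs ! i) (rs ! j))"
    (is "?L \<longleftrightarrow> ?A \<and> ?B")
  proof
    assume L: ?L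
    have ?A using L[rule_format, of 0 "Suc _"] by simp
    moreover have ?B using L[rule_format, of "Suc _" "Suc _"] by simp
    ultimately show "?A \<and> ?B" by blast
  next
    assume R: "?A \<and> ?B"
    show ?L
    proof (intro allI impI)
      fix i j assume "i < j \<and> j < length (r # rs)"
      then show "even_overlap ((r # rs) ! i) ((r # rs) ! j)"
        using R by (cases i; cases j) auto
    qed
  qed
  then show ?case using Cons.IH by (auto simp: even_overlaps_iff all_set_conv_all_nth)
qed simp

text \<open>The binary digits of a number, least significant first, as a compact notation for lists of
  truth values.\<close>

primrec bits_of :: "nat \<Rightarrow> nat \<Rightarrow> bool list" where
  "bits_of 0 n = []"
| "bits_of (Suc k) n = odd n # bits_of k (n div 2)"

lemma length_bits_of [simp]: "length (bits_of k n) = k"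
  by (induction k arbitrary: n) auto

lemma bits_of_inj: "bits_of k n = bits_of k m \<Longrightarrow> n < 2 ^ k \<Longrightarrow> m < 2 ^ k \<Longrightarrow> n = m"
proof (induction k arbitrary: n m)
  case (Suc k)
  then have "n div 2 = m div 2" by (intro Suc.IH) auto
  moreover have "odd n = odd m" using Suc.prems(1) by simp
  ultimately show ?case by (metis odd_two_times_div_two_succ even_two_times_div_two)
qed simp

lemma bits_of_eval:
  "bits_of 0 m = []"
  "bits_of (Suc k) 0 = False # bits_of k 0"
  "bits_of (Suc k) 1 = True # bits_of k 0"
  "bits_of (Suc k) (numeral num.One) = True # bits_of k 0"
  "bits_of (Suc k) (numeral (num.Bit0 n)) = False # bits_of k (numeral n)"
  "bits_of (Suc k) (numeral (num.Bit1 n)) = True # bits_of k (numeral n)"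
  by simp_all

text \<open>The ten entries are those on and above the diagonal of a symmetric array.  A list of another length
  stands for the zero array, so that the shape is the same for all arguments.\<close>

fun blocks :: "nat list \<Rightarrow> bool list list list" where
  "blocks [a, b, c, d, e, f, g, h, i, j] =
     map (map (bits_of 7)) [[a, b, c, d], [b, e, f, g], [c, f, h, i], [d, g, i, j]]"
| "blocks _ = map (map (bits_of 7)) [[0, 0, 0, 0], [0, 0, 0, 0], [0, 0, 0, 0], [0, 0, 0, 0]]"

lemma less_4_cases: "b < 4 \<Longrightarrow> b = 0 \<or> b = 1 \<or> b = 2 \<or> b = (3 :: nat)"
  by auto

lemma blocks_shape: "length (blocks fs) = 4"
  "b < 4 \<Longrightarrow> length (blocks fs ! b) = 4"
  "b < 4 \<Longrightarrow> c < 4 \<Longrightarrow> length (blocks fs ! b ! c) = 7"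
  "b < 4 \<Longrightarrow> c < 4 \<Longrightarrow> blocks fs ! b ! c = blocks fs ! c ! b"
  by (cases fs rule: blocks.cases; auto dest!: less_4_cases)+

text \<open>The rows of a strip of blocks: row \<open>i\<close> is row 0 with all blocks rotated by \<open>i\<close>.\<close>

primrec block_rows :: "nat \<Rightarrow> bool list list \<Rightarrow> bool list list" where
  "block_rows 0 bs = []"
| "block_rows (Suc k) bs = concat bs # block_rows k (map rotate1 bs)"

lemma length_block_rows [simp]: "length (block_rows k bs) = k"
  by (induction k arbitrary: bs) auto

lemma block_rows_nth: "i < k \<Longrightarrow> block_rows k bs ! i = concat (map (rotate i) bs)"
proof (induction k arbitrary: bs i)
  case (Suc k)
  show ?case
  proof (cases i)
    case (Suc i')
    then have "block_rows (Suc k) bs ! i = concat (map (rotate i') (map rotate1 bs))"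
      using Suc.prems Suc.IH by simp
    also have "map (rotate i') (map rotate1 bs) = map (rotate i) bs"
      using Suc by (simp add: rotate_def funpow_swap1)
    finally show ?thesis .
  qed (simp add: map_idI)
qed simp

lemma concat_uniform:
  assumes "\<And>xs. xs \<in> set xss \<Longrightarrow> length xs = k"
  shows "length (concat xss) = k * length xss"
    "b < length xss \<Longrightarrow> i < k \<Longrightarrow> concat xss ! (k * b + i) = xss ! b ! i"
    "b \<le> length xss \<Longrightarrow> concat (drop b xss) = drop (k * b) (concat xss)"
  using assms
proof (induction xss arbitrary: b)
  case (Cons xs xss)
  {
    case 1 then show ?case using Cons(1) by simp
  next
    case 2 then show ?case using Cons(2)[of "b - 1"] by (cases b) (auto simp: nth_append)
  next
    case 3 then show ?case using Cons(3)[of "b - 1"] by (cases b) auto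
  }
qed auto

section \<open>Codes from circulant blocks\<close>

definition shift :: "nat \<Rightarrow> nat \<Rightarrow> nat" where
  "shift m i = 7 * (i div 7) + (i mod 7 + m) mod 7"

lemma shift_div [simp]: "shift m i div 7 = i div 7" and shift_mod [simp]: "shift m i mod 7 = (i mod 7 + m) mod 7"
  by (simp_all add: shift_def)

lemma div_mod_eqI: "i div 7 = j div 7 \<Longrightarrow> i mod 7 = j mod 7 \<Longrightarrow> i = (j :: nat)"
  by (metis div_mult_mod_eq)

lemma shift_inverse: "m \<le> 7 \<Longrightarrow> shift (7 - m) (shift m i) = i"
proof (rule div_mod_eqI)
  assume "m \<le> 7"
  have "((i mod 7 + m) mod 7 + (7 - m)) mod 7 = (i mod 7 + (m + (7 - m))) mod 7"
    by (simp only: mod_add_left_eq add.assoc)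
  then show "shift (7 - m) (shift m i) mod 7 = i mod 7"
    using \<open>m \<le> 7\<close> by (simp only: shift_mod le_add_diff_inverse mod_add_self2 mod_mod_trivial)
qed (simp only: shift_div)

lemma shift_inverse': "m \<le> 7 \<Longrightarrow> shift m (shift (7 - m) i) = i"
  using shift_inverse[of "7 - m" i] by simp

lemma shift_less: "i < 28 \<Longrightarrow> shift m i < 28"
proof -
  assume "i < 28"
  then have "i div 7 < 4" by simp
  then have "shift m i div 7 < 4" by (simp only: shift_div)
  then show ?thesis by (simp only: div_less_iff_less_mult[OF zero_less_numeral])
qed

text \<open>The entry in a block depends only on the sum of the two positions modulo 7, so that the blocks,
  and with them the matrix, are symmetric.\<close>

definition mat :: "nat list \<Rightarrow> nat \<Rightarrow> nat \<Rightarrow> bit" where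
  "mat fs i j = of_bool (blocks fs ! (i div 7) ! (j div 7) ! ((i mod 7 + j mod 7) mod 7))"

definition row_groups :: "nat list \<Rightarrow> bool list list list" where
  "row_groups fs = map (block_rows 7) (blocks fs)"

definition row_lists :: "nat list \<Rightarrow> bool list list" where
  "row_lists fs = concat (row_groups fs)"

text \<open>Shifting the rows forwards has the same effect as shifting the columns forwards; consequently
  \<open>img\<close> maps a forward shift to a backward one.\<close>

lemma mat_shift: "mat fs (shift m i) j = mat fs i (shift m j)"
proof -
  have "((a + m) mod 7 + b) mod 7 = (a + (b + m) mod 7) mod 7" for a b
    by (simp only: mod_add_left_eq mod_add_right_eq add.assoc add.commute[of m b])
  then show ?thesis by (simp only: mat_def shift_div shift_mod)
qed

lemma mat_sym: "i < 28 \<Longrightarrow> j < 28 \<Longrightarrow> mat fs i j = mat fs j i"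
  by (simp add: mat_def blocks_shape(4)[of "i div 7" "j div 7"] add.commute)

lemma length_row_groups [simp]: "length (row_groups fs) = 4"
  by (simp add: row_groups_def blocks_shape(1-3))

lemma length_in_row_groups: "B \<in> set (row_groups fs) \<Longrightarrow> length B = 7"
  by (auto simp: row_groups_def)

lemma length_row_lists [simp]: "length (row_lists fs) = 28"
proof -
  have "length (concat (row_groups fs)) = 7 * length (row_groups fs)"
    by (rule concat_uniform(1)) (rule length_in_row_groups)
  then show ?thesis by (simp add: row_lists_def)
qed

lemma row_lists_nth:
  assumes "i < 28"
  shows "length (row_lists fs ! i) = 28" "j < 28 \<Longrightarrow> row_lists fs ! i ! j \<longleftrightarrow> mat fs i j = 1"
proof -
  define b i' where "b = i div 7" and "i' = i mod 7"
  have bi: "b < 4" "i' < 7" "i = 7 * b + i'" using assms by (auto simp: b_def i'_def)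
  let ?L = "map (rotate i') (blocks fs ! b)"
  have "row_lists fs ! i = row_groups fs ! b ! i'"
    unfolding row_lists_def bi(3) by (rule concat_uniform(2)) (use bi(1,2) length_in_row_groups in auto)
  also have "\<dots> = concat ?L"
    using bi(1,2) by (simp add: row_groups_def blocks_shape(1-3) block_rows_nth)
  finally have r: "row_lists fs ! i = concat ?L" .
  have len: "length xs = 7" if "xs \<in> set ?L" for xs
    using that bi(1,2) by (auto simp: in_set_conv_nth blocks_shape(1-3))
  show "length (row_lists fs ! i) = 28"
  proof -
    have "length (concat ?L) = 7 * length ?L"
      by (rule concat_uniform(1)) (rule len)
    then show ?thesis using bi(1) by (simp add: r blocks_shape(2))
  qed
  assume j: "j < 28"
  define c j' where "c = j div 7" and "j' = j mod 7"
  have cj: "c < 4" "j' < 7" "j = 7 * c + j'" using j by (auto simp: c_def j'_def)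
  have "row_lists fs ! i ! j = ?L ! c ! j'"
    unfolding r cj(3)
  proof (rule concat_uniform(2))
    show "length xs = 7" if "xs \<in> set ?L" for xs using that by (rule len)
  qed (use cj(1,2) bi(1) in \<open>simp_all add: blocks_shape(2)\<close>)
  also have "\<dots> = blocks fs ! b ! c ! ((i' + j') mod 7)"
    using bi(1,2) cj(1,2) by (simp add: blocks_shape(1-3) nth_rotate)
  finally show "row_lists fs ! i ! j \<longleftrightarrow> mat fs i j = 1"
    by (simp add: mat_def b_def c_def i'_def j'_def)
qed

lemma row_lists_of_bool: "i < 28 \<Longrightarrow> j < 28 \<Longrightarrow> of_bool (row_lists fs ! i ! j) = mat fs i j"
  by (cases "mat fs i j") (simp_all add: row_lists_nth(2))

lemma bit_mult_1: "a * b = 1 \<longleftrightarrow> a = 1 \<and> b = 1" for a b :: bit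
  by (cases a; cases b) simp_all

locale circulant =
  fixes fs :: "nat list"
  assumes orth_rows: "orth_rows (row_lists fs)"
begin

lemma sum_mat: "i < 28 \<Longrightarrow> k < 28 \<Longrightarrow>
  (\<Sum>j<28. mat fs i j * mat fs k j) = of_nat (ones (map2 (\<and>) (row_lists fs ! i) (row_lists fs ! k)))"
proof -
  assume ik: "i < 28" "k < 28"
  have "{j\<in>{..<28}. mat fs i j * mat fs k j = 1}
      = {j. j < length (map2 (\<and>) (row_lists fs ! i) (row_lists fs ! k)) \<and> map2 (\<and>) (row_lists fs ! i) (row_lists fs ! k) ! j}"
    using ik by (intro Collect_cong) (auto simp: row_lists_nth bit_mult_1)
  then show ?thesis
    by (simp only: sum_bit_eq_card[OF finite_lessThan] ones_card)
qed

sublocale symmetric_orthogonal "mat fs"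
proof
  fix i j :: nat assume ij: "i < 28" "j < 28"
  show "mat fs i j = mat fs j i" using ij by (rule mat_sym)
next
  fix i :: nat assume i: "i < 28"
  have "weight_check 0 (row_lists fs ! i)"
    using orth_rows i by (simp add: orth_rows_iff)
  moreover have "ones (row_lists fs ! i) = card {j. j < 28 \<and> mat fs i j = 1}"
    unfolding ones_card by (rule arg_cong[of _ _ card], rule Collect_cong) (auto simp: i row_lists_nth)
  ultimately show "card {j. j < 28 \<and> mat fs i j = 1} mod 4 = 1"
    by (simp add: weight_check_def)
next
  fix i k :: nat assume ik: "i < 28" "k < 28"
  have "(\<Sum>j<28. mat fs i j * mat fs j k) = (\<Sum>j<28. mat fs i j * mat fs k j)"
    by (rule sum.cong[OF refl]) (simp only: lessThan_iff mat_sym[OF ik(2)])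
  also have "\<dots> = of_nat (ones (map2 (\<and>) (row_lists fs ! i) (row_lists fs ! k)))"
    by (rule sum_mat[OF ik])
  also have "\<dots> = of_bool (i = k)"
  proof (cases "i = k")
    case True
    have "map2 (\<and>) xs xs = xs" for xs :: "bool list"
      by (induction xs) auto
    moreover have "weight_check 0 (row_lists fs ! i)"
      using orth_rows ik by (simp add: orth_rows_iff)
    then have "ones (row_lists fs ! i) mod 4 = 1" by (simp add: weight_check_def)
    then have "odd (ones (row_lists fs ! i))" by presburger
    ultimately show ?thesis using True by (simp add: of_nat_bit)
  next
    case False
    have "even_overlap xs ys = even_overlap ys xs" for xs ys
    proof -
      have "map2 (\<and>) xs ys = map2 (\<and>) ys xs"
        by (induction xs ys rule: list_induct2') auto
      then show ?thesis by (simp add: even_overlap_def)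
    qed
    then have "even_overlap (row_lists fs ! i) (row_lists fs ! k)"
      using orth_rows ik False unfolding orth_rows_iff length_row_lists by (metis nat_neq_iff)
    then show ?thesis using False by (simp add: even_overlap_def of_nat_bit)
  qed
  finally show "(\<Sum>j<28. mat fs i j * mat fs j k) = of_bool (i = k)" .
qed

lemma img_shift:
  assumes "U \<subseteq> {..<28}" "m \<le> 7"
  shows "img (shift m ` U) = {j. j < 28 \<and> shift m j \<in> img U}"
proof -
  have "inj_on (shift m) U"
    using shift_inverse[OF assms(2)] by (metis inj_onI)
  then have "(\<Sum>i\<in>shift m ` U. mat fs i j) = (\<Sum>i\<in>U. mat fs i (shift m j))" for j
    by (simp add: sum.reindex mat_shift)
  then show ?thesis by (auto simp: img_def shift_less)
qed

lemma preimage_shift: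
  assumes "U \<subseteq> {..<28}" "m \<le> 7"
  shows "{j. j < 28 \<and> shift m j \<in> U} = shift (7 - m) ` U"
proof (intro set_eqI iffI)
  fix j assume "j \<in> {j. j < 28 \<and> shift m j \<in> U}"
  then show "j \<in> shift (7 - m) ` U"
    using shift_inverse[OF assms(2), of j] by (intro image_eqI[of _ _ "shift m j"]) auto
next
  fix j assume "j \<in> shift (7 - m) ` U"
  then show "j \<in> {j. j < 28 \<and> shift m j \<in> U}"
    using assms shift_inverse'[OF assms(2)] by (auto simp: shift_less)
qed

lemma card_shift:
  assumes "m \<le> 7"
  shows "card (shift m ` U) = card U"
  by (rule card_image) (use shift_inverse[OF assms] in \<open>metis inj_onI\<close>)

lemma card_img_shift:
  assumes "U \<subseteq> {..<28}" "m \<le> 7"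
  shows "card (img (shift m ` U)) = card (img U)"
  using assms by (simp add: img_shift preimage_shift[OF img_sub] card_shift)

lemma xor_select_rows:
  assumes "length us = 28"
  shows "length (xor_select us (row_lists fs) zero28) = 28"
    and "j < 28 \<Longrightarrow> xor_select us (row_lists fs) zero28 ! j \<longleftrightarrow> j \<in> img {i. i < 28 \<and> us ! i}"
proof -
  have *: "length r = length zero28" if "r \<in> set (row_lists fs)" for r
    using that row_lists_nth(1) by (auto simp: in_set_conv_nth zero28_def)
  note c = xor_select_nth[of us "row_lists fs" zero28, OF _ *]
  show "length (xor_select us (row_lists fs) zero28) = 28"
    using c assms by (simp add: zero28_def)
  assume j: "j < 28"
  have "(of_bool (xor_select us (row_lists fs) zero28 ! j) :: bit)
      = (\<Sum>i<28. if us ! i then of_bool (row_lists fs ! i ! j) else 0)"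
    using c assms j by (simp add: zero28_def)
  also have "\<dots> = (\<Sum>i<28. if us ! i then mat fs i j else 0)"
    by (rule sum.cong[OF refl]) (use j in \<open>simp add: row_lists_of_bool\<close>)
  also have "\<dots> = (\<Sum>i\<in>{i\<in>{..<28}. us ! i}. mat fs i j)"
    by (rule sum.inter_filter[symmetric]) simp
  finally have "(of_bool (xor_select us (row_lists fs) zero28 ! j) :: bit) = (\<Sum>i\<in>{i. i < 28 \<and> us ! i}. mat fs i j)"
    by simp
  then show "xor_select us (row_lists fs) zero28 ! j \<longleftrightarrow> j \<in> img {i. i < 28 \<and> us ! i}"
    using j by (cases "xor_select us (row_lists fs) zero28 ! j") (auto simp: img_def)
qed

lemma ones_xor_select_rows: "length us = 28 \<Longrightarrow> ones (xor_select us (row_lists fs) zero28) = card (img {i. i < 28 \<and> us ! i})"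
proof -
  assume us: "length us = 28"
  have "{j. j < 28 \<and> xor_select us (row_lists fs) zero28 ! j} = img {i. i < 28 \<and> us ! i}"
    using xor_select_rows(2)[OF us] img_sub by auto
  then show ?thesis by (simp add: ones_card xor_select_rows(1)[OF us])
qed

text \<open>Some shift moves an element of the first nonempty block of \<open>U\<close> to the beginning of its block.  It
  changes neither \<open>card U\<close> nor \<open>card (img U)\<close>, and its result is covered by the search.\<close>

lemma small_supports:
  assumes "min_dist_check (row_groups fs)" "U \<subseteq> {..<28}" "U \<noteq> {}" "card U \<le> 4"
  shows "10 \<le> card U + card (img U) \<and> card (img U) \<le> 19 + card U"
proof -
  obtain i0 where i0: "i0 \<in> U" "\<And>i. i \<in> U \<Longrightarrow> i0 div 7 \<le> i div 7"
    using ex_has_least_nat[of "\<lambda>i. i \<in> U" _ "\<lambda>i. i div 7"] assms(3) by blast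
  \<comment> \<open>The shift by \<open>m\<close> moves \<open>i0\<close> to the beginning of its block \<open>b\<close>.\<close>
  define b m where "b = i0 div 7" and "m = 7 - i0 mod 7"
  have m: "m \<le> 7" by (simp add: m_def)
  have b: "b < 4" using i0 assms(2) by (auto simp: b_def)
  define U' where "U' = shift m ` U"
  have U': "U' \<subseteq> {..<28}" using assms(2) by (auto simp: U'_def shift_less)
  have cU: "card U' = card U" "card (img U') = card (img U)"
    using card_shift[OF m] card_img_shift[OF assms(2) m] by (simp_all add: U'_def)
  have "shift m i0 = 7 * b"
    by (rule div_mod_eqI) (simp_all add: b_def m_def)
  then have first: "7 * b \<in> U'" unfolding U'_def using i0(1) by (metis imageI)
  have later: "7 * b \<le> i" if i: "i \<in> U'" for i
  proof -
    obtain i' where "i' \<in> U" "i = shift m i'" using i unfolding U'_def by blast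
    then have "b \<le> i div 7" using i0(2)[of i'] by (simp add: b_def)
    then show ?thesis by (simp add: less_eq_div_iff_mult_less_eq mult.commute)
  qed
  define us where "us = map (\<lambda>i. i \<in> U') [0..<28]"
  define us2 where "us2 = map (\<lambda>i. i \<in> U') [7 * b..<28]"
  have us: "us = replicate (7 * b) False @ us2"
  proof -
    have "[0..<28] = [0..<7 * b] @ [7 * b..<28]"
      using b upt_add_eq_append[of 0 "7 * b" "28 - 7 * b"] by simp
    moreover have "map (\<lambda>i. i \<in> U') [0..<7 * b] = replicate (7 * b) False"
      by (rule replicate_eqI) (use later in fastforce)+
    ultimately show ?thesis by (simp add: us_def us2_def)
  qed
  have lus: "length us = 28" by (simp add: us_def)
  have Us: "{i. i < 28 \<and> us ! i} = U'" using U' by (auto simp: us_def)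
  have o1: "ones us = card U'" by (simp add: ones_card lus Us)
  then have o2: "ones us2 = card U'"
    using ones_0[of "replicate (7 * b) False"] by (simp add: us)
  have c: "xor_select us (row_lists fs) zero28 = xor_select us2 (drop (7 * b) (row_lists fs)) zero28"
    unfolding us by (rule xor_select_append_False) (use b in simp)
  have d: "concat (drop b (row_groups fs)) = drop (7 * b) (row_lists fs)"
    unfolding row_lists_def by (rule concat_uniform(3)) (use b length_in_row_groups in auto)
  have "10 \<le> ones us2 + ones (xor_select us2 (drop (7 * b) (row_lists fs)) zero28) \<and>
        ones (xor_select us2 (drop (7 * b) (row_lists fs)) zero28) \<le> 19 + ones us2"
  proof (rule search_from_sound)
    show "search_from (drop (7 * b) (row_lists fs))"
      using min_dist_check_drop[OF assms(1), of b] b by (simp add: d)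
    show "length us2 = length (drop (7 * b) (row_lists fs))" by (simp add: us2_def)
    show "us2 \<noteq> []" using b by (simp add: us2_def)
    show "hd us2" using b first by (simp add: us2_def hd_map)
    show "ones us2 \<le> 4" using o2 cU assms(4) by simp
    show "length r = 28" if "r \<in> set (drop (7 * b) (row_lists fs))" for r
      using in_set_dropD[OF that] row_lists_nth(1) by (auto simp: in_set_conv_nth)
  qed
  then show ?thesis
    using ones_xor_select_rows[OF lus] by (simp add: o2 c[symmetric] Us cU)
qed

end

section \<open>Correlating the words of weight 10\<close>

fun split7 :: "bool list \<Rightarrow> bool list list" where
  "split7 (a # b # c # d # e # f # g # xs) = [a, b, c, d, e, f, g] # split7 xs"
| "split7 _ = []"

lemma split7_nth:
  "7 * b + 7 \<le> length xs \<Longrightarrow> length (split7 xs ! b) = 7 \<and> (\<forall>i<7. split7 xs ! b ! i = xs ! (7 * b + i))"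
proof (induction xs arbitrary: b rule: split7.induct)
  case (1 a0 a1 a2 a3 a4 a5 a6 xs)
  show ?case
  proof (cases b)
    case 0
    have "([a0, a1, a2, a3, a4, a5, a6] @ xs) ! i = [a0, a1, a2, a3, a4, a5, a6] ! i" if "i < 7" for i
      by (rule nth_append_left) (use that in simp)
    then show ?thesis using 0 by simp
  next
    case (Suc b')
    have "(a0 # a1 # a2 # a3 # a4 # a5 # a6 # xs) ! (7 * b + i) = xs ! (7 * b' + i)" for i
    proof -
      have "7 * b + i = Suc (Suc (Suc (Suc (Suc (Suc (Suc (7 * b' + i)))))))" using Suc by simp
      then show ?thesis by (simp only: nth_Cons_Suc)
    qed
    moreover have "7 * b' + 7 \<le> length xs" using 1(2) Suc by simp
    ultimately show ?thesis using 1(1)[of b'] Suc by simp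
  qed
qed auto

lemma length_split7: "length xs = 28 \<Longrightarrow> length (split7 xs) = 4"
proof -
  have "length (split7 xs) = length xs div 7" for xs
    by (induction xs rule: split7.induct) auto
  then show "length xs = 28 \<Longrightarrow> length (split7 xs) = 4" by simp
qed

text \<open>Position \<open>i\<close> is exchanged with \<open>-i\<close> modulo 7.  With this numbering the shift that is backward on
  the right half becomes a forward shift of all eight blocks.\<close>

fun flip7 :: "bool list \<Rightarrow> bool list" where
  "flip7 [a, b, c, d, e, f, g] = [a, g, f, e, d, c, b]"
| "flip7 xs = xs"

lemma less_7_cases: "i < 7 \<Longrightarrow> i = 0 \<or> i = 1 \<or> i = 2 \<or> i = 3 \<or> i = 4 \<or> i = 5 \<or> i = (6 :: nat)"
  by auto

lemma flip7_nth:
  assumes "length xs = 7"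
  shows "length (flip7 xs) = 7" "i < 7 \<Longrightarrow> flip7 xs ! i = xs ! ((7 - i) mod 7)"
proof -
  obtain a b c d e f g where xs: "xs = [a, b, c, d, e, f, g]"
    using assms by (auto simp: length_Suc_conv numeral_eq_Suc)
  show "length (flip7 xs) = 7" by (simp add: xs)
  assume "i < 7"
  then show "flip7 xs ! i = xs ! ((7 - i) mod 7)"
    using less_7_cases[of i] by (auto simp: xs)
qed

fun word_blocks :: "bool list \<times> bool list \<Rightarrow> bool list list" where
  "word_blocks (u, v) = split7 u @ map flip7 (split7 v)"

lemma word_blocks_nth:
  assumes "length u = 28" "length v = 28"
  shows "length (word_blocks (u, v)) = 8"
    "b < 8 \<Longrightarrow> length (word_blocks (u, v) ! b) = 7"
    "b < 4 \<Longrightarrow> i < 7 \<Longrightarrow> word_blocks (u, v) ! b ! i = u ! (7 * b + i)"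
    "b < 4 \<Longrightarrow> i < 7 \<Longrightarrow> word_blocks (u, v) ! (4 + b) ! i = v ! (7 * b + (7 - i) mod 7)"
proof -
  note l = length_split7[OF assms(1)] length_split7[OF assms(2)]
  show "length (word_blocks (u, v)) = 8" by (simp add: l)
  have u: "length (split7 u ! b) = 7 \<and> (\<forall>i<7. split7 u ! b ! i = u ! (7 * b + i))" if "b < 4" for b
    by (rule split7_nth) (use that assms in simp)
  have v: "length (split7 v ! b) = 7 \<and> (\<forall>i<7. split7 v ! b ! i = v ! (7 * b + i))" if "b < 4" for b
    by (rule split7_nth) (use that assms in simp)
  show "length (word_blocks (u, v) ! b) = 7" if "b < 8"
    using that u[of b] v[of "b - 4"] by (auto simp: nth_append l flip7_nth)
  show "word_blocks (u, v) ! b ! i = u ! (7 * b + i)" if "b < 4" "i < 7"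
    using that u[of b] by (simp add: nth_append l)
  show "word_blocks (u, v) ! (4 + b) ! i = v ! (7 * b + (7 - i) mod 7)" if "b < 4" "i < 7"
    using that v[of b] by (simp add: nth_append l flip7_nth)
qed

text \<open>The sum of \<open>k + i\<close> over the positions \<open>i\<close> of the ones.  Modulo 7 it distinguishes the words in an
  orbit of the shift: a shift by \<open>m\<close> changes it by \<open>m\<close> times the weight of the word.\<close>

primrec index_sum :: "nat \<Rightarrow> bool list \<Rightarrow> nat \<Rightarrow> nat" where
  "index_sum k [] acc = acc"
| "index_sum k (x # xs) acc = index_sum (Suc k) xs (if x then k + acc else acc)"

primrec index_sums :: "bool list list \<Rightarrow> nat \<Rightarrow> nat" where
  "index_sums [] acc = acc"
| "index_sums (x # xs) acc = index_sums xs (index_sum 0 x acc)"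

lemma index_sum_eq: "index_sum k xs acc = acc + (\<Sum>i<length xs. if xs ! i then k + i else 0)"
  by (induction xs arbitrary: k acc)
    (simp_all add: sum.lessThan_Suc_shift del: sum.lessThan_Suc cong: if_cong)

lemma index_sums_eq: "index_sums xss acc = acc + (\<Sum>b<length xss. \<Sum>i<length (xss ! b). if xss ! b ! i then i else 0)"
  by (induction xss arbitrary: acc) (simp_all add: index_sum_eq sum.lessThan_Suc_shift del: sum.lessThan_Suc)

primrec rotations :: "nat \<Rightarrow> bool list list \<Rightarrow> bool list list list" where
  "rotations 0 w = []"
| "rotations (Suc k) w = w # rotations k (map rotate1 w)"

lemma length_rotations [simp]: "length (rotations k w) = k"
  by (induction k arbitrary: w) auto

lemma rotations_nth: "m < k \<Longrightarrow> rotations k w ! m = map (rotate m) w"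
proof (induction k arbitrary: w m)
  case (Suc k)
  show ?case
  proof (cases m)
    case (Suc m')
    then have "rotations (Suc k) w ! m = map (rotate m') (map rotate1 w)"
      using Suc.prems Suc.IH by simp
    also have "\<dots> = map (rotate m) w"
      using Suc by (simp add: rotate_def funpow_swap1)
    finally show ?thesis .
  qed (simp add: map_idI)
qed simp

text \<open>A successor that stays apart from \<^const>\<open>Suc\<close>: it is evaluated on binary numerals, while the
  bounds of the search are unary.\<close>

definition plus_one :: "nat \<Rightarrow> nat" where "plus_one n = n + 1"

definition add_bits :: "bool list \<Rightarrow> nat list \<Rightarrow> nat list" where
  "add_bits = map2 (\<lambda>y n. if y then plus_one n else n)"

definition add_blocks :: "bool list list \<Rightarrow> nat list list \<Rightarrow> nat list list" where
  "add_blocks = map2 add_bits"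

text \<open>The \<open>m\<close>-th entry of \<open>R\<close> is a word rotated by \<open>m\<close>; those with a one at position \<open>m\<close> of \<open>x\<close> are
  added to the counters.\<close>

fun correlate_block :: "bool list \<Rightarrow> bool list list list \<Rightarrow> nat list list \<Rightarrow> nat list list" where
  "correlate_block (True # xs) (w # R) A = correlate_block xs R (add_blocks w A)"
| "correlate_block (False # xs) (w # R) A = correlate_block xs R A"
| "correlate_block xs R A = A"

text \<open>The counter at \<open>(b, c, d)\<close> is increased by the number of pairs of ones of the word in blocks \<open>b\<close>
  and \<open>c\<close> whose positions differ by \<open>d\<close>.\<close>

fun correlate :: "bool list list \<Rightarrow> bool list list list \<Rightarrow> nat list list list \<Rightarrow> nat list list list" where
  "correlate (x # xs) R (A # As) = correlate_block x R A # correlate xs R As"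
| "correlate _ R _ = []"

fun correlations :: "bool list list list \<Rightarrow> nat list list list \<Rightarrow> nat list list list" where
  "correlations [] A = A"
| "correlations (w # ws) A = correlations ws (correlate w (rotations 7 w) A)"

definition shape2 :: "'a list list \<Rightarrow> bool" where
  "shape2 A \<longleftrightarrow> length A = 8 \<and> (\<forall>c<8. length (A ! c) = 7)"

definition shape3 :: "'a list list list \<Rightarrow> bool" where
  "shape3 A \<longleftrightarrow> length A = 8 \<and> (\<forall>b<8. shape2 (A ! b))"

lemma add_blocks_shape: "shape2 w \<Longrightarrow> shape2 A \<Longrightarrow> shape2 (add_blocks w A)"
  by (simp add: shape2_def add_blocks_def add_bits_def)

lemma add_blocks_nth: "shape2 w \<Longrightarrow> shape2 A \<Longrightarrow> c < 8 \<Longrightarrow> d < 7 \<Longrightarrow>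
    add_blocks w A ! c ! d = A ! c ! d + of_bool (w ! c ! d)"
  by (simp add: shape2_def add_blocks_def add_bits_def plus_one_def)

lemma correlate_block_nth:
  assumes "length x = length R" "\<And>w. w \<in> set R \<Longrightarrow> shape2 w" "shape2 A"
  shows "shape2 (correlate_block x R A) \<and> (\<forall>c<8. \<forall>d<7. correlate_block x R A ! c ! d =
    A ! c ! d + (\<Sum>m<length R. of_bool (x ! m \<and> R ! m ! c ! d)))"
  using assms
proof (induction x R A rule: correlate_block.induct)
  case (1 xs w R A)
  have "shape2 (correlate_block xs R (add_blocks w A)) \<and> (\<forall>c<8. \<forall>d<7. correlate_block xs R (add_blocks w A) ! c ! d =
    add_blocks w A ! c ! d + (\<Sum>m<length R. of_bool (xs ! m \<and> R ! m ! c ! d)))"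
    by (rule 1(1)) (use 1(2-4) in \<open>auto intro: add_blocks_shape\<close>)
  then show ?case
    using 1(3,4) by (simp add: add_blocks_nth sum.lessThan_Suc_shift del: sum.lessThan_Suc)
next
  case (2 xs w R A)
  then show ?case by (simp add: sum.lessThan_Suc_shift del: sum.lessThan_Suc)
qed auto

lemma correlate_nth: "length xs = length As \<Longrightarrow>
    length (correlate xs R As) = length As \<and> (\<forall>b<length As. correlate xs R As ! b = correlate_block (xs ! b) R (As ! b))"
  by (induction xs R As rule: correlate.induct) (auto simp: nth_Cons split: nat.split)

lemma correlate_shape:
  assumes "shape2 w" "shape3 A"
  shows "shape3 (correlate w (rotations 7 w) A)"
    "b < 8 \<Longrightarrow> c < 8 \<Longrightarrow> d < 7 \<Longrightarrow> correlate w (rotations 7 w) A ! b ! c ! d =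
       A ! b ! c ! d + (\<Sum>m<7. of_bool (w ! b ! m \<and> w ! c ! ((m + d) mod 7)))"
proof -
  have l: "length w = 8" "length A = 8" using assms by (simp_all add: shape2_def shape3_def)
  have a: "length (correlate w (rotations 7 w) A) = 8"
    "\<And>b. b < 8 \<Longrightarrow> correlate w (rotations 7 w) A ! b = correlate_block (w ! b) (rotations 7 w) (A ! b)"
    using correlate_nth[of w A "rotations 7 w"] l by simp_all
  have R: "shape2 w'" if w': "w' \<in> set (rotations 7 w)" for w'
  proof -
    obtain m where "m < 7" "w' = map (rotate m) w"
      using w' rotations_nth unfolding in_set_conv_nth length_rotations by metis
    then show ?thesis using assms(1) by (simp add: shape2_def)
  qed
  have c: "shape2 (correlate_block (w ! b) (rotations 7 w) (A ! b)) \<and> (\<forall>c<8. \<forall>d<7. correlate_block (w ! b) (rotations 7 w) (A ! b) ! c ! d =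
    A ! b ! c ! d + (\<Sum>m<7. of_bool (w ! b ! m \<and> rotations 7 w ! m ! c ! d)))" if "b < 8" for b
    using correlate_block_nth[of "w ! b" "rotations 7 w" "A ! b", OF _ R] assms that by (simp add: shape2_def shape3_def)
  show "shape3 (correlate w (rotations 7 w) A)"
    unfolding shape3_def using a c by simp
  assume b: "b < 8" and cd: "c < 8" "d < 7"
  have "(\<Sum>m<7. of_bool (w ! b ! m \<and> rotations 7 w ! m ! c ! d) :: nat)
      = (\<Sum>m<7. of_bool (w ! b ! m \<and> w ! c ! ((m + d) mod 7)))"
    by (rule sum.cong[OF refl]) (use cd assms(1) in \<open>simp add: rotations_nth shape2_def nth_rotate\<close>)
  then show "correlate w (rotations 7 w) A ! b ! c ! d =
       A ! b ! c ! d + (\<Sum>m<7. of_bool (w ! b ! m \<and> w ! c ! ((m + d) mod 7)))"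
    using a(2)[OF b] c[OF b] cd by simp
qed

lemma correlations_nth:
  assumes "\<And>w. w \<in> set ws \<Longrightarrow> shape2 w" "shape3 A"
  shows "shape3 (correlations ws A) \<and> (\<forall>b<8. \<forall>c<8. \<forall>d<7. correlations ws A ! b ! c ! d =
     A ! b ! c ! d + (\<Sum>w\<leftarrow>ws. \<Sum>m<7. of_bool (w ! b ! m \<and> w ! c ! ((m + d) mod 7))))"
  using assms
proof (induction ws arbitrary: A)
  case (Cons w ws)
  have w: "shape2 w" using Cons.prems(1) by simp
  note s = correlate_shape[OF w Cons.prems(2)]
  have "shape3 (correlations ws (correlate w (rotations 7 w) A)) \<and> (\<forall>b<8. \<forall>c<8. \<forall>d<7. correlations ws (correlate w (rotations 7 w) A) ! b ! c ! d =
     correlate w (rotations 7 w) A ! b ! c ! d + (\<Sum>w\<leftarrow>ws. \<Sum>m<7. of_bool (w ! b ! m \<and> w ! c ! ((m + d) mod 7))))"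
    by (rule Cons.IH) (use Cons.prems(1) s(1) in auto)
  then show ?case using s(2) by simp
qed auto

primrec sum_sq :: "nat list \<Rightarrow> nat" where
  "sum_sq [] = 0" | "sum_sq (n # ns) = n * n + sum_sq ns"

primrec sum_sq2 :: "nat list list \<Rightarrow> nat" where
  "sum_sq2 [] = 0" | "sum_sq2 (n # ns) = sum_sq n + sum_sq2 ns"

primrec sum_sq3 :: "nat list list list \<Rightarrow> nat" where
  "sum_sq3 [] = 0" | "sum_sq3 (n # ns) = sum_sq2 n + sum_sq3 ns"

lemma sum_sq_nth: "sum_sq xs = (\<Sum>d<length xs. (xs ! d)\<^sup>2)" "sum_sq2 ys = (\<Sum>c<length ys. sum_sq (ys ! c))"
  "sum_sq3 zs = (\<Sum>b<length zs. sum_sq2 (zs ! b))"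
  by (induction xs, simp_all add: power2_eq_square sum.lessThan_Suc_shift del: sum.lessThan_Suc)
    (induction ys, simp_all add: sum.lessThan_Suc_shift del: sum.lessThan_Suc,
     induction zs, simp_all add: sum.lessThan_Suc_shift del: sum.lessThan_Suc)

text \<open>The initial counters, one for each of the orbits of the shift on pairs of coordinates.\<close>

definition zero3 :: "nat list list list" where
  "zero3 = replicate 8 (replicate 8 (replicate 7 0))"

lemma sum_sq3_correlations:
  assumes "\<And>w. w \<in> set ws \<Longrightarrow> shape2 w"
  shows "sum_sq3 (correlations ws zero3) = (\<Sum>b<8. \<Sum>c<8. \<Sum>d<7.
    (\<Sum>w\<leftarrow>ws. \<Sum>m<7. of_bool (w ! b ! m \<and> w ! c ! ((m + d) mod 7)))\<^sup>2)"
proof -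
  have z: "shape3 zero3" by (simp add: shape3_def shape2_def zero3_def)
  have s: "shape3 (correlations ws zero3)" using correlations_nth[OF assms z] by blast
  have e: "correlations ws zero3 ! b ! c ! d = (\<Sum>w\<leftarrow>ws. \<Sum>m<7. of_bool (w ! b ! m \<and> w ! c ! ((m + d) mod 7)))"
    if "b < 8" "c < 8" "d < 7" for b c d
    using correlations_nth[OF assms z] that by (simp add: zero3_def)
  have "sum_sq3 (correlations ws zero3) = (\<Sum>b<8. \<Sum>c<8. \<Sum>d<7. (correlations ws zero3 ! b ! c ! d)\<^sup>2)"
    using s by (simp add: sum_sq_nth shape3_def shape2_def)
  also have "\<dots> = (\<Sum>b<8. \<Sum>c<8. \<Sum>d<7.
    (\<Sum>w\<leftarrow>ws. \<Sum>m<7. of_bool (w ! b ! m \<and> w ! c ! ((m + d) mod 7)))\<^sup>2)"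
    by (intro sum.cong[OF refl]) (simp add: e)
  finally show ?thesis .
qed

section \<open>From a certificate to the properties of a code\<close>

fun codeword :: "bool list list \<Rightarrow> bool list \<Rightarrow> bool list \<times> bool list" where
  "codeword R u = (u, xor_select u R zero28)"

definition ones_eq :: "nat \<Rightarrow> bool list \<Rightarrow> bool" where
  "ones_eq k xs \<longleftrightarrow> ones xs = k"

lemma ones_eq_eval:
  "ones_eq 0 [] = True"
  "ones_eq (Suc k) (True # xs) = ones_eq k xs"
  "ones_eq k (False # xs) = ones_eq k xs"
  by (simp_all add: ones_eq_def)

definition multiple_of_7 :: "nat \<Rightarrow> bool" where "multiple_of_7 n \<longleftrightarrow> 7 dvd n"

lemma multiple_of_7_eval:
  "multiple_of_7 0 = True"
  "multiple_of_7 (Suc (Suc (Suc (Suc (Suc (Suc (Suc n))))))) = multiple_of_7 n"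
proof -
  show "multiple_of_7 0 = True" by (simp add: multiple_of_7_def)
  have "Suc (Suc (Suc (Suc (Suc (Suc (Suc n)))))) = n + 7" by simp
  then show "multiple_of_7 (Suc (Suc (Suc (Suc (Suc (Suc (Suc n))))))) = multiple_of_7 n"
    by (simp only: multiple_of_7_def dvd_add_triv_right_iff)
qed

text \<open>A word of weight 10 whose positions add up to 0 modulo 7.  As 7 does not divide 10, each orbit
  of seven words contains exactly one such word.\<close>

fun word_ok :: "bool list \<times> bool list \<Rightarrow> bool" where
  "word_ok (u, v) \<longleftrightarrow> ones_eq 10 (u @ v) \<and> multiple_of_7 (index_sums (word_blocks (u, v)) 0)"

text \<open>Complementing the right half of a word \<open>(u, u M)\<close> leads to the shadow, because the all-zero left and
  all-one right half is the sum of \<open>half\<close> and the all-one word.\<close>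

fun shadow_ok :: "bool list \<times> bool list \<Rightarrow> bool" where
  "shadow_ok (u, v) \<longleftrightarrow> ones_eq 12 (u @ map Not v)"

text \<open>The bound \<open>268435456\<close> is \<open>2\<^bsup>28\<^esup>\<close>, so that the numbers are determined by their 28 digits.\<close>

fun ascending :: "nat list \<Rightarrow> bool" where
  "ascending [] \<longleftrightarrow> True"
| "ascending [n] \<longleftrightarrow> n < 268435456"
| "ascending (m # n # ns) \<longleftrightarrow> m < n \<and> ascending (n # ns)"

lemma ascending_sound: "ascending ns \<Longrightarrow> sorted_wrt (<) ns \<and> (\<forall>n\<in>set ns. n < 2 ^ 28)"
  by (induction ns rule: ascending.induct) force+

text \<open>The coordinate of position \<open>i\<close> in block \<open>b\<close>, with the reversed numbering in the right half.\<close>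

definition coord :: "nat \<Rightarrow> nat \<Rightarrow> nat" where
  "coord b i = (if b < 4 then 7 * b + i else 7 * b + (7 - i) mod 7)"

lemma sum_coord:
  fixes f :: "nat \<Rightarrow> 'a :: comm_monoid_add"
  shows "(\<Sum>p<56. f p) = (\<Sum>b<8. \<Sum>i<7. f (coord b i))"
proof -
  have "(\<Sum>p<56. f p) = (\<Sum>b<8. \<Sum>p\<in>{b * 7..<b * 7 + 7}. f p)"
    using sum.nat_group[of f 7 8] by simp
  also have "\<dots> = (\<Sum>b<8. \<Sum>i<7. f (7 * b + i))"
  proof (rule sum.cong[OF refl])
    fix b :: nat
    show "(\<Sum>p\<in>{b * 7..<b * 7 + 7}. f p) = (\<Sum>i<7. f (7 * b + i))"
      using sum.shift_bounds_nat_ivl[of f 0 "b * 7" 7]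
      by (simp add: lessThan_atLeast0 add.commute mult.commute)
  qed
  also have "\<dots> = (\<Sum>b<8. \<Sum>i<7. f (coord b i))"
  proof (rule sum.cong[OF refl])
    fix b :: nat
    have "{..<7 :: nat} = {0, 1, 2, 3, 4, 5, 6}" by auto
    then have "(\<Sum>i<7. g i) = (\<Sum>i<7. g ((7 - i) mod 7))" for g :: "nat \<Rightarrow> 'a"
      by (simp add: add_ac)
    from this[of "\<lambda>i. f (7 * b + i)"] show "(\<Sum>i<7. f (7 * b + i)) = (\<Sum>i<7. f (coord b i))"
      by (cases "b < 4") (simp_all add: coord_def)
  qed
  finally show ?thesis .
qed

lemma sum_rotate: "a < 7 \<Longrightarrow> (\<Sum>k<7. f ((k + a) mod 7)) = (\<Sum>k<7. f (k :: nat))"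
proof -
  assume a: "a < 7"
  have i: "((k + a) mod 7 + (7 - a)) mod 7 = k" "((k + (7 - a)) mod 7 + a) mod 7 = k" if "k < 7" for k
    using less_7_cases[OF a] less_7_cases[OF that] by (elim disjE; simp)+
  show ?thesis
    by (rule sum.reindex_bij_witness[of _ "\<lambda>k. (k + (7 - a)) mod 7" "\<lambda>k. (k + a) mod 7"])
      (use i in auto)
qed

context circulant
begin

definition word_of :: "nat \<Rightarrow> bool list \<times> bool list" where
  "word_of n = codeword (row_lists fs) (bits_of 28 n)"

definition supp :: "nat \<Rightarrow> nat set" where
  "supp n = {i. i < 28 \<and> bits_of 28 n ! i}"

lemma supp_sub: "supp n \<subseteq> {..<28}" by (auto simp: supp_def)

lemma img_supp: "img (supp n) = {j. j < 28 \<and> snd (word_of n) ! j}"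
  using xor_select_rows(2)[of "bits_of 28 n"] img_sub by (auto simp: supp_def word_of_def)

lemma length_word_of: "length (fst (word_of n)) = 28" "length (snd (word_of n)) = 28"
  using xor_select_rows(1)[of "bits_of 28 n"] by (simp_all add: word_of_def)

lemma card_supp: "card (supp n) = ones (fst (word_of n))" "card (img (supp n)) = ones (snd (word_of n))"
  by (simp_all add: ones_card length_word_of img_supp) (simp add: supp_def word_of_def)

definition blocks_of :: "nat \<Rightarrow> bool list list" where
  "blocks_of n = word_blocks (word_of n)"

lemma blocks_of_nth:
  "length (blocks_of n) = 8"
  "b < 8 \<Longrightarrow> length (blocks_of n ! b) = 7"
  "b < 4 \<Longrightarrow> i < 7 \<Longrightarrow> blocks_of n ! b ! i \<longleftrightarrow> 7 * b + i \<in> supp n"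
  "b < 4 \<Longrightarrow> i < 7 \<Longrightarrow> blocks_of n ! (4 + b) ! i \<longleftrightarrow> 7 * b + (7 - i) mod 7 \<in> img (supp n)"
proof -
  obtain u v where w: "word_of n = (u, v)" by force
  have uv: "length u = 28" "length v = 28" using length_word_of[of n] by (simp_all add: w)
  have u: "u = bits_of 28 n" using w by (simp add: word_of_def)
  note B = word_blocks_nth[OF uv]
  show "length (blocks_of n) = 8" by (simp only: blocks_of_def w B(1))
  show "length (blocks_of n ! b) = 7" if "b < 8" using that by (simp only: blocks_of_def w B(2))
  show "blocks_of n ! b ! i \<longleftrightarrow> 7 * b + i \<in> supp n" if "b < 4" "i < 7"
  proof -
    have "7 * b + i < 28" using that by simp
    then show ?thesis using that by (simp only: blocks_of_def w B(3)) (simp add: supp_def u)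
  qed
  show "blocks_of n ! (4 + b) ! i \<longleftrightarrow> 7 * b + (7 - i) mod 7 \<in> img (supp n)" if "b < 4" "i < 7"
  proof -
    have "(7 - i) mod 7 < 7" by simp
    then have "7 * b + (7 - i) mod 7 < 28" using that by linarith
    then show ?thesis using that by (simp only: blocks_of_def w B(4)) (simp add: img_supp w)
  qed
qed

definition shifted_word :: "nat \<Rightarrow> nat \<Rightarrow> bit ^ 56" where
  "shifted_word m n = vec_of {i. i < 28 \<and> shift m i \<in> supp n} {j. j < 28 \<and> shift (7 - m) j \<in> img (supp n)}"

lemma shifted_word_code:
  assumes "m < 7"
  shows "shifted_word m n \<in> code" "weight (shifted_word m n) = ones (fst (word_of n)) + ones (snd (word_of n))"
proof -
  have m: "m \<le> 7" "7 - m \<le> 7" using assms by auto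
  have L: "left (shifted_word m n) = shift (7 - m) ` supp n"
    using preimage_shift[OF supp_sub m(1), of n] by (auto simp: shifted_word_def)
  have R: "right (shifted_word m n) = img (shift (7 - m) ` supp n)"
    using img_shift[OF supp_sub m(2), of n] by (auto simp: shifted_word_def)
  show "shifted_word m n \<in> code" by (simp add: code_def L R)
  show "weight (shifted_word m n) = ones (fst (word_of n)) + ones (snd (word_of n))"
    by (simp add: weight_left_right L R card_shift[OF m(2)] card_img_shift[OF supp_sub m(2)] card_supp)
qed

lemma shift_block: "i < 7 \<Longrightarrow> shift m (7 * b + i) = 7 * b + (i + m) mod 7"
  by (simp add: shift_def)

lemma shifted_word_nth:
  assumes "m < 7" "b < 8" "i < 7"
  shows "shifted_word m n $ pos (coord b i) = of_bool (blocks_of n ! b ! ((i + m) mod 7))"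
proof (cases "b < 4")
  case True
  have "7 * b + i < 28" using True assms(3) by simp
  then have "shifted_word m n $ pos (7 * b + i) = of_bool (shift m (7 * b + i) \<in> supp n)"
    by (simp add: shifted_word_def vec_of_left)
  then show ?thesis
    using True assms(3) by (simp add: coord_def shift_block blocks_of_nth(3))
next
  case False
  define c where "c = b - 4"
  have c: "b = 4 + c" "c < 4" using False assms(2) by (auto simp: c_def)
  have i': "(7 - i) mod 7 < 7" by simp
  have lt: "7 * c + (7 - i) mod 7 < 28" using c(2) i' by linarith
  have "coord b i = 28 + (7 * c + (7 - i) mod 7)" by (simp add: coord_def c)
  then have "shifted_word m n $ pos (coord b i) = of_bool (shift (7 - m) (7 * c + (7 - i) mod 7) \<in> img (supp n))"
    using lt by (simp add: shifted_word_def vec_of_right)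
  also have "shift (7 - m) (7 * c + (7 - i) mod 7) = 7 * c + ((7 - i) mod 7 + (7 - m)) mod 7"
    by (rule shift_block[OF i'])
  also have "((7 - i) mod 7 + (7 - m)) mod 7 = (7 - (i + m) mod 7) mod 7"
    using less_7_cases[OF assms(1)] less_7_cases[OF assms(3)] by (elim disjE; simp)
  finally show ?thesis
    using c(2) by (simp add: c(1) blocks_of_nth(4))
qed

text \<open>A one of the shifted word at position \<open>i\<close> comes from position \<open>i + m\<close> modulo 7.  Adding \<open>m\<close> for
  each of the ten ones therefore restores the position sum of the original word, a multiple of 7.\<close>

lemma sum_index_shifted_word:
  assumes "m < 7" "word_ok (word_of n)"
  shows "7 dvd (\<Sum>b<8. \<Sum>i<7. if shifted_word m n $ pos (coord b i) = 1 then i else 0) + 10 * m"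
proof -
  let ?P = "\<lambda>b i. blocks_of n ! b ! i"
  have w: "ones (fst (word_of n)) + ones (snd (word_of n)) = 10"
    and h: "7 dvd index_sums (blocks_of n) 0"
    using assms(2) by (cases "word_of n"; simp add: ones_eq_def multiple_of_7_def blocks_of_def)+
  have P: "shifted_word m n $ pos (coord b i) = 1 \<longleftrightarrow> ?P b ((i + m) mod 7)" if "b < 8" "i < 7" for b i
    using shifted_word_nth[OF assms(1) that, of n] by simp
  have "10 = weight (shifted_word m n)" using shifted_word_code(2)[OF assms(1)] w by simp
  also have "\<dots> = (\<Sum>q\<in>UNIV. if shifted_word m n $ q = 1 then 1 else 0)"
    by (simp add: weight_def flip: sum.inter_filter)
  also have "\<dots> = (\<Sum>b<8. \<Sum>i<7. if shifted_word m n $ pos (coord b i) = 1 then 1 else 0)"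
    by (simp only: sum_pos sum_coord)
  finally have "(\<Sum>b<8. \<Sum>i<7. if shifted_word m n $ pos (coord b i) = 1 then i else 0) + 10 * m
      = (\<Sum>b<8. \<Sum>i<7. if shifted_word m n $ pos (coord b i) = 1 then i else 0)
        + (\<Sum>b<8. \<Sum>i<7. if shifted_word m n $ pos (coord b i) = 1 then 1 else 0) * m"
    by simp
  also have "\<dots> = (\<Sum>b<8. \<Sum>i<7. if shifted_word m n $ pos (coord b i) = 1 then i + m else 0)"
    by (simp add: sum_distrib_right if_distrib[of "\<lambda>x. x * m"] flip: sum.distrib cong: if_cong)
      (intro sum.cong refl, simp)
  also have "\<dots> = (\<Sum>b<8. \<Sum>i<7. if ?P b ((i + m) mod 7) then i + m else 0)"
    by (intro sum.cong[OF refl]) (simp add: P)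
  finally have "((\<Sum>b<8. \<Sum>i<7. if shifted_word m n $ pos (coord b i) = 1 then i else 0) + 10 * m) mod 7
      = (\<Sum>b<8. \<Sum>i<7. if ?P b ((i + m) mod 7) then i + m else 0) mod 7"
    by (rule arg_cong)
  also have "\<dots> = (\<Sum>b<8. \<Sum>i<7. if ?P b ((i + m) mod 7) then (i + m) mod 7 else 0) mod 7"
  proof -
    have "(\<Sum>b<8. \<Sum>i<7. g b i) mod 7 = (\<Sum>b<8. \<Sum>i<7. g b i mod 7) mod 7" for g :: "nat \<Rightarrow> nat \<Rightarrow> nat"
    proof -
      have "(\<Sum>b<8. \<Sum>i<7. g b i) mod 7 = (\<Sum>b<8. (\<Sum>i<7. g b i) mod 7) mod 7"
        by (rule mod_sum_eq[symmetric])
      also have "\<dots> = (\<Sum>b<8. (\<Sum>i<7. g b i mod 7) mod 7) mod 7"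
        by (simp only: mod_sum_eq)
      also have "\<dots> = (\<Sum>b<8. \<Sum>i<7. g b i mod 7) mod 7"
        by (rule mod_sum_eq)
      finally show ?thesis .
    qed
    note * = this
    have if_mod: "(if c then x else 0) mod 7 = (if c then x mod 7 else 0)" for c and x :: nat
      by simp
    from *[of "\<lambda>b i. if ?P b ((i + m) mod 7) then i + m else 0"] show ?thesis
      by (simp only: if_mod)
  qed
  also have "(\<Sum>b<8. \<Sum>i<7. if ?P b ((i + m) mod 7) then (i + m) mod 7 else 0)
      = (\<Sum>b<8. \<Sum>i<7. if ?P b i then i else 0)"
    by (rule sum.cong[OF refl]) (rule sum_rotate[OF assms(1)])
  also have "\<dots> = index_sums (blocks_of n) 0"
    by (simp add: index_sums_eq blocks_of_nth)
  finally show ?thesis using h by (simp only: dvd_eq_mod_eq_0)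
qed

text \<open>The position sum recovers the amount \<open>m\<close> of the shift, because 10 is invertible modulo 7.\<close>

lemma shifted_word_inj:
  assumes "m < 7" "m' < 7" "word_ok (word_of n)" "word_ok (word_of n')" "n < 2 ^ 28" "n' < 2 ^ 28"
    "shifted_word m n = shifted_word m' n'"
  shows "m = m' \<and> n = n'"
proof -
  let ?H = "\<Sum>b<8. \<Sum>i<7. if shifted_word m n $ pos (coord b i) = 1 then i else 0"
  have "7 dvd ?H + 10 * m" "7 dvd ?H + 10 * m'"
    using sum_index_shifted_word[OF assms(1,3)] sum_index_shifted_word[OF assms(2,4)] by (simp_all only: assms(7))
  then have "7 dvd (?H + 10 * m) - (?H + 10 * m')" "7 dvd (?H + 10 * m') - (?H + 10 * m)"
    using dvd_diff_nat by blast+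
  then have "7 dvd 10 * m - 10 * m'" "7 dvd 10 * m' - 10 * m"
    by simp_all
  \<comment> \<open>Ten times the difference of two numbers below 7 is divisible by 7 only if they are equal.\<close>
  then have m: "m = m'"
    using less_7_cases[OF assms(1)] less_7_cases[OF assms(2)] by (elim disjE) simp_all
  have B: "blocks_of n ! b ! i \<longleftrightarrow> blocks_of n' ! b ! i" if "b < 8" "i < 7" for b i
  proof -
    define k where "k = (i + (7 - m)) mod 7"
    have k: "k < 7" "(k + m) mod 7 = i"
      using less_7_cases[OF assms(1)] less_7_cases[OF that(2)] by (auto simp: k_def)
    have "(of_bool (blocks_of n ! b ! i) :: bit) = of_bool (blocks_of n' ! b ! i)"
      using shifted_word_nth[OF assms(1) that(1) k(1), of n] shifted_word_nth[OF assms(1) that(1) k(1), of n'] assms(7) m k(2)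
      by simp
    then show ?thesis by (simp only: of_bool_eq_iff)
  qed
  have "bits_of 28 n = bits_of 28 n'"
  proof (rule nth_equalityI)
    fix i assume "i < length (bits_of 28 n)"
    then have i: "i < 28" by simp
    then have "i div 7 < 4" "i mod 7 < 7" "7 * (i div 7) + i mod 7 = i" by auto
    then have "i \<in> supp n \<longleftrightarrow> i \<in> supp n'"
      using B[of "i div 7" "i mod 7"] blocks_of_nth(3)[of "i div 7" "i mod 7"] by simp
    then show "bits_of 28 n ! i = bits_of 28 n' ! i" using i by (simp add: supp_def)
  qed simp
  then show ?thesis using m bits_of_inj[of 28 n n'] assms(5,6) by blast
qed

text \<open>The \<open>7 * 44 = 308\<close> shifted words are distinct, so they are all words of weight 10.  The number of
  them that contain two given positions \<open>i\<close> and \<open>j\<close> of blocks \<open>b\<close> and \<open>c\<close> depends only on \<open>b\<close>,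
  \<open>c\<close> and the difference of \<open>i\<close> and \<open>j\<close>, which accounts for the factor 7.\<close>

lemma pair_energy_code:
  assumes min_dist_check: "min_dist_check (row_groups fs)"
    and ascending: "ascending ws" and len: "length ws = 44"
    and ok: "\<And>n. n \<in> set ws \<Longrightarrow> word_ok (word_of n)"
  shows "pair_energy code = 7 * sum_sq3 (correlations (map blocks_of ws) zero3)"
proof -
  let ?f = "\<lambda>(m, n). shifted_word m n"
  have ws: "distinct ws" "\<And>n. n \<in> set ws \<Longrightarrow> n < 2 ^ 28"
    using ascending_sound[OF ascending] strict_sorted_iff by blast+
  have inj: "inj_on ?f ({..<7} \<times> set ws)"
  proof (rule inj_onI)
    fix x y assume x: "x \<in> {..<7} \<times> set ws" and y: "y \<in> {..<7} \<times> set ws" and eq: "?f x = ?f y"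
    obtain m n m' n' where xy: "x = (m, n)" "y = (m', n')" by (cases x; cases y)
    have "m = m' \<and> n = n'"
      by (rule shifted_word_inj) (use x y eq xy ok ws(2) in auto)
    then show "x = y" by (simp add: xy)
  qed
  have S10: "{x\<in>code. weight x = 10} = ?f ` ({..<7} \<times> set ws)"
  proof (rule card_subset_eq[symmetric])
    show "?f ` ({..<7} \<times> set ws) \<subseteq> {x\<in>code. weight x = 10}"
    proof (rule subsetI)
      fix x assume "x \<in> ?f ` ({..<7} \<times> set ws)"
      then obtain m n where x: "m < 7" "n \<in> set ws" "x = shifted_word m n" by auto
      have "ones (fst (word_of n)) + ones (snd (word_of n)) = 10"
        using ok[OF x(2)] by (cases "word_of n") (simp add: ones_eq_def)
      then show "x \<in> {x\<in>code. weight x = 10}"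
        using shifted_word_code[OF x(1), of n] by (simp add: x(3))
    qed
    have "card (?f ` ({..<7} \<times> set ws)) = 308"
      using inj distinct_card[OF ws(1)] len by (simp add: card_image card_cartesian_product)
    moreover have "card {x\<in>code. weight x = 10} = 308"
      by (rule card_code_weight_10[OF small_supports[OF min_dist_check]])
    ultimately show "card (?f ` ({..<7} \<times> set ws)) = card {x\<in>code. weight x = 10}"
      by (simp only:)
  qed simp
  define T where "T b c d = (\<Sum>n\<in>set ws. \<Sum>k<7. of_bool (blocks_of n ! b ! k \<and> blocks_of n ! c ! ((k + d) mod 7)) :: nat)" for b c d
  have pair_count: "pair_count code (pos (coord b i)) (pos (coord c j)) = T b c ((j + (7 - i)) mod 7)"
    if "b < 8" "i < 7" "c < 8" "j < 7" for b i c j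
  proof -
    let ?Q = "\<lambda>(m, n). blocks_of n ! b ! ((i + m) mod 7) \<and> blocks_of n ! c ! ((j + m) mod 7)"
    have Q: "?f x $ pos (coord b i) = 1 \<and> ?f x $ pos (coord c j) = 1 \<longleftrightarrow> ?Q x" if "x \<in> {..<7} \<times> set ws" for x
      using that \<open>b < 8\<close> \<open>i < 7\<close> \<open>c < 8\<close> \<open>j < 7\<close> by (auto simp: shifted_word_nth)
    have "{x\<in>code. weight x = 10 \<and> x $ pos (coord b i) = 1 \<and> x $ pos (coord c j) = 1}
        = {x\<in>?f ` ({..<7} \<times> set ws). x $ pos (coord b i) = 1 \<and> x $ pos (coord c j) = 1}"
      unfolding S10[symmetric] by blast
    also have "\<dots> = ?f ` {x\<in>{..<7} \<times> set ws. ?Q x}"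
      using Q by blast
    finally have "pair_count code (pos (coord b i)) (pos (coord c j)) = card (?f ` {x\<in>{..<7} \<times> set ws. ?Q x})"
      by (simp only: pair_count_def)
    also have "\<dots> = card {x\<in>{..<7} \<times> set ws. ?Q x}"
      by (rule card_image) (rule inj_on_subset[OF inj], blast)
    also have "\<dots> = (\<Sum>x\<in>{..<7} \<times> set ws. if ?Q x then 1 else 0)"
      by (simp flip: sum.inter_filter)
    also have "\<dots> = (\<Sum>m<7. \<Sum>n\<in>set ws. if ?Q (m, n) then 1 else 0)"
      by (simp add: sum.cartesian_product case_prod_beta)
    also have "\<dots> = (\<Sum>n\<in>set ws. \<Sum>m<7. if ?Q (m, n) then 1 else 0)"
      by (rule sum.swap)
    also have "\<dots> = T b c ((j + (7 - i)) mod 7)"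
      unfolding T_def
    proof (rule sum.cong[OF refl])
      fix n
      have e: "(m + i + (j + (7 - i)) mod 7) mod 7 = (j + m) mod 7" for m
      proof -
        have "(m + i + (j + (7 - i)) mod 7) mod 7 = (m + i + (j + (7 - i))) mod 7"
          by (rule mod_add_right_eq)
        also have "m + i + (j + (7 - i)) = (j + m) + 7" using that(2) by simp
        finally show ?thesis by simp
      qed
      have "(\<Sum>m<7. if ?Q (m, n) then 1 else 0 :: nat)
          = (\<Sum>m<7. of_bool (blocks_of n ! b ! ((m + i) mod 7) \<and> blocks_of n ! c ! (((m + i) mod 7 + (j + (7 - i)) mod 7) mod 7)))"
        by (rule sum.cong[OF refl]) (simp only: prod.case mod_add_left_eq e add.commute[of i] of_bool_def)
      also have "\<dots> = (\<Sum>k<7. of_bool (blocks_of n ! b ! k \<and> blocks_of n ! c ! ((k + (j + (7 - i)) mod 7) mod 7)))"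
        by (rule sum_rotate[OF that(2)])
      finally show "(\<Sum>m<7. if ?Q (m, n) then 1 else 0 :: nat)
          = (\<Sum>k<7. of_bool (blocks_of n ! b ! k \<and> blocks_of n ! c ! ((k + (j + (7 - i)) mod 7) mod 7)))" .
    qed
    finally show ?thesis .
  qed
  have rot: "(\<Sum>j<7. g ((j + (7 - i)) mod 7)) = (\<Sum>d<7. g d)" if "i < 7" for i and g :: "nat \<Rightarrow> nat"
  proof (cases "i = 0")
    case True
    then show ?thesis by simp
  next
    case False
    then show ?thesis by (intro sum_rotate) simp
  qed
  have "pair_energy code = (\<Sum>b<8. \<Sum>i<7. \<Sum>c<8. \<Sum>j<7. (pair_count code (pos (coord b i)) (pos (coord c j)))\<^sup>2)"
    unfolding pair_energy_def by (simp only: sum_pos sum_coord)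
  also have "\<dots> = (\<Sum>b<8. \<Sum>i<7. \<Sum>c<8. \<Sum>j<7. (T b c ((j + (7 - i)) mod 7))\<^sup>2)"
    by (intro sum.cong[OF refl]) (simp add: pair_count)
  also have "\<dots> = (\<Sum>b<8. \<Sum>i<7::nat. \<Sum>c<8. \<Sum>d<7. (T b c d)\<^sup>2)"
    by (intro sum.cong[OF refl] rot) simp
  also have "\<dots> = 7 * (\<Sum>b<8. \<Sum>c<8. \<Sum>d<7. (T b c d)\<^sup>2)"
    by (simp add: sum_distrib_left)
  also have "(\<Sum>b<8. \<Sum>c<8. \<Sum>d<7. (T b c d)\<^sup>2) = sum_sq3 (correlations (map blocks_of ws) zero3)"
  proof -
    have s: "shape2 w" if "w \<in> set (map blocks_of ws)" for w
      using that by (auto simp: shape2_def blocks_of_nth)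
    have t: "T b c d = (\<Sum>w\<leftarrow>map blocks_of ws. \<Sum>m<7. of_bool (w ! b ! m \<and> w ! c ! ((m + d) mod 7)))" for b c d
      by (simp add: T_def sum_list_distinct_conv_sum_set[OF ws(1)] o_def)
    show ?thesis by (simp only: sum_sq3_correlations[OF s] t)
  qed
  finally show ?thesis .
qed

end

text \<open>The length as a binary numeral.\<close>

primrec len_acc :: "'a list \<Rightarrow> nat \<Rightarrow> nat" where
  "len_acc [] n = n"
| "len_acc (x # xs) n = len_acc xs (plus_one n)"

lemma len_acc_eq: "len_acc xs n = n + length xs"
  by (induction xs arbitrary: n) (simp_all add: plus_one_def)

text \<open>The three stages of the check are separate functions because the simplifier evaluates arguments
  before it unfolds a call: the rows and the words are computed once and used several times.\<close>

definition certified_words :: "(bool list \<times> bool list) list \<Rightarrow> nat \<Rightarrow> bool" where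
  "certified_words W tot \<longleftrightarrow> list_all word_ok W \<and> sum_sq3 (correlations (map word_blocks W) zero3) = tot"

definition certified_rows :: "bool list list \<Rightarrow> nat list \<Rightarrow> nat \<Rightarrow> nat \<Rightarrow> bool" where
  "certified_rows R ws u tot \<longleftrightarrow> orth_rows R \<and> shadow_ok (codeword R (bits_of 28 u)) \<and> len_acc ws 0 = 44 \<and> ascending ws
     \<and> certified_words (map (codeword R) (map (bits_of 28) ws)) tot"

definition certified_groups :: "bool list list list \<Rightarrow> nat list \<Rightarrow> nat \<Rightarrow> nat \<Rightarrow> bool" where
  "certified_groups Bs ws u tot \<longleftrightarrow> min_dist_check Bs \<and> certified_rows (concat Bs) ws u tot"

text \<open>The ten upper triangular blocks of the matrix, the left halves of the 44 words of weight 10, the left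
  half of a word that leads to weight 12 in the shadow, and the pair energy divided by 7.  Blocks and
  halves are written as binary numbers.\<close>

type_synonym certificate = "nat list \<times> nat list \<times> nat \<times> nat"

fun certified :: "certificate \<Rightarrow> bool" where
  "certified (fs, ws, u, tot) \<longleftrightarrow> certified_groups (map (block_rows 7) (blocks fs)) ws u tot"

definition circulant_code :: "nat list \<Rightarrow> (bit ^ 56) set" where
  "circulant_code fs = symmetric_orthogonal.code (mat fs)"

text \<open>The support of the word for \<open>u\<close> witnesses the weight 12 in the shadow.\<close>

lemma certified_sound:
  assumes "certified (fs, ws, u, tot)"
  shows "is_code 56 28 10 (circulant_code fs) \<and> self_dual (circulant_code fs) \<and> singly_even (circulant_code fs) \<and> s_extremal (circulant_code fs)"
    and "pair_energy (circulant_code fs) = 7 * tot"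
proof -
  have m: "min_dist_check (row_groups fs)" and o: "orth_rows (row_lists fs)" and s: "shadow_ok (codeword (row_lists fs) (bits_of 28 u))"
    and l: "length ws = 44" and a: "ascending ws" and w: "list_all word_ok (map (codeword (row_lists fs)) (map (bits_of 28) ws))"
    and t: "sum_sq3 (correlations (map word_blocks (map (codeword (row_lists fs)) (map (bits_of 28) ws))) zero3) = tot"
    using assms by (simp_all only: certified.simps certified_groups_def certified_rows_def certified_words_def row_groups_def[symmetric]
        row_lists_def[symmetric] len_acc_eq add_0)
  interpret circulant fs by standard (rule o)
  have small_supports: "10 \<le> card U + card (img U) \<and> card (img U) \<le> 19 + card U"
    if "U \<subseteq> {..<28}" "U \<noteq> {}" "card U \<le> 4" for U
    by (rule small_supports[OF m that])
  have sh: "card (img (supp u)) = card (supp u) + 16"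
  proof -
    have neg: "ones (map Not v) + ones v = length v" for v
      by (induction v) auto
    obtain x y where xy: "word_of u = (x, y)" by force
    have "ones x + ones (map Not y) = 12"
      using s by (simp only: word_of_def[symmetric] xy shadow_ok.simps ones_eq_def ones_append)
    moreover have "ones (map Not y) + ones y = 28"
      using neg[of y] length_word_of(2)[of u] by (simp add: xy)
    ultimately show ?thesis by (simp add: card_supp xy)
  qed
  have "is_code 56 28 10 code \<and> self_dual code \<and> singly_even code \<and> s_extremal code"
    by (rule code_properties[OF small_supports supp_sub sh])
  then show "is_code 56 28 10 (circulant_code fs) \<and> self_dual (circulant_code fs) \<and> singly_even (circulant_code fs) \<and> s_extremal (circulant_code fs)"
    by (simp only: circulant_code_def)
  have "word_ok (word_of n)" if "n \<in> set ws" for n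
    using w that by (auto simp: list_all_iff word_of_def)
  from pair_energy_code[OF m a l this]
  show "pair_energy (circulant_code fs) = 7 * tot"
    using t by (simp add: circulant_code_def blocks_of_def[abs_def] word_of_def[abs_def] o_def)
qed

section \<open>Rewrite rules that evaluate a certificate\<close>

text \<open>Counters that a recursion decreases are unary, so that each step is a single match.\<close>

lemma unary_eval:
  "bits_of 7 n = bits_of (Suc (Suc (Suc (Suc (Suc (Suc (Suc 0))))))) n"
  "bits_of 28 n = bits_of (Suc (Suc (Suc (Suc (Suc (Suc (Suc (Suc (Suc (Suc (Suc (Suc (Suc (Suc (Suc (Suc (Suc (Suc (Suc (Suc (Suc (Suc (Suc (Suc (Suc (Suc (Suc (Suc 0)))))))))))))))))))))))))))) n"
  "block_rows 7 bs = block_rows (Suc (Suc (Suc (Suc (Suc (Suc (Suc 0))))))) bs"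
  "rotations 7 w = rotations (Suc (Suc (Suc (Suc (Suc (Suc (Suc 0))))))) w"
  "ones_eq 10 xs = ones_eq (Suc (Suc (Suc (Suc (Suc (Suc (Suc (Suc (Suc (Suc 0)))))))))) xs"
  "ones_eq 12 xs = ones_eq (Suc (Suc (Suc (Suc (Suc (Suc (Suc (Suc (Suc (Suc (Suc (Suc 0)))))))))))) xs"
  "thresholds = [(Suc (Suc (Suc (Suc (Suc (Suc (Suc (Suc 0))))))), Suc (Suc (Suc (Suc (Suc (Suc (Suc 0))))))), (Suc (Suc (Suc (Suc (Suc (Suc (Suc 0)))))), Suc (Suc (Suc (Suc (Suc (Suc 0)))))), (Suc (Suc (Suc (Suc (Suc (Suc 0))))), Suc (Suc (Suc (Suc (Suc 0)))))]"
  "zero28 = replicate (Suc (Suc (Suc (Suc (Suc (Suc (Suc (Suc (Suc (Suc (Suc (Suc (Suc (Suc (Suc (Suc (Suc (Suc (Suc (Suc (Suc (Suc (Suc (Suc (Suc (Suc (Suc (Suc 0)))))))))))))))))))))))))))) False"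
  "zero3 = replicate (Suc (Suc (Suc (Suc (Suc (Suc (Suc (Suc 0)))))))) (replicate (Suc (Suc (Suc (Suc (Suc (Suc (Suc (Suc 0)))))))) (replicate (Suc (Suc (Suc (Suc (Suc (Suc (Suc 0))))))) 0))"
  "search_from (r # rs) = (far (Suc (Suc (Suc (Suc (Suc (Suc (Suc (Suc (Suc 0))))))))) (Suc (Suc (Suc (Suc (Suc (Suc (Suc (Suc 0)))))))) zero28 r \<and> search thresholds r rs)"
  by (simp_all only: eval_nat_numeral thresholds_def zero28_def zero3_def search_from.simps BitM.simps)

text \<open>For the last row of a sum, the bounds are tested without computing the sum.\<close>

lemma search_eval:
  "search [(a, b)] t (r # rs) = (far a b t r \<and> search [(a, b)] t rs)"
  "search ((a, b) # th # ths) t (r # rs) =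
     (far a b t r \<and> search (th # ths) (xor_list t r) rs \<and> search ((a, b) # th # ths) t rs)"
  "search ths t [] = True"
  by (simp, simp, cases ths) auto

lemma rotate1_7: "rotate1 [a, b, c, d, e, f, g] = [b, c, d, e, f, g, a]"
  by simp

lemma index_sum_eval:
  "index_sum k [] acc = acc"
  "index_sum k (True # xs) acc = index_sum (Suc k) xs (k + acc)"
  "index_sum k (False # xs) acc = index_sum (Suc k) xs acc"
  by simp_all

lemma plus_one_eval:
  "plus_one 0 = 1"
  "plus_one 1 = numeral (num.Bit0 num.One)"
  "plus_one (numeral n) = numeral (Num.inc n)"
  by (simp_all add: plus_one_def add_One)

text \<open>A separate rule for an empty block, because most blocks of a word of weight 10 have few ones.\<close>

lemma add_bits_eval:
  "add_bits [] [] = []"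
  "add_bits (True # ys) (n # ns) = plus_one n # add_bits ys ns"
  "add_bits (False # ys) (n # ns) = n # add_bits ys ns"
  "add_bits [False, False, False, False, False, False, False] [a, b, c, d, e, f, g] = [a, b, c, d, e, f, g]"
  "add_blocks [] [] = []"
  "add_blocks (y # w) (v # A) = add_bits y v # add_blocks w A"
  by (simp_all add: add_bits_def add_blocks_def)

lemma true_eval: "(True \<and> P) = P" "(x = x) = True" "(\<not> True) = False" "(\<not> False) = True"
  by simp_all

text \<open>No arithmetic beyond these rules is involved, which keeps the evaluation of a certificate to
  single rewriting steps on constructor terms.\<close>

lemmas certified_eval =
  certified.simps certified_groups_def certified_rows_def certified_words_def true_eval unary_eval
  blocks.simps(1) list.map bits_of_eval block_rows.simps concat.simps append.simps rotate1_7
  min_dist_check.simps search_eval far_eval xor_list_eval replicate.simps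
  orth_rows.simps even_overlaps.simps even_overlap_eval weight_check_eval
  codeword.simps xor_select.simps shadow_ok.simps word_ok.simps ones_eq_eval
  len_acc.simps plus_one_eval Num.inc.simps ascending.simps
  list.pred_inject word_blocks.simps split7.simps flip7.simps index_sums.simps index_sum_eval multiple_of_7_eval
  add_0 add_Suc add_0_right
  correlations.simps correlate.simps correlate_block.simps rotations.simps add_bits_eval
  sum_sq.simps sum_sq2.simps sum_sq3.simps
  mult_zero_left mult_1 numeral_times_numeral numeral_plus_numeral one_plus_numeral numeral_plus_one
  one_add_one add_num_simps mult_num_simps
  numeral_less_iff less_num_simps le_num_simps one_less_numeral_iff

section \<open>The 71 codes\<close>

text \<open>The certificates are ordered by increasing energy.\<close>

definition batch1 :: "certificate list" where
"batch1 = [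
  ([71, 74, 96, 46, 20, 45, 60, 64, 66, 104],
    [4228, 4353, 33336, 65536, 395281, 668944, 1573376, 2183457, 3146249, 4489216, 4522049,
     6291493, 8421650, 8663552, 9502768, 10503184, 12585745, 14909952, 16976128, 17042464,
     17162256, 17859073, 25231369, 33562880, 34078724, 50348800, 58737192, 67108994, 67207178,
     67510466, 68425728, 76546562, 86048770, 134219817, 134226971, 134348808, 134484225,
     135528448, 136366152, 142737696, 151001089, 152045584, 168039832, 201622016],
    9, 62304),
  ([66, 16, 9, 102, 86, 45, 57, 121, 24, 52],
    [1, 2068, 2128, 10242, 35857, 263169, 656290, 1049104, 1057928, 1065386, 1179650, 1181248,
     2099715, 2425600, 4294660, 5259528, 8388833, 8388868, 8717316, 8724608, 16785796, 16859153,
     18645121, 18882560, 20988932, 22874112, 25305104, 33832966, 34144392, 41945121, 50331686,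
     68160544, 71864320, 75503685, 79826944, 84150018, 84410497, 100679704, 100976648, 101452304,
     139493384, 148899840, 201458752, 214059074],
    192, 62368),
  ([40, 16, 75, 66, 9, 20, 102, 13, 99, 50],
    [32, 512, 66581, 81952, 336388, 524451, 1049228, 1065024, 1585418, 2114081, 2383904, 4457025,
     6359168, 8431744, 8814656, 8978690, 16777428, 18088504, 21733409, 25952512, 33554945,
     33557152, 34611488, 35661976, 37814416, 42205568, 53477377, 54790144, 67118113, 67240970,
     67311616, 67682308, 68174352, 69209612, 71632896, 75497536, 85991440, 134221874, 134357376,
     134447108, 134752260, 136577034, 151289858, 186732804],
    147456, 62400),
  ([63, 73, 10, 18, 34, 119, 20, 41, 6, 52],
    [273, 2564, 4715, 5121, 35009, 41027, 74336, 524298, 532481, 558240, 717312, 794624, 2097188,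
     2114184, 2164756, 2695172, 3178496, 8390756, 11012608, 11796992, 12847232, 16816256,
     16974344, 18919424, 19417632, 29493248, 33574992, 33689730, 38797336, 42467464, 67190849,
     67682308, 72362244, 76550208, 106975488, 119209984, 123731971, 134217728, 134250552,
     134268932, 134365444, 134545456, 201339921, 218305572],
    129, 62560),
  ([27, 47, 57, 45, 126, 54, 34, 82, 10, 117],
    [16526, 24580, 77896, 280096, 331908, 409920, 475137, 524962, 1054849, 1081605, 1572962,
     4195392, 4204096, 4784704, 6439936, 6816002, 8486924, 8671253, 8684288, 10486850, 11075712,
     11534480, 12584452, 16785920, 17563936, 17891328, 18088585, 33554456, 33751106, 33754752,
     37750801, 41943248, 42205442, 67404304, 69339392, 100729092, 103415808, 110100736,
     134223912, 134283345, 171967328, 201328136, 201359620, 212078593],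
    1, 62592),
  ([18, 41, 108, 51, 95, 120, 54, 111, 21, 18],
    [4228, 4256, 22688, 32780, 131264, 229696, 557184, 565268, 1052928, 2162689, 4198917,
     4734976, 5701952, 6292936, 8388834, 8421562, 11599874, 16777473, 16778248, 17039361,
     17039616, 17828000, 18892808, 18948370, 21008496, 27394112, 33820160, 33826564, 34095568,
     67125896, 67649536, 67674113, 71959108, 84672556, 118490178, 134236228, 134547472,
     135372800, 136315904, 139462784, 151420934, 168562880, 218116136, 239338497],
    128, 62640),
  ([75, 61, 65, 72, 126, 66, 114, 19, 80, 115],
    [16384, 17218, 28692, 131465, 131712, 262404, 270352, 2359408, 3146017, 3152896, 3276960,
     4195587, 4300832, 4874240, 5373972, 8398865, 8519712, 9441793, 16783400, 16788032, 16860672,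
     17861123, 18014209, 19005956, 21037121, 25184264, 33562752, 33563142, 34116608, 34668673,
     46317569, 67371520, 68160002, 68428800, 69468232, 75759914, 76022922, 84410464, 96600608,
     134221826, 142737488, 153255936, 168091969, 176685220],
    128, 62672),
  ([119, 97, 15, 101, 80, 27, 77, 31, 120, 55],
    [10632, 33172, 33824, 107024, 135256, 266499, 525664, 819458, 1114240, 1187874, 1343488,
     2494528, 3670560, 4199172, 8429728, 8519936, 8667649, 8716288, 8918072, 9568276, 10487876,
     12599314, 12846096, 16974344, 17852416, 21106977, 26218504, 33557124, 33701984, 34604035,
     37787648, 67371072, 71303296, 71368968, 72384540, 75499616, 109053474, 134217757, 134555648,
     143687744, 158400516, 169940480, 201364480, 240132100],
    1, 62736),
  ([125, 41, 65, 40, 72, 95, 125, 38, 123, 112],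
    [656, 3104, 17732, 65553, 76034, 264716, 531457, 567298, 591980, 656417, 1134600, 4196641,
     4587588, 5243904, 6594560, 8423424, 8520707, 10504320, 13647873, 16778337, 25232896,
     29624864, 33562960, 34603072, 34738177, 34776066, 35664936, 36044802, 38406144, 39649296,
     39846048, 42011170, 67371322, 67766528, 109084800, 134381616, 134480932, 135272452,
     135282880, 138429056, 142608384, 155320321, 184582176, 201392134],
    128, 62752)]"

lemma batch1: "list_all certified batch1"
  by (simp only: batch1_def certified_eval)

definition batch2 :: "certificate list" where
"batch2 = [
  ([10, 26, 6, 34, 65, 113, 106, 76, 113, 14],
    [1, 1550, 2114, 49154, 67648, 73832, 524706, 788224, 1057024, 2326592, 4194576, 4194708,
     4457472, 6298304, 6324277, 6326280, 7341120, 9963776, 11018752, 16984064, 17074180,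
     17433216, 17825793, 17891352, 20979715, 21168192, 33571348, 34635906, 41977888, 52052480,
     67136034, 67895884, 68289540, 71404810, 77631746, 96731652, 134218499, 134777088, 134873184,
     136335392, 137429024, 142607363, 142672144, 151521288],
    130, 62768),
  ([75, 35, 53, 17, 3, 68, 5, 61, 33, 21],
    [256, 2648, 10256, 33317, 65680, 72736, 132100, 532784, 1048965, 1114374, 2637956, 3178564,
     4194304, 4197448, 4624384, 9568513, 16777795, 17039368, 19922978, 21004288, 25231617,
     33554946, 33561092, 33561632, 33653761, 33947840, 34078818, 34619402, 67404034, 76547154,
     90276352, 100728865, 101222400, 135285892, 136369154, 138412544, 138977489, 142618625,
     142868640, 151427072, 151523840, 155869184, 156508488, 202147856],
    3, 62816),
  ([114, 81, 40, 120, 40, 54, 106, 8, 9, 14],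
    [704, 4300, 8712, 39456, 65956, 131082, 132613, 262144, 565768, 598073, 1058828, 2402304,
     2687234, 4202888, 4260388, 4718613, 5310496, 6569992, 8422400, 8486912, 8716432, 8912912,
     10027072, 12718208, 17334432, 18087946, 18907142, 33824912, 42074160, 51380257, 68159272,
     69992960, 71567890, 78185984, 80740480, 89137680, 134226944, 134482016, 137019520,
     148905984, 152050114, 167792644, 201326860, 210108488],
    9, 62864),
  ([24, 110, 108, 18, 34, 60, 5, 73, 5, 74],
    [614, 2116, 49280, 142344, 262286, 267360, 524360, 1061008, 1082368, 1188097, 2100289,
     2232906, 2725904, 4194658, 4259904, 6332480, 8716321, 8979200, 9437197, 10557440, 16781954,
     33554432, 33554833, 33571840, 33833504, 34144800, 35913864, 38576256, 42205444, 51126530,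
     63705088, 67649539, 67782690, 68157952, 71303184, 84938754, 92405888, 137364484, 138682369,
     138690612, 142877184, 151031816, 151538240, 176821265],
    5, 62896),
  ([3, 84, 113, 57, 125, 65, 80, 50, 15, 81],
    [642, 2896, 16394, 65833, 393217, 442384, 790788, 2097315, 2099328, 4276354, 4391296,
     6422538, 8398848, 8650754, 9478472, 10503200, 12648528, 16779012, 16787465, 16827520,
     16908320, 17965058, 18877442, 18944004, 21252096, 25198595, 29630469, 33566852, 33588325,
     33692000, 33833000, 34097168, 35323938, 42209288, 50492416, 50634752, 67118368, 68682368,
     101785618, 134479888, 136577089, 142738464, 143986816, 234882112],
    9, 62912),
  ([23, 74, 18, 23, 23, 3, 30, 19, 34, 73],
    [13, 145, 12704, 32768, 33282, 43028, 67625, 393224, 528388, 823304, 1378560, 1906816,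
     2392132, 2699264, 4304961, 6325280, 8716424, 8913152, 9437632, 9439244, 16908549, 18874892,
     21498112, 33816962, 36855945, 42008839, 61341840, 68162576, 68682368, 69206018, 76063104,
     92275008, 100664548, 104857640, 110182408, 134218112, 134234119, 134251074, 134299713,
     135004928, 142753985, 153224192, 159383588, 201360896],
    3, 62928),
  ([15, 41, 15, 34, 99, 23, 48, 55, 51, 93],
    [1033, 6420, 70274, 70528, 131208, 196715, 262178, 270628, 535041, 868384, 1312773, 2100608,
     2279424, 3409921, 3670016, 4205600, 4456529, 5391408, 6299696, 7349251, 8388611, 8470534,
     8783104, 8947720, 8992896, 9502880, 18358528, 19005457, 19137280, 34603040, 34636864,
     41944384, 71319585, 71565865, 72090624, 76022144, 83959840, 103055360, 150994981, 150995017,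
     151523336, 201343504, 235470848, 247472384],
    16384, 62976),
  ([90, 107, 72, 33, 126, 12, 90, 117, 92, 25],
    [262594, 524801, 528649, 589918, 1048616, 1310736, 1836064, 2097272, 2097985, 2263044,
     2622608, 2625541, 4243972, 4260388, 6294080, 8564748, 8684608, 10945026, 17170690, 17829888,
     18366496, 33591936, 35857920, 38281218, 41944160, 41975808, 42205208, 51380992, 67119104,
     67305664, 67637764, 68190752, 76022336, 77598728, 84936016, 134320129, 134489130, 134619137,
     134783104, 135004432, 136315904, 136446598, 142606368, 180359936],
    128, 62992),
  ([23, 73, 15, 34, 18, 96, 36, 50, 113, 47],
    [8192, 67908, 118912, 198928, 311440, 327826, 598019, 1051731, 1720352, 2147664, 2360512,
     3147364, 5242944, 6299648, 8388758, 8430723, 8650916, 9437696, 10504208, 13635588, 16778529,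
     17055762, 17825808, 25691138, 33564944, 34209795, 34672768, 37814290, 41947680, 51904544,
     67109761, 67634308, 71303496, 79691776, 101188672, 101845280, 134546048, 135331876,
     138494976, 152064531, 168302592, 171984896, 202375168, 234922017],
    5, 63008)]"

lemma batch2: "list_all certified batch2"
  by (simp only: batch2_def certified_eval)

definition batch3 :: "certificate list" where
"batch3 = [
  ([57, 82, 86, 119, 6, 114, 120, 19, 80, 32],
    [580, 8768, 65740, 263745, 340995, 393218, 1114633, 2121728, 2230786, 2688128, 2720516,
     3146758, 12714050, 16777600, 16782384, 16811776, 16883880, 17399810, 17563905, 17858692,
     25436288, 25761800, 26214409, 29364288, 33554437, 33558665, 34113552, 34867264, 67642372,
     68157568, 68161548, 71860226, 75564544, 76554244, 100796424, 134267905, 134481956,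
     134492161, 135283973, 138446852, 142868489, 184909856, 201343552, 243271683],
    1, 63024),
  ([119, 25, 68, 66, 90, 106, 3, 7, 99, 103],
    [5136, 8197, 33920, 37424, 41616, 65560, 1054726, 1061378, 1572896, 2097464, 4228609,
     4325911, 4784128, 6361600, 8591394, 16908289, 17073280, 17113104, 19923216, 25298946,
     33572929, 34211856, 39584896, 41944376, 67113252, 67174528, 67504192, 67698721, 69992456,
     72351778, 83918848, 84444232, 134316224, 134497281, 136327296, 136348680, 136429568,
     138415428, 138428464, 138486312, 142819408, 151257664, 167788928, 209782274],
    132, 63040),
  ([91, 12, 99, 126, 112, 65, 5, 70, 45, 62],
    [128, 13856, 90160, 131105, 132098, 268816, 542720, 1082120, 3735584, 4196936, 4198576,
     4211718, 4720640, 5251536, 5374024, 8462472, 8667216, 10551809, 11565068, 12603400,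
     14712834, 16785472, 16826408, 18878498, 19267592, 25198736, 33838272, 34079840, 34867232,
     38797952, 42500100, 67123208, 67764512, 68191360, 68422144, 69226500, 69732384, 101982220,
     121653264, 135004225, 135266596, 138477648, 151011844, 167842313],
    1, 63056),
  ([90, 74, 6, 77, 96, 36, 6, 50, 68, 59],
    [256, 16384, 65672, 131202, 133409, 272904, 557193, 590336, 753968, 786464, 1084610, 1119105,
     3147776, 4200992, 4236309, 6592549, 10502153, 16779337, 16909441, 18882560, 42205568,
     50339840, 67115266, 67191304, 67241344, 67896384, 71598112, 83888176, 83902599, 100663328,
     101974020, 134227520, 134479904, 135282721, 135364624, 136316938, 138608644, 138608651,
     143430150, 151258113, 163717152, 176292096, 201918624, 209748545],
    3, 63072),
  ([126, 55, 24, 71, 92, 33, 3, 47, 102, 7],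
    [5136, 20992, 75851, 262149, 264256, 528448, 1179776, 1311068, 1648736, 2179208, 3408416,
     3760136, 4358304, 4457185, 6574092, 8391700, 9502754, 11012608, 12715016, 16778755,
     16781393, 17342496, 21013032, 25198592, 33554696, 35651600, 35651616, 41955329, 42008576,
     42729984, 50364434, 50465984, 67111553, 70001408, 70254727, 71468292, 72908805, 76549120,
     134349312, 134807681, 135040008, 135266432, 136585224, 140513281],
    1, 63088),
  ([125, 52, 72, 36, 17, 20, 24, 13, 96, 74],
    [128, 4150, 4619, 32768, 32969, 265536, 524565, 532756, 1048896, 1116160, 1179913, 1245217,
     2097152, 2134022, 2172929, 3154064, 4374560, 4759553, 6361120, 8470534, 8980736, 10503280,
     12599810, 14713088, 16787648, 17322000, 17563657, 21497864, 33653507, 33763328, 42730496,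
     42994176, 50661556, 50729504, 69216288, 84934736, 101811492, 102760466, 134219264,
     150999176, 156765220, 159662080, 201360640, 218235008],
    136, 63104),
  ([5, 84, 96, 126, 114, 77, 66, 64, 63, 28],
    [8228, 20562, 131264, 139404, 426408, 526440, 526592, 1054756, 1122328, 1214592, 2416640,
     2426112, 2654728, 3297280, 4330500, 4366592, 5255169, 8913930, 10486852, 17859712, 21004312,
     25170184, 36962368, 37749072, 50398272, 50466818, 67145761, 67244168, 68158209, 68428288,
     69210396, 71303170, 75628544, 83886112, 134285312, 136609926, 138543169, 140546240,
     142688320, 143654915, 151060818, 151129100, 151156736, 201359876],
    2097152, 63120),
  ([72, 28, 77, 23, 99, 106, 34, 103, 43, 52],
    [32816, 74752, 131300, 274466, 1058816, 1246786, 2361416, 4342912, 4721348, 4784641, 6860816,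
     8390849, 8454148, 8650753, 8937474, 9504000, 11542592, 16843776, 17337344, 17858645,
     18374914, 18907176, 20992200, 33554965, 33556481, 33751060, 34611200, 35684352, 35913748,
     67109253, 67109632, 67113987, 67127426, 67405856, 71303680, 80758800, 100665344, 101339648,
     103809050, 134627649, 138445512, 151259200, 168821024, 201867908],
    16384, 63136),
  ([113, 25, 90, 111, 17, 9, 48, 70, 46, 124],
    [648, 1024, 66633, 147457, 263332, 921601, 2143368, 2228480, 2248706, 2262305, 2884646,
     4196360, 4202560, 4210816, 4330608, 5251072, 5771520, 8389984, 8519764, 8687648, 12863763,
     17563654, 18890757, 33685784, 35782848, 37750276, 52953096, 59260928, 67113544, 67113989,
     67379248, 67461120, 67633936, 67764384, 68550708, 75530369, 77398144, 79693826, 83887488,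
     84018178, 134226176, 136118560, 136319777, 204488704],
    1, 63152)]"

lemma batch3: "list_all certified batch3"
  by (simp only: batch3_def certified_eval)

definition batch4 :: "certificate list" where
"batch4 = [
  ([24, 7, 36, 63, 114, 45, 96, 95, 32, 102],
    [532, 65546, 73856, 344104, 532614, 622616, 659474, 1020928, 1048960, 2107392, 2442240,
     2777088, 4358276, 4727872, 5243232, 8405248, 9472002, 10682369, 16810136, 21020673,
     25165957, 25166502, 33556736, 33603602, 33849362, 34091040, 34670732, 44040264, 67108972,
     67652614, 69470473, 71313412, 71336704, 83886081, 84414472, 85990912, 134746432, 134750340,
     136314896, 151536658, 153110024, 167780358, 168304641, 168856704],
    129, 63168),
  ([36, 50, 48, 68, 24, 126, 111, 107, 106, 32],
    [4, 2208, 4360, 66598, 525844, 532772, 590962, 1050736, 1090836, 1122304, 1204352, 2168834,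
     4212736, 4391200, 7473200, 8396904, 8421380, 8474625, 8537120, 9069569, 10756112, 12587200,
     13639712, 16777486, 17957952, 25690178, 33693713, 34160704, 35651586, 35857929, 41976072,
     50598016, 52495360, 67373056, 67670032, 69730433, 71344640, 86017154, 92849152, 134220836,
     136480768, 140510272, 142671905, 169085192],
    128, 63184),
  ([86, 14, 24, 46, 6, 125, 17, 14, 34, 64],
    [322, 24611, 141576, 266817, 545536, 786529, 1049504, 1065994, 1851417, 2146369, 4493320,
     6301700, 6308360, 7375873, 7487488, 8388608, 8717376, 9185280, 9437446, 9472256, 13664264,
     19398800, 20983809, 34738763, 35651648, 35947268, 50332273, 67436550, 68158784, 70256641,
     71336208, 71434370, 72351762, 75514176, 84025856, 134222272, 134291522, 134745090,
     134775812, 135528481, 142606464, 167778560, 201327616, 201875456],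
    9, 63200),
  ([97, 20, 54, 77, 14, 54, 108, 107, 15, 117],
    [20754, 41732, 67096, 132352, 163940, 352257, 524293, 542726, 1089608, 1098816, 1311010,
     2097232, 2134592, 2424872, 5517952, 8406049, 10494984, 16785929, 17056784, 17830944,
     18891296, 20973952, 20979904, 22020142, 33554586, 33818641, 44580873, 50987264, 52559888,
     58722336, 67109680, 67244168, 69469440, 72384544, 84672513, 85987330, 100811008, 134222848,
     134283525, 134529536, 138416416, 139526272, 139797504, 151093256],
    16384, 63216),
  ([48, 104, 89, 92, 5, 46, 113, 56, 36, 76],
    [17541, 23808, 180296, 266316, 459904, 529600, 541960, 802864, 1052673, 1605637, 1642500,
     3933056, 4196416, 4196912, 4259842, 4328064, 6325264, 8389634, 8394882, 8404996, 16778436,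
     16908580, 16941122, 20987909, 21565440, 33620009, 34914440, 36184072, 51119104, 67143809,
     67174408, 67224642, 68158532, 68225025, 73411586, 92275456, 100663318, 134218247, 155205664,
     167789572, 174329888, 184559616, 205522048, 234946754],
    5, 63232),
  ([111, 21, 20, 24, 54, 5, 46, 82, 68, 107],
    [1064, 65536, 135769, 394500, 528457, 656136, 1575296, 1967104, 2234400, 2687010, 3407892,
     4198428, 4198665, 4366352, 4721696, 6307857, 8389253, 9973760, 11558912, 13676560, 16818200,
     18090016, 19137088, 21504002, 33558673, 34603288, 34638080, 37032069, 37748809, 42992672,
     50399233, 50991104, 67407936, 68288672, 75508224, 84148354, 100675648, 134777088, 138446912,
     151012360, 167772174, 167903492, 168820736, 168828930],
    144, 63264),
  ([125, 122, 72, 102, 75, 53, 108, 113, 28, 33],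
    [9290, 9858, 37376, 164864, 329800, 426512, 524297, 530836, 793218, 991232, 1245217, 2097496,
     2801664, 3442756, 4194576, 4458536, 5767168, 8429698, 8683538, 8912900, 9061520, 9963521,
     12592256, 20971528, 25168136, 33554441, 33622784, 33686528, 36741137, 41943042, 51020928,
     67125896, 67178508, 69206053, 69208107, 79692561, 85010944, 138674216, 146817040, 167777536,
     168034913, 201326593, 202375488, 255950848],
    1, 63280),
  ([106, 73, 86, 65, 10, 15, 108, 59, 71, 28],
    [146, 3136, 24640, 34880, 132872, 157184, 180356, 266752, 282922, 2098466, 2116612, 2392584,
     4196354, 5637120, 9601088, 12714546, 16779592, 16908299, 17563929, 19513376, 25202696,
     33558017, 34607113, 34865152, 37750784, 38830081, 42010913, 50462785, 58728450, 60949520,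
     67113482, 69341216, 71319624, 84488448, 100664452, 100704768, 134226704, 134480012,
     134746136, 135333890, 135398464, 135856136, 138977280, 172245012],
    16384, 63296),
  ([12, 64, 126, 77, 113, 89, 43, 13, 54, 93],
    [524, 648, 6146, 102994, 135697, 344098, 458884, 542726, 665604, 1114258, 1576960, 2098760,
     2134056, 2163808, 2891904, 4198665, 4424744, 5308546, 8422400, 8422657, 8912912, 14681120,
     16779306, 16908338, 26476672, 35992576, 50340497, 50341920, 50364512, 51513604, 52694020,
     59834368, 67151360, 67649572, 68682016, 69339168, 100925697, 117440512, 134365196,
     134422787, 155191552, 201654276, 202375808, 209731600],
    16384, 63312)]"

lemma batch4: "list_all certified batch4"
  by (simp only: batch4_def certified_eval)

definition batch5 :: "certificate list" where
"batch5 = [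
  ([126, 52, 60, 30, 106, 126, 43, 36, 79, 46],
    [714, 4105, 17440, 20998, 67712, 147488, 262657, 527360, 1130561, 1704080, 2637896, 4198401,
     4198413, 4207000, 5144833, 8411457, 8454914, 8695873, 8912912, 10505216, 16851040, 17845392,
     18874370, 18890752, 22544392, 33588224, 33653312, 35652116, 67113508, 67134505, 67371010,
     67403809, 76031264, 100667402, 101712912, 134499328, 137953280, 143262274, 143704064,
     144712192, 155230244, 163864576, 167783616, 170016788],
    1, 63328),
  ([120, 64, 96, 34, 92, 80, 33, 46, 110, 120],
    [4, 524, 2377, 4096, 131112, 140432, 528800, 655368, 655371, 1053708, 1377092, 1581450,
     4261954, 8391680, 8916992, 10920448, 11581698, 16828480, 16842754, 17174530, 18092064,
     33587456, 38273024, 50331938, 50594817, 67108929, 67108954, 67384320, 67634176, 67636297,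
     68306434, 83927042, 117571648, 135954528, 136186880, 136319044, 142608257, 145068032,
     146808834, 147324932, 151390238, 159516162, 201326608, 240394240],
    16386, 63344),
  ([45, 103, 123, 10, 111, 48, 46, 35, 12, 118],
    [1196, 8209, 16387, 16641, 18560, 21136, 36992, 394320, 655553, 2328576, 4198484, 4219010,
     4857920, 6902272, 8391008, 8454145, 8519744, 8585744, 8671233, 8946689, 12861568, 13697800,
     17826087, 18939924, 33558656, 33566720, 33622016, 36185093, 36704293, 41975856, 67109569,
     67391784, 75694084, 134258952, 134361600, 136352768, 136396864, 138543122, 142868480,
     146980880, 167791113, 168038562, 173033728, 176427025],
    1, 63360),
  ([40, 32, 89, 9, 60, 92, 71, 64, 89, 35],
    [32, 832, 33091, 67657, 99088, 147601, 174280, 278530, 1119488, 2123792, 2228560, 5259276,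
     8390276, 8519945, 10491905, 10617024, 16778529, 16910676, 17039872, 18120708, 21626881,
     22052868, 25236480, 33554561, 33562886, 33587202, 34353152, 36241664, 42205189, 51905024,
     54788160, 67111106, 67113250, 67322112, 67895332, 77168801, 104874288, 134222882, 137367553,
     142607496, 167911440, 168432768, 177344576, 201867776],
    192, 63376),
  ([111, 52, 27, 51, 36, 36, 123, 74, 77, 70],
    [12624, 37396, 67972, 69634, 200740, 262672, 524294, 540800, 542737, 672016, 803200, 1116355,
     2105736, 2491424, 2621504, 4196356, 4199200, 6308704, 10715456, 13109264, 17052672,
     18940970, 25165893, 33574960, 34121985, 34625536, 35688576, 37818370, 47464704, 50921474,
     59768840, 67635210, 71303424, 73662480, 77070400, 134225972, 134253584, 134875392,
     138453248, 142647328, 143687694, 168296453, 171966532, 201394192],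
    1, 63392),
  ([123, 97, 45, 27, 66, 6, 65, 17, 31, 6],
    [512, 632, 2208, 2336, 24608, 38058, 104721, 131105, 279360, 528453, 590848, 1310724,
     2105680, 3153926, 4195329, 6305922, 6324224, 8553281, 8651776, 8749184, 16793616, 17899672,
     21500928, 26214688, 34078752, 34799617, 36700160, 39846160, 50467144, 67242371, 67343376,
     68161536, 68255793, 69206606, 69265536, 79824961, 101738552, 102761536, 134414336,
     155586816, 167772192, 169640960, 169934864, 235536897],
    1, 63408),
  ([106, 1, 92, 53, 99, 89, 53, 35, 3, 100],
    [769, 41105, 65827, 67600, 86022, 139782, 532808, 2231312, 2381824, 3212320, 4198752,
     4260400, 4325383, 4720640, 4722824, 5245216, 5376512, 6684928, 8980736, 17702912, 25248768,
     33571137, 33949824, 34111500, 34930944, 40114184, 44060960, 67928072, 75506689, 83894812,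
     134217857, 134219814, 134483988, 134743040, 135794696, 136642592, 138511370, 139468832,
     143130629, 150995456, 151027722, 153142273, 201331744, 202379337],
    3, 63424),
  ([77, 104, 114, 12, 24, 80, 9, 7, 101, 122],
    [512, 6308, 10304, 12564, 33824, 65920, 72960, 212992, 263330, 295953, 370432, 533569,
     921608, 2108448, 8423696, 8471072, 8475136, 8536084, 9052164, 9504784, 15990817, 16811376,
     17043585, 17866753, 23068692, 33563009, 34603009, 34898120, 35651609, 67174992, 69533698,
     71631642, 92274722, 134283520, 134758400, 135266468, 136446980, 139481100, 143132704,
     144703553, 168034624, 174097410, 180355080, 243679232],
    5, 63440),
  ([102, 35, 63, 54, 45, 24, 113, 93, 60, 115],
    [1281, 41216, 75156, 81936, 263232, 279142, 328585, 525320, 1114368, 1572866, 2132226,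
     3147793, 4204680, 4243536, 4325888, 5302276, 6816776, 8390912, 8462336, 9050112, 9568385,
     10551296, 11829320, 16778505, 17436836, 17695298, 18874372, 18907301, 24150022, 31469632,
     33697892, 34078755, 35924226, 37771264, 38043824, 41943361, 54659072, 67189008, 67633153,
     67634176, 69222468, 88080384, 136855556, 168562691],
    1, 63456)]"

lemma batch5: "list_all certified batch5"
  by (simp only: batch5_def certified_eval)

definition batch6 :: "certificate list" where
"batch6 = [
  ([54, 67, 113, 65, 34, 30, 53, 1, 101, 56],
    [53512, 66080, 66112, 135433, 164884, 198696, 311816, 541828, 661632, 1050124, 1606208,
     2097392, 2134056, 2163336, 4196864, 4327808, 5505344, 6824192, 8424512, 8438276, 9699588,
     16779292, 16793681, 21102625, 22021136, 25430032, 33620041, 34669072, 36700163, 38273173,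
     48301088, 50400256, 55640076, 67143692, 67436673, 68682112, 70322176, 84410377, 93325312,
     134220480, 142610976, 168165377, 169877508, 171970816],
    5, 63472),
  ([12, 110, 102, 9, 60, 36, 10, 55, 48, 13],
    [4353, 19473, 41288, 131168, 132200, 156736, 197264, 1839616, 2097152, 2097536, 2686976,
     4202560, 4294720, 4297808, 4458496, 6422552, 6820864, 8390670, 8397152, 8462401, 8669186,
     8983040, 9048080, 16793767, 20972640, 21504512, 28050697, 33590288, 34623552, 35651874,
     42018816, 44065284, 67141664, 67141682, 68255748, 77152384, 100671488, 101192004, 134220107,
     134696961, 151158833, 151257728, 153225216, 206573568],
    5, 63488),
  ([108, 124, 86, 53, 57, 101, 54, 48, 112, 95],
    [929, 1664, 6146, 8202, 8705, 50433, 565762, 590216, 688152, 730752, 1142784, 1180672,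
     1278208, 1314912, 2163210, 4270084, 6359048, 8389136, 8392196, 8519832, 16779440, 16908612,
     19824648, 35914324, 42141708, 42536970, 50397220, 60817452, 67108912, 67142792, 67735552,
     76284416, 86016064, 100960290, 105381904, 117440548, 134246402, 134358272, 138448897,
     153094160, 167772167, 167772168, 201490818, 205684736],
    1, 63504),
  ([20, 4, 95, 113, 77, 54, 114, 84, 71, 16],
    [6242, 51329, 68865, 265219, 319492, 541960, 1122370, 2099232, 2110016, 2115584, 2360320,
     2463872, 3278849, 4201474, 4262988, 4358336, 6471680, 8389701, 8421389, 8996898, 9437200,
     16777281, 18896896, 26214403, 33554438, 33570848, 33857537, 33952034, 41992448, 50987009,
     101254144, 109183232, 134251076, 134383361, 134747150, 134750752, 136347713, 137364032,
     139462784, 142868546, 145295872, 155193345, 167774241, 167788816],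
    16384, 63520),
  ([53, 124, 125, 66, 46, 40, 36, 93, 54, 64],
    [304, 2057, 3913, 8387, 65632, 131657, 567808, 731136, 1097764, 1114312, 2162816, 3875845,
     4198402, 4489216, 5505592, 9046528, 16918544, 16924929, 17179184, 19415104, 20980864,
     25362880, 34604098, 34671240, 36704264, 37748864, 50462729, 57671680, 67117571, 67699072,
     69216264, 71305226, 83894532, 86654977, 100730888, 134217728, 134219778, 134219969,
     137363984, 139378688, 139460704, 143130760, 152576132, 167788547],
    1, 63536),
  ([45, 112, 99, 18, 96, 18, 95, 103, 125, 84],
    [2096, 19648, 29056, 131684, 527105, 1048586, 2490881, 2621521, 3195524, 3678464, 8391300,
     8537120, 8728576, 9441664, 9830528, 16781571, 16785667, 16846980, 20185114, 25219588,
     25427977, 33628226, 33751060, 33850496, 33854088, 35653632, 39518720, 41943048, 67108873,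
     67387460, 67682312, 69222433, 71827522, 75506008, 75761152, 100667392, 100698116, 134219780,
     134349312, 134414370, 135794689, 153096194, 167807300, 206176304],
    16384, 63552),
  ([43, 1, 6, 66, 72, 71, 6, 31, 33, 76],
    [16, 128, 266, 522, 32773, 37025, 67621, 131082, 532704, 659490, 672772, 3146761, 4390912,
     6292528, 8398882, 8407232, 8438018, 8553088, 8919065, 9454608, 12715520, 13755393, 18096192,
     20986400, 33554432, 33557060, 33818784, 34111506, 42483716, 42730586, 55641344, 61084672,
     69468228, 71467012, 134390272, 134611136, 134746112, 135334144, 136841218, 138551618,
     144703680, 151298368, 172229120, 209885204],
    16388, 63568),
  ([60, 91, 30, 90, 54, 6, 72, 122, 3, 31],
    [2564, 10304, 12352, 33312, 65604, 166408, 297152, 360968, 527400, 885796, 1049410, 2097284,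
     2372096, 3179534, 4259842, 4342017, 4457588, 6422664, 6897712, 10519616, 12583040, 12583936,
     12648736, 13238561, 16777408, 16781333, 17170438, 25170688, 29525000, 34101248, 67111204,
     67117352, 67387920, 68292736, 70281280, 79708164, 83951681, 119607304, 134549760, 135282694,
     201339922, 201965600, 202899584, 234889217],
    1, 63584),
  ([62, 9, 77, 68, 93, 113, 20, 28, 96, 35],
    [23168, 65938, 262162, 332033, 394000, 409610, 525065, 590596, 657680, 1753472, 2100737,
     2229272, 2433152, 3149968, 3162148, 4194304, 4229633, 5439504, 5832768, 6308480, 8537636,
     10485804, 10551329, 13664356, 16990216, 33555332, 38797600, 67176964, 67633568, 69369888,
     75498532, 79691779, 85983272, 100665362, 134224256, 134514692, 135790592, 136315042,
     136855553, 138412036, 138412424, 142606609, 170657058, 171968768],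
    5, 63600)]"

lemma batch6: "list_all certified batch6"
  by (simp only: batch6_def certified_eval)

definition batch7 :: "certificate list" where
"batch7 = [
  ([75, 13, 106, 17, 89, 15, 68, 70, 96, 19],
    [265, 2178, 16836, 45136, 68992, 264769, 787459, 1051176, 1059844, 1187888, 2097152, 2179330,
     4522017, 5374212, 6356992, 12845076, 16795784, 16812044, 18972688, 25952257, 34084868,
     34883584, 38010920, 41427473, 41945602, 42468416, 54542344, 67176712, 67256480, 67371300,
     67898368, 68225536, 69212212, 71565321, 72351840, 78184448, 84977920, 134218625, 134498308,
     135266441, 138429059, 139724800, 142606400, 201523473],
    3, 63616),
  ([72, 38, 63, 80, 95, 6, 95, 67, 17, 100],
    [176, 35328, 139920, 262694, 530480, 557088, 589888, 672002, 1048993, 1179712, 2109520,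
     2146310, 2179072, 2203816, 2359552, 4199320, 4423736, 8421888, 8781824, 10489880, 16777221,
     17861200, 19138564, 25706512, 33576082, 33653824, 33710088, 35782656, 36720664, 42075168,
     50346560, 67108897, 79757698, 134479873, 134521344, 134760512, 136317571, 136339488,
     138675364, 144704520, 152047617, 163873024, 168304930, 170429440],
    128, 63632),
  ([3, 52, 68, 80, 108, 57, 6, 82, 23, 118],
    [8, 4450, 11052, 137225, 212992, 271377, 720925, 917764, 1048615, 1049152, 1066001, 1245196,
     2097508, 2113888, 2136068, 2249216, 4244496, 4358144, 4456480, 4866176, 5259808, 5383234,
     9441794, 17563792, 17859104, 22160176, 23074816, 25168016, 29622336, 33556529, 34603156,
     46137984, 67375113, 67635460, 71304192, 81821696, 135466112, 151259168, 155779072,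
     163610754, 167777024, 168296577, 184558592, 201465858],
    129, 63648),
  ([72, 42, 60, 60, 72, 99, 71, 37, 18, 74],
    [16808, 16836, 229410, 296001, 536706, 565260, 589831, 1049808, 1180226, 2622020, 3277313,
     4196898, 4243492, 4264008, 6316544, 8388961, 8528388, 12664864, 13762592, 14681216,
     16801936, 19005572, 25206816, 33559555, 33947716, 34605121, 34668808, 35656768, 35657730,
     37752320, 67436561, 68685888, 69484800, 71500800, 75500545, 134220044, 134489120, 135139328,
     137365632, 138446976, 143687744, 151012354, 168562688, 235929604],
    9, 63664),
  ([92, 21, 43, 111, 51, 23, 40, 31, 120, 2],
    [3083, 8225, 10625, 33608, 66660, 135316, 278592, 297476, 410960, 530432, 660356, 2228480,
     2658312, 4526084, 4734979, 6422534, 8402946, 8470600, 14745608, 17907968, 18907296,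
     26216512, 33554465, 33685512, 50594052, 53477776, 67109929, 67240130, 67260432, 67666440,
     67707904, 71307330, 71583744, 73433120, 84018688, 134266880, 134759969, 135283152,
     137888000, 150999060, 168821280, 202113608, 205549824, 243269648],
    1, 63680),
  ([46, 103, 18, 20, 63, 15, 34, 62, 119, 25],
    [261, 2134, 6028, 31744, 131972, 286870, 1130532, 1179649, 2032768, 2234441, 4203008,
     4204547, 5243008, 8388737, 8413441, 8486978, 10634280, 12845320, 21495808, 25509888,
     33558529, 33685637, 33753600, 34095152, 35129420, 35651616, 41943116, 41968128, 42074376,
     68288548, 75800576, 83890305, 84443392, 100682240, 134316092, 134317088, 135283328,
     138413216, 138482176, 139461648, 139722754, 150996036, 176440336, 201343264],
    128, 63696),
  ([95, 91, 68, 114, 3, 92, 20, 16, 72, 103],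
    [14852, 163842, 262153, 524288, 524552, 528416, 655877, 790160, 790534, 1572865, 2105859,
     2654208, 4345857, 5767168, 6291584, 8388676, 8585345, 8912928, 13206532, 16781573, 16842816,
     16846944, 21233952, 23146752, 33563908, 34606256, 35192848, 42078464, 42599429, 50397316,
     50545280, 67111945, 67190790, 72366354, 120064002, 134219396, 134258688, 134390292,
     134758417, 135340194, 136906820, 141033584, 174063680, 203433026],
    1, 63712),
  ([24, 1, 75, 48, 40, 18, 102, 81, 43, 74],
    [16, 176, 512, 68120, 131281, 263424, 532770, 1052937, 2100289, 2179084, 2236688, 4200448,
     4460544, 4718795, 4727300, 5243914, 5263392, 5386240, 7799873, 8929345, 11108364, 16984084,
     21505024, 22022272, 25759768, 33563184, 33570962, 33702416, 34603360, 34750468, 35784708,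
     42467968, 67125264, 69279872, 71303184, 71434784, 75761665, 77074976, 101715984, 134267138,
     135336192, 151257160, 187761952, 209977792],
    130, 63744),
  ([12, 62, 10, 71, 33, 53, 125, 112, 45, 73],
    [521, 1044, 33061, 66641, 112770, 272452, 589843, 1458197, 1572865, 2098208, 2106434,
     3146817, 4199556, 4278336, 6328384, 8462496, 8691978, 12588288, 16787592, 18139152,
     33554465, 33559040, 33628160, 38867972, 39059712, 45224960, 50343944, 59179010, 67111941,
     67444752, 68173824, 69468163, 69748736, 71319572, 84541616, 134219792, 134758684, 134774976,
     135006210, 135332992, 136840196, 138416128, 170464256, 213909508],
    128, 63760)]"

lemma batch7: "list_all certified batch7"
  by (simp only: batch7_def certified_eval)

definition batch8 :: "certificate list" where
"batch8 = [
  ([6, 32, 101, 3, 23, 43, 43, 81, 68, 124],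
    [32, 12580, 43088, 82176, 132376, 270347, 557063, 787788, 2113544, 2638340, 3146008, 3180576,
     4292673, 9707524, 12608512, 16781412, 17831944, 17973766, 18089216, 18924544, 18940418,
     19398785, 25542808, 33655176, 35127872, 36708608, 37756961, 37814792, 50336384, 67117112,
     69224456, 69255824, 100664320, 100679692, 101188609, 134218241, 134316548, 135004193,
     135401728, 138418184, 142614657, 151158816, 168362240, 201328928],
    384, 63776),
  ([2, 99, 77, 106, 94, 40, 20, 62, 80, 110],
    [9734, 70696, 164930, 213124, 264737, 591382, 688128, 1067008, 1069344, 1640464, 2097665,
     2478096, 2648100, 3409921, 4227594, 8392960, 8568840, 8652824, 16784400, 16822274, 18350120,
     23068930, 25493536, 33685704, 35652116, 38077440, 42017280, 42337280, 67895568, 69271809,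
     71305284, 75514896, 83886096, 85065792, 101187744, 134222089, 134357152, 138412177,
     151535617, 167773896, 201327621, 201349129, 202376704, 203424800],
    129, 63808),
  ([24, 74, 30, 75, 10, 101, 102, 101, 61, 86],
    [1174, 4609, 5128, 17920, 18117, 34576, 66688, 524480, 528409, 672032, 696576, 1249792,
     1703936, 4199460, 4784320, 8519936, 8724496, 9175427, 9667586, 16778085, 16793856, 17326208,
     19054592, 19664992, 26222624, 35651588, 35686978, 35930385, 50401281, 67108898, 67291136,
     67305616, 77596964, 79699970, 100925440, 102776884, 134217857, 134226528, 134415368,
     136315944, 164237312, 184549415, 184811528, 210765314],
    16384, 63824),
  ([57, 112, 101, 66, 20, 90, 53, 14, 65, 8],
    [52, 2144, 6169, 32774, 67137, 102920, 131105, 262531, 528386, 593923, 656417, 1179656,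
     1378320, 2097344, 2916960, 4986576, 6558720, 8388608, 8389382, 8407649, 8587328, 16781328,
     16842880, 22020610, 25428064, 33556880, 34668547, 36897920, 44044320, 67142216, 71436416,
     75645328, 107497472, 118759488, 134283266, 135267842, 135268609, 135725216, 136876035,
     150994948, 153358336, 163589120, 168086528, 239599880],
    9, 63840),
  ([18, 28, 36, 66, 101, 80, 75, 67, 34, 62],
    [1, 4105, 6656, 20484, 36914, 67852, 131072, 328237, 533764, 1050208, 1351684, 1359894,
     2490368, 4329552, 5275681, 8409248, 8585473, 8685584, 11542536, 12730384, 16883714,
     16884260, 17039616, 19138048, 21104704, 25970944, 33826564, 37818400, 50331664, 67119109,
     71567392, 76416324, 76546065, 77742272, 79695874, 84148224, 134217875, 134219840, 136577104,
     138417664, 139005458, 139464832, 143172672, 193077264],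
    1152, 63856),
  ([101, 117, 57, 30, 90, 120, 86, 124, 106, 94],
    [35, 1537, 2184, 3200, 10661, 16432, 66316, 81952, 348224, 525385, 665734, 1294346, 1311232,
     2656536, 3153940, 8390154, 8405248, 8441984, 8519688, 8594449, 8945669, 16875520, 18939937,
     19665412, 33562914, 33564164, 33669136, 33720352, 35913738, 36175872, 46563332, 52462092,
     67110049, 67191298, 67510336, 69862406, 134222928, 142607360, 151099520, 159383552,
     159385632, 180367364, 208961536, 220212224],
    1, 63872),
  ([23, 59, 90, 23, 92, 89, 99, 115, 43, 103],
    [35, 8352, 10645, 26629, 32777, 37893, 134224, 139520, 299008, 393280, 413698, 476544,
     1050890, 2099456, 2099712, 3410082, 5259304, 5767688, 6310144, 7882240, 11011136, 16785953,
     16843521, 16946193, 17974272, 29360148, 33703937, 33948176, 34636064, 42074117, 46145540,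
     67117194, 69738497, 76546048, 85983492, 88227840, 100806728, 101196300, 134217818,
     136646736, 167903492, 168493056, 204210176, 251659281],
    1, 63888),
  ([120, 50, 53, 111, 101, 96, 101, 52, 71, 56],
    [289, 8960, 33602, 147488, 180864, 192512, 262215, 294913, 541232, 643712, 688148, 1051272,
     1314816, 1720369, 2196482, 4195649, 6357505, 8393776, 16786568, 16827394, 19136522,
     25165897, 33554504, 33555457, 33555712, 38012992, 50856452, 67162368, 67240448, 67765252,
     68161829, 69255176, 72615042, 76687368, 100860425, 142609024, 142869024, 152043585,
     167772181, 167837826, 186647552, 203437568, 228589633, 234971168],
    1, 63904)]"

lemma batch8: "list_all certified batch8"
  by (simp only: batch8_def certified_eval)

definition code_table :: "certificate list" where
  "code_table = batch1 @ batch2 @ batch3 @ batch4 @ batch5 @ batch6 @ batch7 @ batch8"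

text \<open>One seventh of the pair energy.\<close>

fun claimed_energy :: "certificate \<Rightarrow> nat" where
  "claimed_energy (fs, ws, u, tot) = tot"

lemma all_certified: "c \<in> set code_table \<Longrightarrow> certified c"
proof -
  have "list_all certified code_table"
    by (simp only: code_table_def list_all_append batch1 batch2 batch3 batch4 batch5 batch6 batch7 batch8 simp_thms)
  then show "c \<in> set code_table \<Longrightarrow> certified c" by (simp add: list_all_iff)
qed

lemma ascending_energies: "ascending (map claimed_energy code_table)"
  by (simp only: code_table_def batch1_def batch2_def batch3_def batch4_def batch5_def batch6_def batch7_def batch8_def append.simps
      list.map claimed_energy.simps ascending.simps numeral_less_iff less_num_simps le_num_simps simp_thms)

lemma card_code_table: "card (set code_table) = 71"
proof -
  have "distinct (map claimed_energy code_table)"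
    using ascending_sound[OF ascending_energies] strict_sorted_iff by blast
  then have "card (set code_table) = length code_table"
    by (intro distinct_card) (simp only: distinct_map)
  also have "\<dots> = 71"
    by (simp add: code_table_def batch1_def batch2_def batch3_def batch4_def batch5_def batch6_def batch7_def batch8_def)
  finally show ?thesis .
qed

lemma inj_claimed_energy: "inj_on claimed_energy (set code_table)"
  using ascending_sound[OF ascending_energies] strict_sorted_iff distinct_map by blast

theorem proposition4:
  "\<exists>F :: (bit ^ 56) set set.
     71 \<le> card F \<and>
     (\<forall>C\<in>F. is_code 56 28 10 C \<and> self_dual C \<and> singly_even C \<and> s_extremal C) \<and>
     pairwise (\<lambda>C D. \<not> code_equiv C D) F"
proof -
  let ?code = "\<lambda>c :: certificate. circulant_code (fst c)"
  have props: "is_code 56 28 10 (?code c) \<and> self_dual (?code c) \<and> singly_even (?code c) \<and> s_extremal (?code c)"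
    and energy: "pair_energy (?code c) = 7 * claimed_energy c" if "c \<in> set code_table" for c
  proof -
    obtain fs ws u tot where c: "c = (fs, ws, u, tot)" by (cases c)
    then have "certified (fs, ws, u, tot)" using all_certified[OF that] by simp
    from certified_sound[OF this]
    show "is_code 56 28 10 (?code c) \<and> self_dual (?code c) \<and> singly_even (?code c) \<and> s_extremal (?code c)"
      and "pair_energy (?code c) = 7 * claimed_energy c"
      by (simp_all only: c fst_conv claimed_energy.simps)
  qed
  have equiv: "c = c'" if "c \<in> set code_table" "c' \<in> set code_table"
    "pair_energy (?code c) = pair_energy (?code c')" for c c'
  proof -
    have "claimed_energy c = claimed_energy c'"
      using that(3) by (simp add: energy[OF that(1)] energy[OF that(2)])
    then show ?thesis using inj_claimed_energy that(1,2) by (simp add: inj_on_eq_iff)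
  qed
  have "inj_on ?code (set code_table)"
    by (rule inj_onI) (rule equiv, simp_all)
  then have "card (?code ` set code_table) = 71"
    by (simp only: card_image card_code_table)
  moreover have "\<forall>C\<in>?code ` set code_table.
      is_code 56 28 10 C \<and> self_dual C \<and> singly_even C \<and> s_extremal C"
    using props by blast
  moreover have "pairwise (\<lambda>C D. \<not> code_equiv C D) (?code ` set code_table)"
  proof (rule pairwiseI)
    fix C D assume C: "C \<in> ?code ` set code_table" and D: "D \<in> ?code ` set code_table" and "C \<noteq> D"
    show "\<not> code_equiv C D"
    proof
      assume "code_equiv C D"
      then have "pair_energy C = pair_energy D" by (rule pair_energy_equiv)
      then show False using C D \<open>C \<noteq> D\<close> equiv by blast
    qed
  qed
  ultimately show ?thesis
    by (intro exI[of _ "?code ` set code_table"]) simp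
qed

end
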